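(* Let $\mathscr{F}$ be a codimension one $\mathscr{L}$-foliation on $\mathbf{C}\mathbf{P}(n)$ associated with the Lie subalgebra $\mathscr{L}\subset\chi(\mathbf{C}\mathbf{P}(n))$. If $\mathscr{L}$ is semi-simple, or more generally if $[\mathscr{L},\mathscr{L}]=\mathscr{L}$, then $\mathscr{F}$ has a (non-constant) rational first integral.
   Context: A codimension one foliation $\mathscr{F}$ on $\mathbf{C}\mathbf{P}(n)$ is given in homogeneous coordinates by a $1$-form $\omega=\sum_{k=0}^nA_kdz_k$ on $\mathbf{C}^{n+1}$, with $A_k$ homogeneous polynomials of the same degree, $\omega\wedge d\omega=0$, $\sum z_kA_k=0$, and $\{A_0=\dots=A_n=0\}$ of codimension $\geq2$. Let $\chi(\mathbf{C}\mathbf{P}(n))$ be the Lie algebra of holomorphic vector fields on $\mathbf{C}\mathbf{P}(n)$. $\mathscr{F}$ is an $\mathscr{L}$-foliation (associated with $\mathscr{L}$) if $\mathscr{L}\subset\chi(\mathbf{C}\mathbf{P}(n))$ is a Lie subalgebra such that, for generic $z$, $\mathscr{L}(z)=\{X(z):X\in\mathscr{L}\}$ is the tangent space at $z$ to the leaf of $\mathscr{F}$ (so it has dimension $n-1$); $\mathscr{L}$ is always taken maximal for this property, i.e. it is the algebra of all holomorphic vector fields on $\mathbf{C}\mathbf{P}(n)$ tangent to $\mathscr{F}$. *)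

theory Defs
  imports "HOL-Analysis.Analysis" "HOL-Library.Function_Algebras"
begin

text \<open>
  Homogeneous coordinates on \<open>CP(n)\<close> are indexed by a finite type \<open>'n\<close> with \<open>CARD('n) = n + 1\<close>.
  Points of \<open>CP(n)\<close> are represented by nonzero vectors of \<open>complex^'n\<close> up to scaling.
\<close>

subsection \<open>Polynomials and the Zariski topology\<close>

text \<open>As \<open>\<complex>\<close> is infinite, polynomials are identified with polynomial functions.\<close>

definition monomial_fun :: "('n::finite \<Rightarrow> nat) \<Rightarrow> complex^'n \<Rightarrow> complex" where
  "monomial_fun \<alpha> z = (\<Prod>i\<in>UNIV. (z $ i) ^ \<alpha> i)"

definition poly_fun :: "(complex^'n::finite \<Rightarrow> complex) \<Rightarrow> bool" where
  "poly_fun f \<longleftrightarrow>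
    (\<exists>d c. \<forall>z. f z = (\<Sum>\<alpha> | (\<Sum>i\<in>UNIV. \<alpha> i) \<le> d. c \<alpha> * monomial_fun \<alpha> z))"

definition hom_poly_fun :: "nat \<Rightarrow> (complex^'n::finite \<Rightarrow> complex) \<Rightarrow> bool" where
  "hom_poly_fun d f \<longleftrightarrow>
    (\<exists>c. \<forall>z. f z = (\<Sum>\<alpha> | (\<Sum>i\<in>UNIV. \<alpha> i) = d. c \<alpha> * monomial_fun \<alpha> z))"

definition zariski_closed :: "(complex^'n::finite) set \<Rightarrow> bool" where
  "zariski_closed Z \<longleftrightarrow> (\<exists>F. (\<forall>f\<in>F. poly_fun f) \<and> Z = {z. \<forall>f\<in>F. f z = 0})"

definition irreducible_closed :: "(complex^'n::finite) set \<Rightarrow> bool" where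
  "irreducible_closed Y \<longleftrightarrow> zariski_closed Y \<and> Y \<noteq> {} \<and>
    (\<forall>Y1 Y2. zariski_closed Y1 \<and> zariski_closed Y2 \<and> Y = Y1 \<union> Y2 \<longrightarrow> Y = Y1 \<or> Y = Y2)"

text \<open>
  The codimension of a closed \<open>Z\<close> is the infimum, over the irreducible closed \<open>Y \<subseteq> Z\<close>, of the
  supremum of the lengths of the chains of irreducible closed sets starting at \<open>Y\<close>.
\<close>

definition codim_at_least :: "nat \<Rightarrow> (complex^'n::finite) set \<Rightarrow> bool" where
  "codim_at_least m Z \<longleftrightarrow>
    (\<forall>Y. irreducible_closed Y \<and> Y \<subseteq> Z \<longrightarrow>
      (\<exists>C :: nat \<Rightarrow> (complex^'n) set. C 0 = Y \<and> (\<forall>k\<le>m. irreducible_closed (C k)) \<and>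
        (\<forall>k<m. C k \<subset> C (Suc k))))"

text \<open>
  Generic points of \<open>CP(n)\<close>: every proper Zariski closed subset of \<open>CP(n)\<close> is contained in one
  of the form \<open>g = 0\<close> with \<open>g\<close> a nonzero homogeneous polynomial.
\<close>

definition generically :: "(complex^'n::finite \<Rightarrow> bool) \<Rightarrow> bool" where
  "generically P \<longleftrightarrow>
    (\<exists>d g. hom_poly_fun d g \<and> (\<exists>z. g z \<noteq> 0) \<and> (\<forall>z. z \<noteq> 0 \<and> g z \<noteq> 0 \<longrightarrow> P z))"

subsection \<open>Differential forms\<close>

definition dir_deriv :: "(complex^'n::finite \<Rightarrow> complex) \<Rightarrow> complex^'n \<Rightarrow> complex^'n \<Rightarrow> complex" where
  "dir_deriv f z v = deriv (\<lambda>t. f (z + t *s v)) 0"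

text \<open>\<open>A\<close> stands for the 1-form \<open>\<omega> = \<Sum>\<^sub>k A\<^sub>k dz\<^sub>k\<close>; \<open>ext_deriv A\<close> is \<open>d\<omega>\<close>.\<close>

definition one_form :: "(complex^'n::finite \<Rightarrow> complex^'n) \<Rightarrow> complex^'n \<Rightarrow> complex^'n \<Rightarrow> complex" where
  "one_form A z v = (\<Sum>k\<in>UNIV. A z $ k * v $ k)"

definition ext_deriv ::
  "(complex^'n::finite \<Rightarrow> complex^'n) \<Rightarrow> complex^'n \<Rightarrow> complex^'n \<Rightarrow> complex^'n \<Rightarrow> complex" where
  "ext_deriv A z u v =
    (\<Sum>k\<in>UNIV. dir_deriv (\<lambda>x. A x $ k) z u * v $ k - dir_deriv (\<lambda>x. A x $ k) z v * u $ k)"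

definition wedge11 :: "('v \<Rightarrow> complex) \<Rightarrow> ('v \<Rightarrow> complex) \<Rightarrow> 'v \<Rightarrow> 'v \<Rightarrow> complex" where
  "wedge11 \<alpha> \<beta> u v = \<alpha> u * \<beta> v - \<alpha> v * \<beta> u"

definition wedge12 :: "('v \<Rightarrow> complex) \<Rightarrow> ('v \<Rightarrow> 'v \<Rightarrow> complex) \<Rightarrow> 'v \<Rightarrow> 'v \<Rightarrow> 'v \<Rightarrow> complex" where
  "wedge12 \<alpha> \<beta> u v w = \<alpha> u * \<beta> v w - \<alpha> v * \<beta> u w + \<alpha> w * \<beta> u v"

subsection \<open>Codimension one foliations\<close>

definition codim_one_foliation :: "(complex^'n::finite \<Rightarrow> complex^'n) \<Rightarrow> bool" where
  "codim_one_foliation A \<longleftrightarrow>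
    (\<exists>d. \<forall>k. hom_poly_fun d (\<lambda>z. A z $ k)) \<and>
    (\<forall>z u v w. wedge12 (one_form A z) (ext_deriv A z) u v w = 0) \<and>
    (\<forall>z. (\<Sum>k\<in>UNIV. z $ k * A z $ k) = 0) \<and>
    codim_at_least 2 {z. A z = 0}"

text \<open>
  A rational function on \<open>CP(n)\<close> is a quotient \<open>P / Q\<close> of homogeneous polynomials of the same
  degree; it is a first integral if \<open>\<omega> \<and> d(P/Q) = 0\<close> wherever it is defined.
\<close>

definition has_rational_first_integral :: "(complex^'n::finite \<Rightarrow> complex^'n) \<Rightarrow> bool" where
  "has_rational_first_integral A \<longleftrightarrow>
    (\<exists>d P Q. hom_poly_fun d P \<and> hom_poly_fun d Q \<and> (\<exists>z. Q z \<noteq> 0) \<and>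
      \<not> (\<exists>c. \<forall>z. Q z \<noteq> 0 \<longrightarrow> P z / Q z = c) \<and>
      (\<forall>z u v. Q z \<noteq> 0 \<longrightarrow> wedge11 (one_form A z) (dir_deriv (\<lambda>x. P x / Q x) z) u v = 0))"

subsection \<open>Holomorphic vector fields on projective space\<close>

definition holomorphic_map_on :: "(complex^'n::finite \<Rightarrow> complex^'n) \<Rightarrow> (complex^'n) set \<Rightarrow> bool" where
  "holomorphic_map_on f S \<longleftrightarrow>
    (\<forall>z\<in>S. \<exists>D. (f has_derivative D) (at z) \<and> (\<forall>c v. D (c *s v) = c *s D v))"

text \<open>
  A vector field \<open>X\<close> on \<open>CP(n)\<close> is given by its expressions in the standard affine charts
  \<open>z\<^sub>i \<noteq> 0\<close>. The tangent space at \<open>[z]\<close> is the quotient of \<open>complex^'n\<close> by the line of \<open>z\<close>, where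
  \<open>v\<close> at \<open>z\<close> and \<open>c v\<close> at \<open>c z\<close> define the same tangent vector. In chart \<open>i\<close> each class has a unique
  representative \<open>X i z\<close> with vanishing \<open>i\<close>-th component, and the component of \<open>X\<close> along the
  affine coordinate \<open>z\<^sub>j / z\<^sub>i\<close> is \<open>X i z $ j / z $ i\<close>. The expressions in the charts \<open>i\<close> and \<open>j\<close> must
  agree modulo \<open>z\<close>. Outside of the chart, \<open>X i z\<close> is set to 0, so that equal vector fields are
  equal as functions.
\<close>

type_synonym 'n vfield = "'n \<Rightarrow> complex^'n \<Rightarrow> complex^'n"

definition holo_vfields :: "'n::finite vfield set" where
  "holo_vfields = {X.
    (\<forall>i. holomorphic_map_on (X i) {z. z $ i \<noteq> 0}) \<and>
    (\<forall>i z. z $ i \<noteq> 0 \<longrightarrow> X i z $ i = 0) \<and>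
    (\<forall>i z c. z $ i \<noteq> 0 \<and> c \<noteq> 0 \<longrightarrow> X i (c *s z) = c *s X i z) \<and>
    (\<forall>i j z. z $ i \<noteq> 0 \<and> z $ j \<noteq> 0 \<longrightarrow> (\<exists>c. X j z = X i z + c *s z)) \<and>
    (\<forall>i z. z $ i = 0 \<longrightarrow> X i z = 0)}"

definition vf_scale :: "complex \<Rightarrow> 'n::finite vfield \<Rightarrow> 'n vfield" where
  "vf_scale c X = (\<lambda>i z. c *s X i z)"

interpretation vf: vector_space vf_scale
  by unfold_locales
    (simp_all add: vf_scale_def fun_eq_iff vec_eq_iff algebra_simps)

definition lie_bracket :: "'n::finite vfield \<Rightarrow> 'n vfield \<Rightarrow> 'n vfield" where
  "lie_bracket X Y = (\<lambda>i z. if z $ i = 0 then 0 else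
    (\<chi> k. dir_deriv (\<lambda>x. Y i x $ k) z (X i z) - dir_deriv (\<lambda>x. X i x $ k) z (Y i z)))"

definition lie_subalgebra :: "'n::finite vfield set \<Rightarrow> bool" where
  "lie_subalgebra L \<longleftrightarrow> L \<subseteq> holo_vfields \<and> vf.subspace L \<and> (\<forall>X\<in>L. \<forall>Y\<in>L. lie_bracket X Y \<in> L)"

definition derived_algebra :: "'n::finite vfield set \<Rightarrow> 'n vfield set" where
  "derived_algebra L = vf.span {lie_bracket X Y | X Y. X \<in> L \<and> Y \<in> L}"

definition lie_ideal :: "'n::finite vfield set \<Rightarrow> 'n vfield set \<Rightarrow> bool" where
  "lie_ideal J L \<longleftrightarrow> J \<subseteq> L \<and> vf.subspace J \<and> (\<forall>X\<in>L. \<forall>Y\<in>J. lie_bracket X Y \<in> J)"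

definition simple_lie :: "'n::finite vfield set \<Rightarrow> bool" where
  "simple_lie L \<longleftrightarrow> lie_subalgebra L \<and> (\<exists>X\<in>L. \<exists>Y\<in>L. lie_bracket X Y \<noteq> 0) \<and>
    (\<forall>J. lie_ideal J L \<longrightarrow> J = {0} \<or> J = L)"

text \<open>Semi-simple: a finite direct sum of simple ideals.\<close>

definition semisimple_lie :: "'n::finite vfield set \<Rightarrow> bool" where
  "semisimple_lie L \<longleftrightarrow> lie_subalgebra L \<and>
    (\<exists>S. finite S \<and> (\<forall>I\<in>S. lie_ideal I L \<and> simple_lie I) \<and> vf.span (\<Union>S) = L \<and>
      (\<forall>I\<in>S. I \<inter> vf.span (\<Union>(S - {I})) = {0}))"

subsection \<open>Foliations associated with a Lie algebra of vector fields\<close>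

text \<open>Tangent space at a regular point \<open>[z]\<close> to the leaf, in chart \<open>i\<close>.\<close>

definition leaf_tangent :: "(complex^'n::finite \<Rightarrow> complex^'n) \<Rightarrow> 'n \<Rightarrow> complex^'n \<Rightarrow> (complex^'n) set" where
  "leaf_tangent A i z = {v. v $ i = 0 \<and> one_form A z v = 0}"

definition tangent_vfields :: "(complex^'n::finite \<Rightarrow> complex^'n) \<Rightarrow> 'n vfield set" where
  "tangent_vfields A =
    {X \<in> holo_vfields. \<forall>i z. z $ i \<noteq> 0 \<longrightarrow> one_form A z (X i z) = 0}"

definition L_foliation :: "(complex^'n::finite \<Rightarrow> complex^'n) \<Rightarrow> 'n vfield set \<Rightarrow> bool" where
  "L_foliation A L \<longleftrightarrow> codim_one_foliation A \<and> lie_subalgebra L \<and>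
    generically (\<lambda>z. A z \<noteq> 0 \<and>
      (\<forall>i. z $ i \<noteq> 0 \<longrightarrow> (\<lambda>X. X i z) ` L = leaf_tangent A i z)) \<and>
    L = tangent_vfields A"

end

theory Submission
  imports Defs "HOL-Complex_Analysis.Cauchy_Integral_Formula"
    "HOL-Computational_Algebra.Fundamental_Theorem_Algebra"
begin

text \<open>
  The vector fields of the foliation become linear on the space of homogeneous coordinates: every
  holomorphic vector field on projective space is induced by a matrix (\<open>holo_vfield_linear\<close>, by
  Liouville's theorem in the charts). Let \<open>g\<close> be the Lie algebra of all matrices, scalars included,
  that induce elements of \<open>L\<close>. Since \<open>\<omega>\<close> vanishes on \<open>M z\<close> for \<open>M \<in> g\<close>, and generically these
  vectors fill the kernel of \<open>\<omega>\<close>, the theorem amounts to finding two homogeneous polynomials of the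
  same degree whose quotient is not constant and is annihilated by \<open>g\<close>.

  Perfectness enters through the algebraicity of the orbits. A generalized eigenvector of \<open>ad X\<close> for
  a nonzero eigenvalue is a nilpotent matrix, and modulo the ideal spanned by these matrices every
  \<open>ad X\<close> is nilpotent. So, by Engel's theorem, a perfect Lie algebra is spanned by them
  (\<open>perfect_spanned_by_roots\<close>, which allows for the scalars in \<open>g\<close>). The flow of a nilpotent matrix
  is polynomial in time. Composing as many flows of nilpotent elements of \<open>g\<close> as
  the leaves of the cone have dimensions besides the radial one, one gets a map \<open>\<Phi>(t, z)\<close> that is
  polynomial in \<open>t\<close>, linear in \<open>z\<close>, and whose image, together with the radial direction, is
  generically tangent to all of \<open>g\<close>.

  There are \<open>card - 2\<close> times, where \<open>card\<close> is the number of homogeneous coordinates. Counting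
  monomials, there must be a nonzero polynomial \<open>F(z, x)\<close>, homogeneous of degree \<open>m\<close> in both
  arguments, with \<open>F(z, \<Phi>(t, z)) = 0\<close> identically (\<open>ex_flow_relation\<close>): the number of unknowns grows
  like \<open>m\<close> to the power \<open>2 (card - 1)\<close>, the number of equations only like \<open>m\<close> to the power
  \<open>2 (card - 1) - 1\<close>. By tangency, \<open>F(z, \<sqdot>)\<close> then vanishes at \<open>z\<close>, for all \<open>z\<close> in some open
  set, together with all its iterated derivatives along \<open>g\<close> (\<open>orbit_relation_of_flow_relation\<close>).

  Among such relations \<open>F(z, x) = \<Sum> p_\<alpha>(z) x^\<alpha>\<close> take one with the fewest nonzero coefficients
  \<open>p_\<alpha>\<close>. Differentiating the \<open>p_\<alpha>\<close> along \<open>g\<close> gives relations again, and eliminating one coefficient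
  shows by minimality that all quotients \<open>p_\<alpha> / p_\<beta>\<close> are annihilated by \<open>g\<close>. They are not all
  constant, because the monomials are linearly independent (\<open>invariant_ratio_of_relation\<close>). One of
  them is the first integral.
\<close>

section \<open>Matrices and commutators\<close>

text \<open>
  Dimension arguments below use the real vector space structure of the type of matrices, so complex
  multiples need an operation of their own.
\<close>
definition cscale :: "complex \<Rightarrow> complex^'n^'m \<Rightarrow> complex^'n^'m" where
  "cscale c M = (\<chi> i j. c * M $ i $ j)"

definition comm :: "complex^'n^'n \<Rightarrow> complex^'n^'n \<Rightarrow> complex^'n^'n" where
  "comm M N = M ** N - N ** M"

lemma cscale_simps [simp]:
  "cscale c (M + N) = cscale c M + cscale c N"
  "cscale c (M - N) = cscale c M - cscale c N"
  "cscale c (- M) = - cscale c M"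
  "cscale (- c) M = - cscale c M" "cscale c 0 = 0" "cscale 0 M = 0" "cscale 1 M = M"
  "cscale c (cscale d M) = cscale (c * d) M"
  by (simp_all add: cscale_def vec_eq_iff algebra_simps)

lemma cscale_add_left: "cscale (c + d) M = cscale c M + cscale d M"
  by (simp add: cscale_def vec_eq_iff algebra_simps)

lemma cscale_diff_left: "cscale (c - d) M = cscale c M - cscale d M"
  by (simp add: cscale_def vec_eq_iff algebra_simps)

lemma scaleR_eq_cscale: "r *\<^sub>R M = cscale (of_real r) M"
  by (simp add: cscale_def vec_eq_iff scaleR_conv_of_real[where 'a=complex])

lemma cscale_sum: "cscale c (sum f I) = (\<Sum>i\<in>I. cscale c (f i))"
  by (induction I rule: infinite_finite_induct) auto

lemma cscale_eq_0_iff: "cscale c M = 0 \<longleftrightarrow> c = 0 \<or> M = 0"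
  by (auto simp: cscale_def vec_eq_iff)

lemma cscale_mult [simp]:
  "cscale c M ** N = cscale c (M ** N)" "M ** cscale c N = cscale c (M ** N)"
  by (simp_all add: cscale_def matrix_matrix_mult_def vec_eq_iff sum_distrib_left algebra_simps)

lemma cscale_mult_vec [simp]: "cscale c M *v z = c *s (M *v z)"
  by (simp add: cscale_def matrix_vector_mult_def vec_eq_iff sum_distrib_left algebra_simps)

lemma matrix_add_rdistrib: "(B + C) ** A = B ** A + C ** (A :: complex^'n^'n)"
  by (simp add: matrix_matrix_mult_def vec_eq_iff sum.distrib algebra_simps)

lemma matrix_diff_mult:
  fixes A B C :: "complex^'n^'n"
  shows "A ** (B - C) = A ** B - A ** C" "(B - C) ** A = B ** A - C ** A"
  by (simp_all add: matrix_matrix_mult_def vec_eq_iff sum_subtractf algebra_simps)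

lemma matrix_sum_mult:
  fixes A :: "complex^'n^'n"
  shows "A ** sum f I = (\<Sum>i\<in>I. A ** f i)" "sum f I ** A = (\<Sum>i\<in>I. f i ** A)"
  by (induction I rule: infinite_finite_induct)
     (simp_all add: matrix_add_ldistrib matrix_add_rdistrib)

lemma mat_1_neq_0: "mat 1 \<noteq> (0 :: complex^'n^'n)"
proof
  fix i :: 'n
  assume "mat 1 = (0 :: complex^'n^'n)"
  then have "(mat 1 :: complex^'n^'n) $ i $ i = 0" by simp
  then show False by (simp add: mat_def)
qed

lemmas matrix_distribs = matrix_add_ldistrib matrix_add_rdistrib matrix_diff_mult
  matrix_mul_assoc[symmetric]

lemma comm_simps [simp]:
  "comm (M + M') N = comm M N + comm M' N" "comm M (N + N') = comm M N + comm M N'"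
  "comm (M - M') N = comm M N - comm M' N" "comm M (N - N') = comm M N - comm M N'"
  "comm (cscale c M) N = cscale c (comm M N)" "comm M (cscale c N) = cscale c (comm M N)"
  "comm 0 N = 0" "comm M 0 = 0" "comm M M = 0" "comm (mat 1) M = 0" "comm M (mat 1) = 0"
  by (simp_all add: comm_def matrix_distribs algebra_simps)

lemma comm_scaleR [simp]: "comm (r *\<^sub>R M) N = r *\<^sub>R comm M N" "comm M (r *\<^sub>R N) = r *\<^sub>R comm M N"
  by (simp_all add: scaleR_eq_cscale)

lemma comm_anti: "comm M N = - comm N M"
  by (simp add: comm_def)

lemma jacobi: "comm A (comm B C) = comm (comm A B) C + comm B (comm A C)"
  by (simp add: comm_def matrix_distribs)

lemma linear_comm: "linear (comm X)" "linear (\<lambda>Y. comm Y X)"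
  by (auto intro!: linearI)

lemma span_image_subset:
  assumes "linear f" "\<And>x. x \<in> A \<Longrightarrow> f x \<in> span B" "x \<in> span A"
  shows "f x \<in> span B"
  using assms(3)
proof (induction rule: span_induct_alt)
  case base then show ?case using linear_0[OF assms(1)] by (simp add: span_zero)
next
  case (step c x y) then show ?case
    using assms(1,2) by (simp add: linear_add linear_cmul span_add span_scale)
qed

section \<open>Generalized eigenvectors of the adjoint action\<close>

definition ad_shift :: "complex^'n^'n \<Rightarrow> complex \<Rightarrow> complex^'n^'n \<Rightarrow> complex^'n^'n" where
  "ad_shift X \<alpha> Z = comm X Z - cscale \<alpha> Z"

lemma ad_shift_simps [simp]:
  "ad_shift X \<alpha> (Y + Z) = ad_shift X \<alpha> Y + ad_shift X \<alpha> Z"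
  "ad_shift X \<alpha> (Y - Z) = ad_shift X \<alpha> Y - ad_shift X \<alpha> Z"
  "ad_shift X \<alpha> (cscale c Y) = cscale c (ad_shift X \<alpha> Y)"
  "ad_shift X \<alpha> 0 = 0"
  by (simp_all add: ad_shift_def mult.commute)

lemma ad_shift_pow_simps [simp]:
  "(ad_shift X \<alpha> ^^ e) (Y + Z) = (ad_shift X \<alpha> ^^ e) Y + (ad_shift X \<alpha> ^^ e) Z"
  "(ad_shift X \<alpha> ^^ e) (Y - Z) = (ad_shift X \<alpha> ^^ e) Y - (ad_shift X \<alpha> ^^ e) Z"
  "(ad_shift X \<alpha> ^^ e) (cscale c Y) = cscale c ((ad_shift X \<alpha> ^^ e) Y)"
  "(ad_shift X \<alpha> ^^ e) 0 = 0"
  by (induction e) auto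

lemma ad_shift_zero: "ad_shift X 0 = comm X"
  by (auto simp: ad_shift_def)

lemma ad_shift_commute: "ad_shift X \<alpha> (ad_shift X \<beta> Z) = ad_shift X \<beta> (ad_shift X \<alpha> Z)"
  by (simp add: ad_shift_def algebra_simps)

lemma ad_shift_mult: "ad_shift X (\<alpha> + \<beta>) (Y ** Z) = ad_shift X \<alpha> Y ** Z + Y ** ad_shift X \<beta> Z"
  by (simp add: ad_shift_def comm_def matrix_distribs cscale_add_left)

lemma ad_shift_comm:
  "ad_shift X (\<alpha> + \<beta>) (comm Y Z) = comm (ad_shift X \<alpha> Y) Z + comm Y (ad_shift X \<beta> Z)"
  by (simp add: ad_shift_def jacobi[of X Y Z] cscale_add_left)

text \<open>
  Iterating the Leibniz rule, the power \<open>a + b\<close> of \<open>D\<close> at \<open>B y z\<close> is a combination of terms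
  \<open>B (D1^i y) (D2^j z)\<close> with \<open>i + j = a + b\<close>, so \<open>i \<ge> a\<close> or \<open>j \<ge> b\<close>. Hence generalized eigenvalues of
  \<open>ad X\<close> add up, both under the product and under the commutator of matrices.
\<close>
lemma funpow_leibniz:
  fixes D :: "'a::ab_group_add \<Rightarrow> 'a"
  assumes D: "\<And>y z. D (B y z) = B (D1 y) z + B y (D2 z)"
    and add: "\<And>x y. D (x + y) = D x + D y"
    and B0: "\<And>z. B 0 z = 0" "\<And>y. B y 0 = 0"
  shows "(D1 ^^ a) y = 0 \<Longrightarrow> (D2 ^^ b) z = 0 \<Longrightarrow> (D ^^ (a + b)) (B y z) = 0"
proof (induction "a + b" arbitrary: a b y z)
  case 0 then show ?case by (simp add: B0)
next
  case (Suc n)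
  have D0: "D 0 = 0" using add[of 0 0] by simp
  have pow_add: "(D ^^ k) (x + y) = (D ^^ k) x + (D ^^ k) y" for k x y
    by (induction k) (auto simp: add)
  have pow_0: "(D ^^ k) 0 = 0" for k by (induction k) (auto simp: D0)
  show ?case
  proof (cases "a = 0 \<or> b = 0")
    case True
    then show ?thesis using Suc.prems by (auto simp: B0 pow_0)
  next
    case False
    then obtain a' b' where ab: "a = Suc a'" "b = Suc b'" by (meson not0_implies_Suc)
    have 1: "(D ^^ (a' + b)) (B (D1 y) z) = 0"
      using Suc.prems ab Suc.hyps by (intro Suc.hyps(1)) (auto simp: funpow_swap1)
    have 2: "(D ^^ (a + b')) (B y (D2 z)) = 0"
      using Suc.prems ab Suc.hyps by (intro Suc.hyps(1)) (auto simp: funpow_swap1)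
    have "(D ^^ (a + b)) (B y z) = (D ^^ n) (D (B y z))"
      using Suc.hyps(2) by (metis funpow_Suc_right o_apply)
    also have "\<dots> = (D ^^ (a' + b)) (B (D1 y) z) + (D ^^ (a + b')) (B y (D2 z))"
      using Suc.hyps(2) ab by (simp add: D pow_add del: funpow.simps)
    also have "\<dots> = 0" by (simp only: 1 2 add_0)
    finally show ?thesis .
  qed
qed

primrec mpow :: "complex^'n^'n \<Rightarrow> nat \<Rightarrow> complex^'n^'n" where
  "mpow N 0 = mat 1" | "mpow N (Suc k) = N ** mpow N k"

lemma mpow_Suc_right: "mpow N (Suc k) = mpow N k ** N"
  by (induction k) (simp_all add: matrix_mul_assoc)

lemma mpow_eq_0_mono: "mpow N D = 0 \<Longrightarrow> D \<le> k \<Longrightarrow> mpow N k = 0"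
  by (induction k) (auto simp: le_Suc_eq)

lemma norm_cscale: "norm (cscale c M) = cmod c * norm M"
  by (simp add: cscale_def norm_vec_def norm_mult flip: L2_set_right_distrib)

lemma ad_eigenvalue_bound:
  "\<exists>C. \<forall>\<alpha> W. comm X W = cscale \<alpha> W \<and> W \<noteq> 0 \<longrightarrow> cmod \<alpha> \<le> C"
proof -
  have "bounded_linear (comm X)"
    using linear_comm(1) linear_conv_bounded_linear by blast
  then obtain C where C: "\<And>W. norm (comm X W) \<le> norm W * C"
    using bounded_linear.bounded by blast
  have "cmod \<alpha> \<le> C" if "comm X W = cscale \<alpha> W" "W \<noteq> 0" for \<alpha> W
    using C[of W] that by (simp add: norm_cscale mult.commute)
  then show ?thesis by blast
qed

text \<open>
  The power \<open>Y^j\<close> is a generalized eigenvector of \<open>ad X\<close> for \<open>j \<alpha>\<close>, unless it is zero; but the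
  eigenvalues of \<open>ad X\<close> are bounded by its operator norm.
\<close>
lemma root_vector_nilpotent:
  assumes Y: "(ad_shift X \<alpha> ^^ e) Y = 0" and "\<alpha> \<noteq> 0"
  shows "\<exists>k. mpow Y k = 0"
proof (rule ccontr)
  assume *: "\<nexists>k. mpow Y k = 0"
  \<comment> \<open>The additional \<open>1\<close> serves the case \<open>j = 0\<close>: the unit matrix is killed by \<open>ad X\<close>, not by its power \<open>0\<close>.\<close>
  have pow: "(ad_shift X (of_nat j * \<alpha>) ^^ (1 + j * e)) (mpow Y j) = 0" for j
  proof (induction j)
    case 0 then show ?case by (simp add: ad_shift_def)
  next
    case (Suc j)
    have "(ad_shift X (\<alpha> + of_nat j * \<alpha>) ^^ (e + (1 + j * e))) (Y ** mpow Y j) = 0"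
      by (rule funpow_leibniz[where ?D1.0 = "ad_shift X \<alpha>" and ?D2.0 = "ad_shift X (of_nat j * \<alpha>)"])
         (use Y Suc in \<open>auto simp: ad_shift_mult\<close>)
    then show ?case by (simp add: algebra_simps)
  qed
  have "\<exists>W. W \<noteq> 0 \<and> comm X W = cscale (of_nat j * \<alpha>) W" for j
  proof -
    let ?T = "ad_shift X (of_nat j * \<alpha>)"
    define k where "k = (LEAST k. (?T ^^ k) (mpow Y j) = 0)"
    have k: "(?T ^^ k) (mpow Y j) = 0" unfolding k_def by (rule LeastI) (rule pow)
    have "k \<noteq> 0" using k * by (metis funpow_0)
    then obtain k' where k': "k = Suc k'" using not0_implies_Suc by blast
    have "(?T ^^ k') (mpow Y j) \<noteq> 0"
      using not_less_Least[of k' "\<lambda>k. (?T ^^ k) (mpow Y j) = 0"] k' by (simp add: k_def)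
    with k k' show ?thesis by (auto simp: ad_shift_def)
  qed
  then obtain C where C: "\<And>j. cmod (of_nat j * \<alpha>) \<le> C"
    using ad_eigenvalue_bound[of X] by blast
  obtain j :: nat where "C / cmod \<alpha> < of_nat j" using reals_Archimedean2 by blast
  then have "C < cmod (of_nat j * \<alpha>)"
    using \<open>\<alpha> \<noteq> 0\<close> by (simp add: norm_mult field_simps)
  with C[of j] show False by simp
qed

abbreviation shift_list :: "complex^'n^'n \<Rightarrow> complex list \<Rightarrow> complex^'n^'n \<Rightarrow> complex^'n^'n" where
  "shift_list X \<alpha>s v \<equiv> foldr (ad_shift X) \<alpha>s v"

text \<open>
  The vector \<open>p(ad X) v\<close>, evaluated by Horner's scheme.
\<close>
definition poly_act :: "complex^'n^'n \<Rightarrow> complex poly \<Rightarrow> complex^'n^'n \<Rightarrow> complex^'n^'n" where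
  "poly_act X p v = fold_coeffs (\<lambda>a w. cscale a v + comm X w) p 0"

lemma poly_act_pCons [simp]: "poly_act X (pCons a p) v = cscale a v + comm X (poly_act X p v)"
  by (cases "p = 0 \<and> a = 0") (auto simp: poly_act_def)

lemma poly_act_0 [simp]: "poly_act X 0 v = 0" by (simp add: poly_act_def)

lemma poly_act_add [simp]: "poly_act X (p + q) v = poly_act X p v + poly_act X q v"
  by (induction p q rule: poly_induct2) (simp_all add: cscale_add_left)

lemma poly_act_smult [simp]: "poly_act X (smult c p) v = cscale c (poly_act X p v)"
  by (induction p) simp_all

lemma poly_act_sum: "poly_act X (sum f I) v = (\<Sum>i\<in>I. poly_act X (f i) v)"
  by (induction I rule: infinite_finite_induct) auto

lemma poly_act_monom: "poly_act X (monom c k) v = cscale c ((comm X ^^ k) v)"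
  by (induction k) (simp_all add: monom_0 monom_Suc)

lemma poly_act_linear_factor: "poly_act X ([:-a, 1:] * q) v = ad_shift X a (poly_act X q v)"
proof -
  have "[:-a, 1:] * q = pCons 0 q + smult (-a) q" by simp
  then show ?thesis
    unfolding poly_act_add poly_act_smult poly_act_pCons
    by (simp only: poly_act_add poly_act_smult poly_act_pCons) (simp add: ad_shift_def)
qed

lemma poly_act_split:
  assumes "p \<noteq> 0"
  shows "\<exists>\<alpha>s c. c \<noteq> 0 \<and> (\<forall>v. poly_act X p v = cscale c (shift_list X \<alpha>s v))"
  using assms
proof (induction "degree p" arbitrary: p)
  case 0
  then obtain c where "p = [:c:]" "c \<noteq> 0" by (metis degree_eq_zeroE pCons_0_0)
  then show ?case by (intro exI[of _ "[]"] exI[of _ c]) (simp)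
next
  case (Suc d)
  then obtain a where "poly p a = 0"
    using fundamental_theorem_of_algebra[of p] by (auto simp: constant_degree)
  then obtain q where q: "p = [:-a, 1:] * q" by (metis dvdE poly_eq_0_iff_dvd)
  with Suc.prems have "q \<noteq> 0" by auto
  moreover have "degree q = d"
    using Suc.hyps(2) q \<open>q \<noteq> 0\<close> by (simp add: degree_mult_eq del: mult_pCons_left)
  ultimately obtain \<alpha>s c where "c \<noteq> 0" "\<And>v. poly_act X q v = cscale c (shift_list X \<alpha>s v)"
    using Suc.hyps(1) by blast
  then show ?case
    by (intro exI[of _ "a # \<alpha>s"] exI[of _ c]) (simp add: q poly_act_linear_factor del: mult_pCons_left)
qed

text \<open>
  In finite dimension \<open>v, (ad X) v, (ad X)^2 v, \<dots>\<close> are linearly dependent, already with real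
  coefficients, and the resulting polynomial splits over the complex numbers.
\<close>
lemma ex_shift_list_eq_0:
  fixes X v :: "complex^'n^'n"
  shows "\<exists>\<alpha>s. shift_list X \<alpha>s v = 0"
proof -
  define d where "d = DIM(complex^'n^'n)"
  let ?f = "\<lambda>i. (comm X ^^ i) v"
  have "\<exists>c::nat \<Rightarrow> real. (\<exists>i\<le>d. c i \<noteq> 0) \<and> (\<Sum>i\<le>d. c i *\<^sub>R ?f i) = 0"
  proof (cases "inj_on ?f {..d}")
    case False
    then obtain i j where ij: "i \<le> d" "j \<le> d" "i \<noteq> j" "?f i = ?f j"
      by (auto simp: inj_on_def)
    let ?c = "\<lambda>k. (if k = i then 1 else 0) - (if k = j then 1 else 0 :: real)"
    have "(\<Sum>k\<le>d. ?c k *\<^sub>R ?f k) = (\<Sum>k\<le>d. (if k = i then ?f k else 0)) - (\<Sum>k\<le>d. (if k = j then ?f k else 0))"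
      by (subst sum_subtractf[symmetric]) (rule sum.cong, auto)
    also have "\<dots> = 0" using ij by simp
    finally show ?thesis using ij by (intro exI[of _ ?c]) auto
  next
    case True
    then have "card (?f ` {..d}) > d" by (simp add: card_image)
    then have "dependent (?f ` {..d})" unfolding d_def by (intro dependent_biggerset) auto
    then obtain u where u: "\<exists>x\<in>?f ` {..d}. u x \<noteq> 0" "(\<Sum>x\<in>?f ` {..d}. u x *\<^sub>R x) = 0"
      using dependent_finite[of "?f ` {..d}"] by auto
    then show ?thesis
      by (intro exI[of _ "\<lambda>i. u (?f i)"]) (auto simp: sum.reindex[OF True])
  qed
  then obtain c :: "nat \<Rightarrow> real" and i where c: "i \<le> d" "c i \<noteq> 0" "(\<Sum>i\<le>d. c i *\<^sub>R ?f i) = 0" by blast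
  define p where "p = (\<Sum>i\<le>d. monom (complex_of_real (c i)) i)"
  have "coeff p i \<noteq> 0" using c by (simp add: p_def coeff_sum)
  then have "p \<noteq> 0" by auto
  moreover have "poly_act X p v = 0"
    using c(3) by (simp add: p_def poly_act_sum poly_act_monom scaleR_eq_cscale)
  ultimately show ?thesis using poly_act_split[of p X] cscale_eq_0_iff by metis
qed

lemma shift_list_commute: "shift_list X \<alpha>s (ad_shift X \<beta> v) = ad_shift X \<beta> (shift_list X \<alpha>s v)"
  by (induction \<alpha>s) (auto simp: ad_shift_commute)

lemma shift_list_filter:
  "shift_list X \<alpha>s v
    = (ad_shift X \<alpha> ^^ count_list \<alpha>s \<alpha>) (shift_list X (filter (\<lambda>\<beta>. \<beta> \<noteq> \<alpha>) \<alpha>s) v)"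
proof (induction \<alpha>s)
  case (Cons \<beta> \<alpha>s)
  have "(ad_shift X \<alpha> ^^ k) (ad_shift X \<beta> w) = ad_shift X \<beta> ((ad_shift X \<alpha> ^^ k) w)" for k w
    by (induction k) (auto simp: ad_shift_commute)
  with Cons show ?case by auto
qed simp


lemma linear_ad_shift: "linear (ad_shift X \<alpha>)"
  by (auto intro!: linearI simp: scaleR_eq_cscale)

lemma linear_cscale: "linear (cscale c)"
  by (auto intro!: linearI simp: scaleR_eq_cscale mult.commute)

locale matrix_lie =
  fixes g :: "(complex^'n^'n) set"
  assumes subspace_g: "subspace g"
    and cscale_g: "M \<in> g \<Longrightarrow> cscale c M \<in> g"
    and comm_g: "M \<in> g \<Longrightarrow> N \<in> g \<Longrightarrow> comm M N \<in> g"
begin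

text \<open>
  If \<open>g\<close> is semisimple and \<open>X\<close> generic in a Cartan subalgebra, these are the usual root vectors and \<open>0\<close>.
\<close>
definition root_vectors :: "complex^'n^'n \<Rightarrow> (complex^'n^'n) set" where
  "root_vectors X = {Y \<in> g. \<exists>\<alpha> e. \<alpha> \<noteq> 0 \<and> (ad_shift X \<alpha> ^^ e) Y = 0}"

definition all_root_vectors :: "(complex^'n^'n) set" where "all_root_vectors = (\<Union>X\<in>g. root_vectors X)"

lemma rootsI: "Y \<in> g \<Longrightarrow> \<alpha> \<noteq> 0 \<Longrightarrow> (ad_shift X \<alpha> ^^ e) Y = 0 \<Longrightarrow> Y \<in> root_vectors X"
  by (auto simp: root_vectors_def)

lemma ad_shift_g: "X \<in> g \<Longrightarrow> Y \<in> g \<Longrightarrow> ad_shift X \<alpha> Y \<in> g"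
  by (simp add: ad_shift_def subspace_diff subspace_g comm_g cscale_g)

lemma shift_list_g: "X \<in> g \<Longrightarrow> Y \<in> g \<Longrightarrow> shift_list X \<alpha>s Y \<in> g"
  by (induction \<alpha>s) (auto intro: ad_shift_g)

lemma roots_cscale:
  assumes "Y \<in> root_vectors X" shows "cscale c Y \<in> root_vectors X"
proof -
  obtain \<alpha> e where "Y \<in> g" "\<alpha> \<noteq> 0" "(ad_shift X \<alpha> ^^ e) Y = 0" using assms by (auto simp: root_vectors_def)
  then show ?thesis by (intro rootsI[of _ \<alpha> e]) (auto intro: cscale_g)
qed

lemma roots_ad_shift: "X \<in> g \<Longrightarrow> Y \<in> root_vectors X \<Longrightarrow> ad_shift X \<beta> Y \<in> root_vectors X"
proof -
  assume X: "X \<in> g" and "Y \<in> root_vectors X"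
  then obtain \<alpha> e where *: "Y \<in> g" "\<alpha> \<noteq> 0" "(ad_shift X \<alpha> ^^ e) Y = 0" by (auto simp: root_vectors_def)
  have "(ad_shift X \<alpha> ^^ e) (ad_shift X \<beta> Y) = ad_shift X \<beta> ((ad_shift X \<alpha> ^^ e) Y)"
    by (induction e) (auto simp: ad_shift_commute)
  then show ?thesis using * X by (intro rootsI[of _ \<alpha> e]) (auto intro: ad_shift_g)
qed

lemma span_roots_g: "span (root_vectors X) \<subseteq> g"
  by (rule span_minimal) (auto simp: root_vectors_def subspace_g)

lemma span_roots_cscale: "Y \<in> span (root_vectors X) \<Longrightarrow> cscale c Y \<in> span (root_vectors X)"
  by (rule span_image_subset[OF linear_cscale]) (auto intro: span_base roots_cscale)

lemma span_roots_ad_shift: "X \<in> g \<Longrightarrow> Y \<in> span (root_vectors X) \<Longrightarrow> ad_shift X \<beta> Y \<in> span (root_vectors X)"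
  by (rule span_image_subset[OF linear_ad_shift]) (auto intro: span_base roots_ad_shift)

text \<open>
  Choose a product of factors \<open>ad X - \<beta>\<close> that annihilates \<open>u\<close>, and let \<open>w\<close> be the image of \<open>u\<close> under
  the factors with \<open>\<beta> \<noteq> \<alpha>\<close>. Then \<open>w\<close> is a generalized eigenvector for \<open>\<alpha>\<close>. On the other hand, modulo
  the span, \<open>ad X\<close> acts on \<open>u\<close> as \<open>\<alpha>\<close>, so \<open>w\<close> is congruent to a nonzero multiple of \<open>u\<close>.
\<close>
lemma ad_shift_in_span_roots_cancel:
  assumes X: "X \<in> g" and u: "u \<in> g" and "\<alpha> \<noteq> 0" and m: "ad_shift X \<alpha> u \<in> span (root_vectors X)"
  shows "u \<in> span (root_vectors X)"
proof -
  obtain \<alpha>s where \<alpha>s: "shift_list X \<alpha>s u = 0" using ex_shift_list_eq_0 by blast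
  define \<beta>s where "\<beta>s = filter (\<lambda>\<beta>. \<beta> \<noteq> \<alpha>) \<alpha>s"
  have w: "shift_list X \<beta>s u \<in> span (root_vectors X)"
    using \<alpha>s u X \<open>\<alpha> \<noteq> 0\<close> unfolding \<beta>s_def
    by (subst (asm) shift_list_filter[of _ _ _ \<alpha>]) (intro span_base rootsI shift_list_g)
  have cong: "\<exists>c. c \<noteq> 0 \<and> shift_list X \<beta>s u - cscale c u \<in> span (root_vectors X)" if "\<alpha> \<notin> set \<beta>s" for \<beta>s
    using that
  proof (induction \<beta>s)
    case Nil show ?case by (intro exI[of _ 1]) (simp add: span_zero)
  next
    case (Cons \<beta> \<beta>s)
    then obtain c where c: "c \<noteq> 0" "shift_list X \<beta>s u - cscale c u \<in> span (root_vectors X)" by auto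
    have "shift_list X (\<beta> # \<beta>s) u - cscale ((\<alpha> - \<beta>) * c) u
       = ad_shift X \<beta> (shift_list X \<beta>s u - cscale c u) + cscale c (ad_shift X \<alpha> u)"
      by (simp add: ad_shift_def cscale_diff_left algebra_simps)
    also have "\<dots> \<in> span (root_vectors X)"
      by (rule span_add[OF span_roots_ad_shift[OF X c(2)] span_roots_cscale[OF m]])
    finally show ?case using Cons.prems c(1) by (intro exI[of _ "(\<alpha> - \<beta>) * c"]) auto
  qed
  obtain c where c: "c \<noteq> 0" "shift_list X \<beta>s u - cscale c u \<in> span (root_vectors X)"
    using cong[of \<beta>s] by (auto simp: \<beta>s_def)
  have "cscale c u \<in> span (root_vectors X)"
    using span_diff[OF w c(2)] by simp
  then have "cscale (1 / c) (cscale c u) \<in> span (root_vectors X)" by (rule span_roots_cscale)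
  then show ?thesis using c(1) by simp
qed

text \<open>
  From a product of factors \<open>ad X - \<alpha>\<close> that annihilates \<open>v\<close>, the factors with \<open>\<alpha> \<noteq> 0\<close> can be
  cancelled modulo the span.
\<close>
lemma ad_nilpotent_mod_roots:
  assumes X: "X \<in> g" and v: "v \<in> g"
  shows "\<exists>p. (comm X ^^ p) v \<in> span (root_vectors X)"
proof -
  have "\<exists>p. (comm X ^^ p) v \<in> span (root_vectors X)"
    if "shift_list X \<alpha>s v \<in> span (root_vectors X)" "v \<in> g" for \<alpha>s v
    using that
  proof (induction \<alpha>s arbitrary: v)
    case Nil then show ?case by (intro exI[of _ 0]) simp
  next
    case (Cons \<alpha> \<alpha>s)
    show ?case
    proof (cases "\<alpha> = 0")
      case False
      then show ?thesis
        using Cons X by (intro Cons.IH) (auto intro: ad_shift_in_span_roots_cancel shift_list_g)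
    next
      case True
      then have "shift_list X \<alpha>s (comm X v) \<in> span (root_vectors X)"
        using Cons.prems shift_list_commute[of X \<alpha>s 0 v] by (simp add: ad_shift_zero)
      then obtain p where "(comm X ^^ p) (comm X v) \<in> span (root_vectors X)"
        using Cons.IH Cons.prems X comm_g by blast
      then show ?thesis by (intro exI[of _ "Suc p"]) (simp add: funpow_swap1)
    qed
  qed
  moreover obtain \<alpha>s where "shift_list X \<alpha>s v = 0" using ex_shift_list_eq_0 by blast
  ultimately show ?thesis using v by (metis span_zero)
qed

text \<open>
  By induction on the exponent \<open>e\<close>, using \<open>\<alpha> Y = (ad X) Y - (ad X - \<alpha>) Y\<close>.
\<close>
lemma roots_ad_surj:
  assumes X: "X \<in> g" and "Y \<in> root_vectors X"
  shows "\<exists>Y'\<in>root_vectors X. comm X Y' = Y"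
proof -
  obtain \<alpha> e where *: "Y \<in> g" "\<alpha> \<noteq> 0" "(ad_shift X \<alpha> ^^ e) Y = 0"
    using assms by (auto simp: root_vectors_def)
  have "\<exists>Y'\<in>g. (ad_shift X \<alpha> ^^ e) Y' = 0 \<and> comm X Y' = Y"
    using *(1,3)
  proof (induction e arbitrary: Y)
    case 0 then show ?case by (intro bexI[of _ 0]) (auto simp: subspace_0 subspace_g)
  next
    case (Suc e)
    have a: "ad_shift X \<alpha> Y \<in> g" using X Suc.prems by (intro ad_shift_g)
    have b: "(ad_shift X \<alpha> ^^ e) (ad_shift X \<alpha> Y) = 0" using Suc.prems(2) by (simp add: funpow_swap1)
    obtain Y'' where Y'': "Y'' \<in> g" "(ad_shift X \<alpha> ^^ e) Y'' = 0" "comm X Y'' = ad_shift X \<alpha> Y"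
      using Suc.IH[OF a b] by blast
    let ?Y' = "cscale (1/\<alpha>) (Y - Y'')"
    have "comm X ?Y' = Y"
      using Y''(3) \<open>\<alpha> \<noteq> 0\<close> by (simp add: ad_shift_def)
    moreover have "(ad_shift X \<alpha> ^^ Suc e) ?Y' = 0" using Y''(2) Suc.prems by simp
    moreover have "?Y' \<in> g" using Y''(1) Suc.prems by (intro cscale_g subspace_diff subspace_g)
    ultimately show ?case by blast
  qed
  then show ?thesis using * by (auto intro: rootsI)
qed

lemma span_roots_ad_surj:
  assumes X: "X \<in> g" and "W \<in> span (root_vectors X)"
  shows "\<exists>W'\<in>span (root_vectors X). comm X W' = W"
  using assms(2)
proof (induction rule: span_induct_alt)
  case base then show ?case by (intro bexI[of _ 0]) (auto simp: span_zero)
next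
  case (step c x y)
  then obtain W' where "W' \<in> span (root_vectors X)" "comm X W' = y" by blast
  moreover obtain x' where "x' \<in> root_vectors X" "comm X x' = x" using roots_ad_surj[OF X step(1)] by blast
  ultimately show ?case
    by (intro bexI[of _ "c *\<^sub>R x' + W'"]) (auto intro: span_add span_scale span_base)
qed

lemma span_roots_ad_pow_surj:
  assumes X: "X \<in> g" and "W \<in> span (root_vectors X)"
  shows "\<exists>W'\<in>span (root_vectors X). (comm X ^^ p) W' = W"
  using assms(2)
proof (induction p arbitrary: W)
  case (Suc p)
  then obtain V where V: "V \<in> span (root_vectors X)" "comm X V = W" using span_roots_ad_surj[OF X] by blast
  then obtain W' where "W' \<in> span (root_vectors X)" "(comm X ^^ p) W' = V" using Suc.IH by blast
  with V show ?case by (intro bexI[of _ W']) auto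
qed auto

text \<open>
  As \<open>ad X\<close> maps the span of the root vectors onto itself, the part of \<open>Z\<close> that survives in a high
  power of \<open>ad X\<close> can be corrected by an element of this span.
\<close>
lemma fitting_decomposition:
  assumes X: "X \<in> g" and Z: "Z \<in> g"
  obtains Z0 W p where "Z = Z0 + W" "Z0 \<in> g" "W \<in> span (root_vectors X)" "(ad_shift X 0 ^^ p) Z0 = 0"
proof -
  obtain p where "(comm X ^^ p) Z \<in> span (root_vectors X)" using ad_nilpotent_mod_roots[OF X Z] by blast
  then obtain W where W: "W \<in> span (root_vectors X)" "(comm X ^^ p) W = (comm X ^^ p) Z"
    using span_roots_ad_pow_surj[OF X] by metis
  have "(ad_shift X 0 ^^ p) (Z - W) = 0" unfolding ad_shift_pow_simps unfolding ad_shift_zero using W(2) by simp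
  then show ?thesis
    using W(1) Z span_roots_g by (intro that[of "Z - W" W p]) (auto intro: subspace_diff subspace_g)
qed

end

section \<open>Exponentials of nilpotent matrices\<close>

text \<open>
  If \<open>mpow N D = 0\<close> then this is \<open>exp(t N)\<close>. The truncation makes it visibly a polynomial in \<open>t\<close>.
\<close>
definition mexp :: "nat \<Rightarrow> complex^'n^'n \<Rightarrow> complex \<Rightarrow> complex^'n^'n" where
  "mexp D N t = (\<Sum>l<D. cscale (t ^ l / fact l) (mpow N l))"

lemma pascal_sum:
  fixes f :: "nat \<Rightarrow> nat \<Rightarrow> 'a::real_vector"
  shows "(\<Sum>a\<le>Suc k. of_nat (Suc k choose a) *\<^sub>R f a (Suc k - a))
       = (\<Sum>a\<le>k. of_nat (k choose a) *\<^sub>R (f (Suc a) (k - a) + f a (Suc (k - a))))"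
proof -
  have "(\<Sum>a\<le>k. real (k choose a) *\<^sub>R f a (Suc (k - a)))
      = f 0 (Suc k) + (\<Sum>a\<le>k. real (k choose Suc a) *\<^sub>R f (Suc a) (k - a))"
  proof (cases k)
    case (Suc k')
    have "(\<Sum>a\<le>k. real (k choose a) *\<^sub>R f a (Suc (k - a)))
      = f 0 (Suc k) + (\<Sum>a\<le>k'. real (k choose Suc a) *\<^sub>R f (Suc a) (Suc (k - Suc a)))"
      unfolding Suc by (subst sum.atMost_Suc_shift) simp
    also have "(\<Sum>a\<le>k'. real (k choose Suc a) *\<^sub>R f (Suc a) (Suc (k - Suc a)))
      = (\<Sum>a\<le>k. real (k choose Suc a) *\<^sub>R f (Suc a) (k - a))"
      unfolding Suc by (simp add: Suc_diff_le binomial_eq_0)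
    finally show ?thesis .
  qed simp
  then show ?thesis
    by (subst sum.atMost_Suc_shift) (simp add: scaleR_add_left scaleR_add_right sum.distrib)
qed

lemma comm_pow_eq:
  "(comm N ^^ k) M = (\<Sum>a\<le>k. of_nat (k choose a) *\<^sub>R ((-1) ^ (k - a) *\<^sub>R (mpow N a ** M ** mpow N (k - a))))"
proof (induction k)
  case (Suc k)
  let ?f = "\<lambda>a b. (-1) ^ b *\<^sub>R (mpow N a ** M ** mpow N b)"
  have "comm N (?f a b) = ?f (Suc a) b + ?f a (Suc b)" for a b
    by (simp only: mpow_Suc_right[of N b]) (simp add: comm_def scaleR_eq_cscale matrix_mul_assoc)
  then have step: "comm N (c *\<^sub>R ?f a b) = c *\<^sub>R (?f (Suc a) b + ?f a (Suc b))" for c a b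
    by (subst comm_scaleR(2)) (simp only:)
  have "comm N (\<Sum>a\<le>k. of_nat (k choose a) *\<^sub>R ?f a (k - a))
    = (\<Sum>a\<le>k. of_nat (k choose a) *\<^sub>R (?f (Suc a) (k - a) + ?f a (Suc (k - a))))"
    unfolding linear_sum[OF linear_comm(1)] by (rule sum.cong[OF refl]) (rule step)
  also have "\<dots> = (\<Sum>a\<le>Suc k. of_nat (Suc k choose a) *\<^sub>R ?f a (Suc k - a))"
    by (rule pascal_sum[symmetric])
  finally show ?case using Suc by simp
qed simp

text \<open>
  The identity \<open>exp(t N) M exp(- t N) = exp(t ad N) M\<close>. The right hand side is truncated at \<open>2 D\<close>
  because \<open>(ad N)^k M\<close> is a combination of the \<open>N^a M N^b\<close> with \<open>a + b = k\<close>.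
\<close>
lemma mexp_conj:
  assumes N: "mpow N D = 0"
  shows "mexp D N t ** M ** mexp D N (- t) = (\<Sum>k<2*D. cscale (t ^ k / fact k) ((comm N ^^ k) M))"
proof -
  let ?h = "\<lambda>a b. cscale (t ^ a / fact a * ((-t) ^ b / fact b)) (mpow N a ** M ** mpow N b)"
  have h0: "?h a b = 0" if "a \<ge> D \<or> b \<ge> D" for a b
    using that mpow_eq_0_mono[OF N] by auto
  have "mexp D N t ** M ** mexp D N (- t) = (\<Sum>a<D. \<Sum>b<D. ?h a b)"
    by (subst sum.swap) (simp add: mexp_def matrix_sum_mult matrix_mul_assoc cscale_sum mult.commute)
  also have "\<dots> = (\<Sum>(a,b)\<in>{..<D}\<times>{..<D}. ?h a b)" by (simp add: sum.cartesian_product)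
  also have "\<dots> = (\<Sum>(a,b)\<in>{(a,b). a + b < 2 * D}. ?h a b)"
  proof (rule sum.mono_neutral_left)
    have "{(a, b). a + b < 2 * D} \<subseteq> {..<2*D} \<times> {..<2*D}" by auto
    then show "finite {(a, b). a + b < 2 * D}" by (rule finite_subset) auto
    show "\<forall>i\<in>{(a, b). a + b < 2 * D} - {..<D} \<times> {..<D}. (case i of (a, b) \<Rightarrow> ?h a b) = 0"
    proof
      fix i assume "i \<in> {(a, b). a + b < 2 * D} - {..<D} \<times> {..<D}"
      then obtain a b where "i = (a, b)" "a \<ge> D \<or> b \<ge> D" by (cases i) auto
      then show "(case i of (a, b) \<Rightarrow> ?h a b) = 0" using h0 by simp
    qed
  qed auto
  also have "\<dots> = (\<Sum>k<2*D. \<Sum>a\<le>k. ?h a (k - a))"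
    by (rule sum.triangle_reindex)
  also have "\<dots> = (\<Sum>k<2*D. cscale (t ^ k / fact k) ((comm N ^^ k) M))"
  proof (rule sum.cong[OF refl])
    fix k
    have "?h a (k - a) = cscale (t ^ k / fact k) (of_nat (k choose a) *\<^sub>R ((-1) ^ (k - a) *\<^sub>R (mpow N a ** M ** mpow N (k - a))))"
      if "a \<le> k" for a
    proof -
      have 1: "(-t) ^ (k - a) = (-1) ^ (k - a) * t ^ (k - a)" by (rule power_minus)
      have 2: "t ^ a * t ^ (k - a) = t ^ k" using that by (simp flip: power_add)
      have 3: "of_nat (k choose a) = (fact k / (fact a * fact (k - a)) :: complex)"
        using that by (rule binomial_fact)
      have "t ^ a / fact a * ((-t) ^ (k - a) / fact (k - a))
        = t ^ k / fact k * (of_nat (k choose a) * (-1) ^ (k - a))"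
        unfolding 1 3 2[symmetric] by simp
      then show ?thesis by (simp add: scaleR_eq_cscale mult.assoc)
    qed
    then show "(\<Sum>a\<le>k. ?h a (k - a)) = cscale (t ^ k / fact k) ((comm N ^^ k) M)"
      by (simp add: comm_pow_eq cscale_sum)
  qed
  finally show ?thesis .
qed

lemma mexp_inverse:
  fixes N :: "complex^'n^'n"
  assumes N: "mpow N D = 0"
  shows "mexp D N t ** mexp D N (- t) = mat 1"
proof -
  have "D \<noteq> 0" using N mat_1_neq_0 by (cases D) auto
  then obtain D' where D': "2 * D = Suc D'" by (cases D) auto
  have "(comm N ^^ Suc k) (mat 1) = 0" for k
    by (induction k) auto
  then have "mexp D N t ** mat 1 ** mexp D N (- t) = mat 1"
    unfolding mexp_conj[OF N] D' by (subst sum.lessThan_Suc_shift) (simp del: funpow.simps)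
  then show ?thesis by simp
qed

lemma mexp_0: "D \<noteq> 0 \<Longrightarrow> mexp D N 0 = mat 1"
  by (cases D) (simp_all add: mexp_def sum.lessThan_Suc_shift del: sum.lessThan_Suc)

context matrix_lie
begin

lemma comm_pow_g: "N \<in> g \<Longrightarrow> M \<in> g \<Longrightarrow> (comm N ^^ k) M \<in> g"
  by (induction k) (auto intro: comm_g)

lemma mexp_conj_g:
  assumes "mpow N D = 0" "N \<in> g" "M \<in> g"
  shows "mexp D N t ** M ** mexp D N (- t) \<in> g"
  unfolding mexp_conj[OF assms(1)]
  by (intro subspace_sum subspace_g cscale_g comm_pow_g assms)

lemma all_roots_nilpotent: "Y \<in> all_root_vectors \<Longrightarrow> \<exists>k. mpow Y k = 0"
  unfolding all_root_vectors_def root_vectors_def using root_vector_nilpotent by blast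

lemma all_roots_g: "all_root_vectors \<subseteq> g" by (auto simp: all_root_vectors_def root_vectors_def)

text \<open>
  Conjugation by \<open>exp(t N)\<close> is an automorphism of \<open>g\<close>, hence it permutes the root vectors.
\<close>
lemma mexp_conj_all_roots:
  assumes N: "mpow N D = 0" "N \<in> g" and "Y \<in> all_root_vectors"
  shows "mexp D N t ** Y ** mexp D N (- t) \<in> all_root_vectors"
proof -
  define \<phi> where "\<phi> M = mexp D N t ** M ** mexp D N (- t)" for M
  have inv: "mexp D N (- t) ** mexp D N t = mat 1" using mexp_inverse[OF N(1), of "- t"] by simp
  have mult: "\<phi> (A ** B) = \<phi> A ** \<phi> B" for A B
  proof -
    have "\<phi> A ** \<phi> B = mexp D N t ** A ** (mexp D N (- t) ** mexp D N t) ** B ** mexp D N (- t)"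
      by (simp add: \<phi>_def matrix_mul_assoc)
    then show ?thesis by (simp add: \<phi>_def inv matrix_mul_assoc)
  qed
  have diff: "\<phi> (A - B) = \<phi> A - \<phi> B" for A B by (simp add: \<phi>_def matrix_diff_mult)
  have shift: "ad_shift (\<phi> X) \<alpha> (\<phi> Z) = \<phi> (ad_shift X \<alpha> Z)" for X \<alpha> Z
    by (simp add: ad_shift_def comm_def diff mult) (simp add: \<phi>_def)
  have pow: "(ad_shift (\<phi> X) \<alpha> ^^ e) (\<phi> Z) = \<phi> ((ad_shift X \<alpha> ^^ e) Z)" for X \<alpha> Z e
    by (induction e) (auto simp: shift)
  obtain X \<alpha> e where *: "X \<in> g" "Y \<in> g" "\<alpha> \<noteq> 0" "(ad_shift X \<alpha> ^^ e) Y = 0"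
    using assms(3) by (auto simp: all_root_vectors_def root_vectors_def)
  have "\<phi> X \<in> g" "\<phi> Y \<in> g" unfolding \<phi>_def using N * by (auto intro: mexp_conj_g)
  moreover have "\<phi> 0 = 0" by (simp add: \<phi>_def)
  ultimately have "\<phi> Y \<in> root_vectors (\<phi> X)" using * by (intro rootsI[of _ \<alpha> e]) (auto simp: pow)
  then show ?thesis using \<open>\<phi> X \<in> g\<close> by (auto simp: all_root_vectors_def \<phi>_def)
qed

text \<open>
  The curve \<open>exp(t N) Y exp(- t N)\<close> consists of root vectors, and \<open>comm N Y\<close> is its derivative at
  \<open>0\<close>.
\<close>
lemma comm_all_roots:
  assumes "N \<in> all_root_vectors" "Y \<in> all_root_vectors"
  shows "comm N Y \<in> span all_root_vectors"
proof -
  obtain D where N: "mpow N D = 0" using all_roots_nilpotent assms(1) by blast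
  have Ng: "N \<in> g" using assms(1) all_roots_g by blast
  \<comment> \<open>The difference quotient of the curve, a polynomial in \<open>t\<close> and so continuous at \<open>0\<close>.\<close>
  define f where "f t = (\<Sum>k<2*D-1. (t ^ k / fact (Suc k)) *\<^sub>R (comm N ^^ Suc k) Y)" for t :: real
  have "D \<noteq> 0" using N mat_1_neq_0 by (cases D) auto
  then obtain D' where D': "2 * D = Suc (Suc D')" by (cases D) auto
  have eq: "mexp D N (of_real t) ** Y ** mexp D N (- of_real t) - Y = t *\<^sub>R f t" for t
  proof -
    have "mexp D N (of_real t) ** Y ** mexp D N (- of_real t)
      = Y + (\<Sum>k<Suc D'. cscale (of_real t ^ Suc k / fact (Suc k)) ((comm N ^^ Suc k) Y))"
      unfolding mexp_conj[OF N] D' by (subst sum.lessThan_Suc_shift) simp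
    also have "(\<Sum>k<Suc D'. cscale (of_real t ^ Suc k / fact (Suc k)) ((comm N ^^ Suc k) Y)) = t *\<^sub>R f t"
      unfolding f_def D' scaleR_sum_right
      by (rule sum.cong) (auto simp: scaleR_eq_cscale simp del: fact_Suc funpow.simps)
    finally show ?thesis by simp
  qed
  have mem: "f t \<in> span all_root_vectors" if "t \<noteq> 0" for t
  proof -
    have "t *\<^sub>R f t \<in> span all_root_vectors"
      unfolding eq[symmetric]
      using mexp_conj_all_roots[OF N Ng assms(2), of "of_real t"] assms(2)
      by (intro span_diff span_base) auto
    then have "(1 / t) *\<^sub>R (t *\<^sub>R f t) \<in> span all_root_vectors" by (rule span_scale)
    then show ?thesis using that by simp
  qed
  have "isCont f 0" unfolding f_def by (intro continuous_intros) auto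
  then have "(f \<longlongrightarrow> f 0) (at 0)" by (simp add: isCont_def)
  moreover have "\<forall>\<^sub>F t in at 0. f t \<in> span all_root_vectors"
    using eventually_neq_at_within[of 0 0 UNIV] by eventually_elim (rule mem)
  ultimately have "f 0 \<in> span all_root_vectors"
    by (intro Lim_in_closed_set[of "span all_root_vectors" f "at 0"]) (auto intro: closed_subspace)
  moreover have "f 0 = comm N Y"
    unfolding f_def D' by (simp add: sum.lessThan_Suc_shift del: sum.lessThan_Suc)
  ultimately show ?thesis by simp
qed

lemma comm_span_all_roots:
  assumes "W \<in> span all_root_vectors" "W' \<in> span all_root_vectors"
  shows "comm W W' \<in> span all_root_vectors"
proof (rule span_image_subset[OF linear_comm(1) _ assms(2)])
  fix Y assume Y: "Y \<in> all_root_vectors"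
  show "comm W Y \<in> span all_root_vectors"
    by (rule span_image_subset[OF linear_comm(2) _ assms(1)]) (rule comm_all_roots[OF _ Y])
qed

text \<open>
  For a root vector \<open>Y\<close> of \<open>X\<close>, decompose \<open>Z\<close> with respect to \<open>X\<close>. The part of \<open>Z\<close> with generalized
  eigenvalue \<open>0\<close> sends \<open>Y\<close> to a root vector for the same eigenvalue; the other part is itself in the
  span of root vectors, which is closed under commutators.
\<close>
lemma span_all_roots_ideal:
  assumes Z: "Z \<in> g" and "W \<in> span all_root_vectors"
  shows "comm Z W \<in> span all_root_vectors"
proof (rule span_image_subset[OF linear_comm(1) _ assms(2)])
  fix Y assume "Y \<in> all_root_vectors"
  then obtain X where X: "X \<in> g" "Y \<in> root_vectors X" by (auto simp: all_root_vectors_def)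
  then obtain \<alpha> e where *: "X \<in> g" "Y \<in> g" "\<alpha> \<noteq> 0" "(ad_shift X \<alpha> ^^ e) Y = 0" "Y \<in> root_vectors X"
    by (auto simp: root_vectors_def)
  obtain Z0 W p where Z0: "Z = Z0 + W" "Z0 \<in> g" "W \<in> span (root_vectors X)" "(ad_shift X 0 ^^ p) Z0 = 0"
    using fitting_decomposition[OF *(1) Z] by blast
  have sub: "span (root_vectors X) \<subseteq> span all_root_vectors"
    using *(1) by (intro span_mono) (auto simp: all_root_vectors_def)
  have "(ad_shift X (0 + \<alpha>) ^^ (p + e)) (comm Z0 Y) = 0"
    by (rule funpow_leibniz[where ?D1.0 = "ad_shift X 0" and ?D2.0 = "ad_shift X \<alpha>"])
       (use * Z0 in \<open>auto simp: ad_shift_comm[of X 0 \<alpha>, simplified]\<close>)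
  then have "comm Z0 Y \<in> root_vectors X" using * Z0 by (intro rootsI[of _ \<alpha> "p + e"]) (auto intro: comm_g)
  then have "comm Z0 Y \<in> span all_root_vectors" using sub span_base by blast
  moreover have "comm W Y \<in> span all_root_vectors"
    using sub Z0(3) *(5) by (intro comm_span_all_roots) (auto intro: span_base)
  ultimately show "comm Z Y \<in> span all_root_vectors" unfolding Z0(1) by (simp add: span_add)
qed

end

section \<open>Engel's theorem relative to an ideal\<close>

definition subalg :: "(complex^'n^'n) set \<Rightarrow> bool" where
  "subalg k \<longleftrightarrow> subspace k \<and> (\<forall>A\<in>k. \<forall>B\<in>k. comm A B \<in> k)"

lemma subalg_dim_less: "subalg h \<Longrightarrow> subalg k \<Longrightarrow> h \<subset> k \<Longrightarrow> dim h < dim k"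
  using span_eq_iff dim_psubset[of h k] by (metis subalg_def)

lemma ex_maximal_subalg:
  assumes m: "subalg m" "m \<subset> k"
  obtains h where "subalg h" "m \<subseteq> h" "h \<subset> k"
    "\<And>h'. subalg h' \<Longrightarrow> h \<subset> h' \<Longrightarrow> h' \<subseteq> k \<Longrightarrow> h' = k"
proof -
  let ?P = "\<lambda>h. subalg h \<and> m \<subseteq> h \<and> h \<subset> k"
  obtain h where h: "?P h" "\<And>h'. ?P h' \<Longrightarrow> dim h' \<le> dim h"
  proof -
    have "\<forall>h. ?P h \<longrightarrow> dim h < Suc (dim k)" using dim_subset by (auto simp: less_Suc_eq_le)
    moreover have "?P m" using m by auto
    ultimately show ?thesis using ex_has_greatest_nat[of ?P m dim "Suc (dim k)"] that by blast
  qed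
  have "h' = k" if h': "subalg h'" "h \<subset> h'" "h' \<subseteq> k" for h'
  proof (rule ccontr)
    assume "h' \<noteq> k"
    then have "dim h' \<le> dim h" using h h' by auto
    moreover have "dim h < dim h'"
      using h h' by (intro subalg_dim_less) auto
    ultimately show False by simp
  qed
  with h that show ?thesis by blast
qed

lemma comm_mod_line:
  assumes h: "subalg h" and Y: "\<And>A. A \<in> h \<Longrightarrow> comm A Y \<in> h"
    and AB: "A - r *\<^sub>R Y \<in> h" "B - s *\<^sub>R Y \<in> h"
  shows "comm A B \<in> h"
proof -
  define a b where "a = A - r *\<^sub>R Y" and "b = B - s *\<^sub>R Y"
  then have ab: "a \<in> h" "b \<in> h" "A = a + r *\<^sub>R Y" "B = b + s *\<^sub>R Y" using AB by auto
  have "comm A B = comm a b + s *\<^sub>R comm a Y - r *\<^sub>R comm b Y"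
    unfolding ab(3,4) using comm_anti[of Y b] by simp
  also have "\<dots> \<in> h" using ab h Y by (simp add: subalg_def subspace_add subspace_diff subspace_scale)
  finally show ?thesis .
qed
lemma subalg_insert:
  assumes h: "subalg h" and Y: "\<And>A. A \<in> h \<Longrightarrow> comm A Y \<in> h"
  shows "subalg (span (insert Y h))"
    and "x \<in> span (insert Y h) \<Longrightarrow> \<exists>r. x - r *\<^sub>R Y \<in> h"
proof -
  have sp: "span h = h" using h by (simp add: subalg_def)
  show *: "\<exists>r. x - r *\<^sub>R Y \<in> h" if "x \<in> span (insert Y h)" for x
    using that unfolding span_insert sp by blast
  have "comm A B \<in> h" if AB: "A \<in> span (insert Y h)" "B \<in> span (insert Y h)" for A B
    using * AB comm_mod_line[OF h Y] by blast
  then show "subalg (span (insert Y h))"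
    unfolding subalg_def using span_superset[of "insert Y h"] by auto
qed

lemma maximal_subalg_split:
  assumes h: "subalg h" "h \<subset> k" and hmax: "\<And>h'. subalg h' \<Longrightarrow> h \<subset> h' \<Longrightarrow> h' \<subseteq> k \<Longrightarrow> h' = k"
    and k: "subspace k" and Y: "Y \<in> k" "Y \<notin> h" "\<And>A. A \<in> h \<Longrightarrow> comm A Y \<in> h" and A: "A \<in> k"
  shows "\<exists>r. A - r *\<^sub>R Y \<in> h"
proof -
  have "span (insert Y h) = k"
  proof (rule hmax)
    show "subalg (span (insert Y h))" using subalg_insert(1)[OF h(1) Y(3)] by blast
    show "h \<subset> span (insert Y h)" using Y span_superset[of "insert Y h"] by blast
    show "span (insert Y h) \<subseteq> k" using h Y k by (intro span_minimal) auto
  qed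
  then show ?thesis using subalg_insert(2)[OF h(1) Y(3)] A by blast
qed

context matrix_lie
begin

text \<open>
  If \<open>m = 0\<close> and \<open>U = 0\<close> this is Engel's theorem for the adjoint action. The usual induction works
  relative to \<open>m\<close>: it starts with \<open>k = m\<close>, where \<open>m\<close> being an ideal contained in \<open>U\<close> settles the
  claim. A maximal subalgebra \<open>h\<close> of \<open>k\<close> has codimension one in \<open>k\<close> by the induction hypothesis for
  \<open>h\<close> and \<open>k\<close> in the roles of \<open>U\<close> and \<open>W\<close>. The elements of \<open>W\<close> sent into \<open>U\<close> by \<open>h\<close> are then stable
  under the additional direction \<open>Y\<close>, which acts nilpotently.
\<close>
lemma engel:
  assumes m: "subspace m" "\<And>Z W. Z \<in> g \<Longrightarrow> W \<in> m \<Longrightarrow> comm Z W \<in> m"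
    and nil: "\<And>X v. X \<in> g \<Longrightarrow> v \<in> g \<Longrightarrow> \<exists>p. (comm X ^^ p) v \<in> m"
    and k: "subalg k" "m \<subseteq> k" "k \<subseteq> g"
    and "subspace U" "subspace W" "m \<subseteq> U" "U \<subset> W" "W \<subseteq> g"
    and "\<And>A u. A \<in> k \<Longrightarrow> u \<in> U \<Longrightarrow> comm A u \<in> U" "\<And>A w. A \<in> k \<Longrightarrow> w \<in> W \<Longrightarrow> comm A w \<in> W"
  shows "\<exists>w\<in>W - U. \<forall>A\<in>k. comm A w \<in> U"
  using assms(4-)
proof (induction "dim k" arbitrary: k U W rule: less_induct)
  case less
  note prems = less.prems
  show ?case
  proof (cases "k = m")
    case True
    obtain w where w: "w \<in> W" "w \<notin> U" using prems by blast
    have "comm A w \<in> U" if "A \<in> k" for A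
      using m(2)[of w A] that w True prems(6,8) m(1) comm_anti[of A w] subspace_neg by (metis subsetD)
    with w show ?thesis by blast
  next
    case False
    then have "m \<subset> k" using prems by auto
    moreover have "subalg m" using m prems by (auto simp: subalg_def)
    ultimately obtain h where h: "subalg h" "m \<subseteq> h" "h \<subset> k"
      and hmax: "\<And>h'. subalg h' \<Longrightarrow> h \<subset> h' \<Longrightarrow> h' \<subseteq> k \<Longrightarrow> h' = k"
      using ex_maximal_subalg by blast
    have dim: "dim h < dim k"
      using h prems(1) by (intro subalg_dim_less)
    have "\<exists>Y\<in>k - h. \<forall>A\<in>h. comm A Y \<in> h"
    proof (rule less.hyps[OF dim h(1,2)])
      show "h \<subseteq> g" "h \<subset> k" "k \<subseteq> g" using h prems(3) by auto
      show "subspace h" "subspace k" using h prems(1) by (auto simp: subalg_def)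
      show "m \<subseteq> h" by (rule h)
      show "comm A u \<in> h" if "A \<in> h" "u \<in> h" for A u using h(1) that by (auto simp: subalg_def)
      show "comm A w \<in> k" if "A \<in> h" "w \<in> k" for A w
        using h(3) prems(1) that by (auto simp: subalg_def)
    qed
    then obtain Y where Y: "Y \<in> k" "Y \<notin> h" "\<And>A. A \<in> h \<Longrightarrow> comm A Y \<in> h" by blast
    have split: "\<exists>r. A - r *\<^sub>R Y \<in> h" if "A \<in> k" for A
      using maximal_subalg_split[OF h(1,3) hmax _ Y that] prems(1) by (auto simp: subalg_def)
    obtain w where w: "w \<in> W" "w \<notin> U" "\<And>A. A \<in> h \<Longrightarrow> comm A w \<in> U"
    proof -
      have "\<exists>w\<in>W - U. \<forall>A\<in>h. comm A w \<in> U"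
        using h(3) prems by (intro less.hyps[OF dim h(1,2) _ prems(4-8)]) auto
      then show ?thesis using that by blast
    qed
    have stab: "(comm Y ^^ j) w \<in> W \<and> (\<forall>A\<in>h. comm A ((comm Y ^^ j) w) \<in> U)" for j
    proof (induction j)
      case (Suc j)
      let ?w = "(comm Y ^^ j) w"
      have "comm A (comm Y ?w) \<in> U" if "A \<in> h" for A
        unfolding jacobi[of A Y] using Suc that Y prems(4,9) by (auto intro: subspace_add)
      with Suc Y prems(10) show ?case by auto
    qed (use w in auto)
    have "\<exists>j. (comm Y ^^ j) w \<in> U" using nil[of Y w] Y w prems by blast
    define j where "j = (LEAST j. (comm Y ^^ j) w \<in> U)"
    have j: "(comm Y ^^ j) w \<in> U" unfolding j_def by (rule LeastI_ex) fact
    then have "j \<noteq> 0" using w by (metis funpow_0)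
    then obtain i where i: "j = Suc i" using not0_implies_Suc by blast
    let ?x = "(comm Y ^^ i) w"
    have x: "?x \<notin> U" using not_less_Least[of i "\<lambda>j. (comm Y ^^ j) w \<in> U"] i by (simp add: j_def)
    have "comm A ?x \<in> U" if A: "A \<in> k" for A
    proof -
      obtain r where r: "A - r *\<^sub>R Y \<in> h" using split[OF A] by blast
      have "comm A ?x = comm (A - r *\<^sub>R Y) ?x + r *\<^sub>R comm Y ?x" by simp
      also have "\<dots> \<in> U"
        using stab[of i] r j i prems(4) by (intro subspace_add subspace_scale) auto
      finally show ?thesis .
    qed
    with x stab[of i] show ?thesis by blast
  qed
qed

text \<open>
  Otherwise a maximal proper subalgebra containing the ideal of root vectors and scalars would have
  codimension one and be an ideal by Engel's theorem, so it would contain all commutators.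
\<close>
lemma perfect_spanned_by_roots:
  assumes one: "mat 1 \<in> g"
    and perfect: "g \<subseteq> span ({comm A B | A B. A \<in> g \<and> B \<in> g} \<union> range (\<lambda>c. cscale c (mat 1)))"
  shows "g = span (all_root_vectors \<union> range (\<lambda>c. cscale c (mat 1)))"
proof -
  define C where "C = range (\<lambda>c. cscale c (mat 1 :: complex^'n^'n))"
  define m where "m = span (all_root_vectors \<union> C)"
  have Cg: "C \<subseteq> g" using one cscale_g by (auto simp: C_def)
  have mg: "m \<subseteq> g" unfolding m_def using all_roots_g Cg subspace_g by (intro span_minimal) auto
  have sub: "span all_root_vectors \<subseteq> m" unfolding m_def by (intro span_mono) auto
  have ideal: "comm Z W \<in> m" if "Z \<in> g" "W \<in> m" for Z W
    using that(2) unfolding m_def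
    by (rule span_image_subset[OF linear_comm(1), rotated])
       (use span_all_roots_ideal[OF that(1)] sub span_base in \<open>auto simp: C_def m_def span_zero\<close>)
  have nil: "\<exists>p. (comm X ^^ p) v \<in> m" if "X \<in> g" "v \<in> g" for X v
  proof -
    have "span (root_vectors X) \<subseteq> m"
      using that unfolding m_def by (intro span_mono) (auto simp: all_root_vectors_def)
    then show ?thesis using ad_nilpotent_mod_roots[OF that] by blast
  qed
  have "m = g"
  proof (rule ccontr)
    assume "m \<noteq> g"
    then have "m \<subset> g" using mg by blast
    moreover have "subalg m" using mg ideal by (auto simp: subalg_def m_def)
    ultimately obtain h where h: "subalg h" "m \<subseteq> h" "h \<subset> g"
      and hmax: "\<And>h'. subalg h' \<Longrightarrow> h \<subset> h' \<Longrightarrow> h' \<subseteq> g \<Longrightarrow> h' = g"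
      using ex_maximal_subalg by blast
    have "\<exists>Y\<in>g - h. \<forall>A\<in>h. comm A Y \<in> h"
    proof (rule engel[of m h h g])
      show "subspace m" by (simp add: m_def)
      show "subalg h" "m \<subseteq> h" "h \<subseteq> g" "m \<subseteq> h" "h \<subset> g" "g \<subseteq> g" "subspace g" "subspace h"
        using h by (auto simp: subalg_def subspace_g)
      show "comm A u \<in> h" if "A \<in> h" "u \<in> h" for A u using h(1) that by (auto simp: subalg_def)
      show "comm A w \<in> g" if "A \<in> h" "w \<in> g" for A w using h(3) that by (auto intro: comm_g)
    qed (fact ideal nil)+
    then obtain Y where Y: "Y \<in> g" "Y \<notin> h" "\<And>A. A \<in> h \<Longrightarrow> comm A Y \<in> h" by blast
    have split: "\<exists>r. A - r *\<^sub>R Y \<in> h" if "A \<in> g" for A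
      by (rule maximal_subalg_split[OF h(1,3) hmax subspace_g Y that])
    have "comm A B \<in> h" if AB: "A \<in> g" "B \<in> g" for A B
      using split AB comm_mod_line[OF h(1) Y(3)] by blast
    moreover have "C \<subseteq> h" using h span_superset[of "all_root_vectors \<union> C"] by (auto simp: m_def)
    ultimately have "span ({comm A B | A B. A \<in> g \<and> B \<in> g} \<union> C) \<subseteq> h"
      using h(1) by (intro span_minimal) (auto simp: subalg_def)
    then show False using perfect h(3) by (auto simp: C_def)
  qed
  then show ?thesis by (simp add: m_def C_def)
qed

end

section \<open>Homogeneous polynomials\<close>

definition expos :: "nat \<Rightarrow> ('n::finite \<Rightarrow> nat) set" where "expos d = {\<alpha>. (\<Sum>i\<in>UNIV. \<alpha> i) = d}"

lemma finite_expos [simp]: "finite (expos d :: ('n::finite \<Rightarrow> nat) set)"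
proof (rule finite_subset)
  show "expos d \<subseteq> (PiE UNIV (\<lambda>_. {..d}) :: ('n \<Rightarrow> nat) set)"
  proof
    fix \<alpha> :: "'n \<Rightarrow> nat" assume "\<alpha> \<in> expos d"
    then have "\<alpha> i \<le> d" for i using member_le_sum[of i UNIV \<alpha>] by (simp add: expos_def)
    then show "\<alpha> \<in> PiE UNIV (\<lambda>_. {..d})" by auto
  qed
qed (intro finite_PiE; simp)

lemma hom_poly_fun_iff: "hom_poly_fun d f \<longleftrightarrow> (\<exists>c. f = (\<lambda>z. \<Sum>\<alpha>\<in>expos d. c \<alpha> * monomial_fun \<alpha> z))"
  by (auto simp: hom_poly_fun_def expos_def fun_eq_iff)

lemma hom_monomial: "\<alpha> \<in> expos d \<Longrightarrow> hom_poly_fun d (\<lambda>z. c * monomial_fun \<alpha> z)"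
  unfolding hom_poly_fun_iff
  by (rule exI[of _ "\<lambda>\<beta>. if \<beta> = \<alpha> then c else 0"]) (simp add: if_distrib if_distribR cong: if_cong)

lemma hom_zero: "hom_poly_fun d (\<lambda>z. 0)"
  unfolding hom_poly_fun_iff by (rule exI[of _ "\<lambda>_. 0"]) simp

lemma hom_add: "hom_poly_fun d f \<Longrightarrow> hom_poly_fun d g \<Longrightarrow> hom_poly_fun d (\<lambda>z. f z + g z)"
  unfolding hom_poly_fun_iff
proof (elim exE)
  fix c c'
  assume "f = (\<lambda>z. \<Sum>\<alpha>\<in>expos d. c \<alpha> * monomial_fun \<alpha> z)" "g = (\<lambda>z. \<Sum>\<alpha>\<in>expos d. c' \<alpha> * monomial_fun \<alpha> z)"
  then show "\<exists>c. (\<lambda>z. f z + g z) = (\<lambda>z. \<Sum>\<alpha>\<in>expos d. c \<alpha> * monomial_fun \<alpha> z)"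
    by (intro exI[of _ "\<lambda>\<alpha>. c \<alpha> + c' \<alpha>"]) (simp add: sum.distrib distrib_right)
qed

lemma hom_sum: "(\<And>i. i \<in> I \<Longrightarrow> hom_poly_fun d (f i)) \<Longrightarrow> hom_poly_fun d (\<lambda>z. \<Sum>i\<in>I. f i z)"
  by (induction I rule: infinite_finite_induct) (auto intro: hom_zero hom_add)

lemma monomial_zero: "monomial_fun (\<lambda>_. 0) z = 1"
  by (simp add: monomial_fun_def)

lemma monomial_Suc:
  "monomial_fun (\<alpha>(i := Suc (\<alpha> i))) z = z $ i * monomial_fun \<alpha> z"
proof -
  have "monomial_fun (\<alpha>(i := Suc (\<alpha> i))) z = z $ i ^ Suc (\<alpha> i) * (\<Prod>j\<in>UNIV - {i}. z $ j ^ \<alpha> j)"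
    unfolding monomial_fun_def by (subst prod.remove[of _ i]) (auto intro!: prod.cong)
  also have "\<dots> = z $ i * (\<Prod>j\<in>UNIV. z $ j ^ \<alpha> j)"
    by (subst (2) prod.remove[of _ i]) auto
  finally show ?thesis by (simp add: monomial_fun_def)
qed

lemma expos_Suc: "\<alpha> \<in> expos d \<Longrightarrow> \<alpha>(i := Suc (\<alpha> i)) \<in> expos (Suc d)"
  unfolding expos_def by (simp add: sum.remove[of UNIV i])

lemma expos_SucE:
  assumes "\<beta> \<in> expos (Suc d)"
  obtains i \<alpha> where "\<alpha> \<in> expos d" "\<beta> = \<alpha>(i := Suc (\<alpha> i))"
proof -
  have "\<exists>i. \<beta> i \<noteq> 0"
  proof (rule ccontr)
    assume "\<not> ?thesis"
    then show False using assms by (simp add: expos_def)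
  qed
  then obtain i where i: "\<beta> i \<noteq> 0" by blast
  let ?\<alpha> = "\<beta>(i := \<beta> i - 1)"
  have "(\<Sum>j\<in>UNIV. \<beta> j) = \<beta> i + (\<Sum>j\<in>UNIV - {i}. \<beta> j)" by (simp add: sum.remove[of UNIV i])
  moreover have "(\<Sum>j\<in>UNIV. ?\<alpha> j) = (\<beta> i - 1) + (\<Sum>j\<in>UNIV - {i}. \<beta> j)" by (simp add: sum.remove[of UNIV i])
  ultimately have "?\<alpha> \<in> expos d" using assms i by (auto simp: expos_def)
  then show ?thesis using i by (intro that[of ?\<alpha> i]) auto
qed

lemma expos_0: "expos 0 = {\<lambda>_. 0}"
  by (auto simp: expos_def)

lemma hom_coord: "hom_poly_fun d f \<Longrightarrow> hom_poly_fun (Suc d) (\<lambda>z. z $ i * f z)"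
  unfolding hom_poly_fun_iff[of d]
proof (elim exE)
  fix c assume f: "f = (\<lambda>z. \<Sum>\<alpha>\<in>expos d. c \<alpha> * monomial_fun \<alpha> z)"
  have "(\<lambda>z. z $ i * f z) = (\<lambda>z. \<Sum>\<alpha>\<in>expos d. c \<alpha> * monomial_fun (\<alpha>(i := Suc (\<alpha> i))) z)"
    by (simp add: f monomial_Suc sum_distrib_left mult_ac)
  moreover have "hom_poly_fun (Suc d) (\<lambda>z. \<Sum>\<alpha>\<in>expos d. c \<alpha> * monomial_fun (\<alpha>(i := Suc (\<alpha> i))) z)"
    by (intro hom_sum hom_monomial expos_Suc)
  ultimately show ?thesis by simp
qed

lemma hom_const: "hom_poly_fun 0 (\<lambda>_. c)"
  using hom_monomial[of "\<lambda>_. 0" 0 c] by (simp add: expos_0 monomial_zero)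

text \<open>
  A monomial of positive degree is a coordinate times a monomial of smaller degree.
\<close>
lemma hom_poly_induct [consumes 1, case_names zero const coord add]:
  assumes "hom_poly_fun d f"
    and zero: "\<And>d. P d (\<lambda>_. 0)"
    and const: "\<And>c. P 0 (\<lambda>_. c)"
    and coord: "\<And>d i f. hom_poly_fun d f \<Longrightarrow> P d f \<Longrightarrow> P (Suc d) (\<lambda>z. z $ i * f z)"
    and add: "\<And>d f g. hom_poly_fun d f \<Longrightarrow> hom_poly_fun d g \<Longrightarrow> P d f \<Longrightarrow> P d g \<Longrightarrow> P d (\<lambda>z. f z + g z)"
  shows "P d f"
proof -
  have mono: "P d (\<lambda>z. c * monomial_fun \<alpha> z)" if "\<alpha> \<in> expos d" for \<alpha> c d
    using that
  proof (induction d arbitrary: \<alpha>)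
    case 0 then show ?case using const by (simp add: expos_0 monomial_zero)
  next
    case (Suc d)
    then obtain i \<beta> where ab: "\<beta> \<in> expos d" "\<alpha> = \<beta>(i := Suc (\<beta> i))" using expos_SucE by blast
    have "P (Suc d) (\<lambda>z. z $ i * (c * monomial_fun \<beta> z))"
      by (intro coord hom_monomial Suc.IH ab)
    then show ?case by (simp only: ab(2) monomial_Suc mult.left_commute)
  qed
  obtain c where f: "f = (\<lambda>z. \<Sum>\<alpha>\<in>expos d. c \<alpha> * monomial_fun \<alpha> z)" using assms(1) hom_poly_fun_iff by blast
  have "P d (\<lambda>z. \<Sum>\<alpha>\<in>I. c \<alpha> * monomial_fun \<alpha> z)" if "I \<subseteq> expos d" for I
    using finite_subset[OF that finite_expos] that
  proof (induction I rule: finite_induct)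
    case (insert \<beta> I)
    have "hom_poly_fun d (\<lambda>z. c \<beta> * monomial_fun \<beta> z)" using insert by (intro hom_monomial) auto
    moreover have "hom_poly_fun d (\<lambda>z. \<Sum>\<alpha>\<in>I. c \<alpha> * monomial_fun \<alpha> z)"
      using insert by (intro hom_sum hom_monomial) auto
    ultimately have "P d (\<lambda>z. c \<beta> * monomial_fun \<beta> z + (\<Sum>\<alpha>\<in>I. c \<alpha> * monomial_fun \<alpha> z))"
      using insert by (intro add mono) auto
    then show ?case using insert by simp
  qed (simp add: zero)
  then show ?thesis using f by auto
qed

lemma hom_cmult: "hom_poly_fun d f \<Longrightarrow> hom_poly_fun d (\<lambda>z. c * f z)"
proof (induction rule: hom_poly_induct)
  case (coord d i f)
  then show ?case using hom_coord[of d "\<lambda>z. c * f z" i] by (simp add: mult.left_commute)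
next
  case (add d f g)
  then show ?case using hom_add[of d "\<lambda>z. c * f z" "\<lambda>z. c * g z"] by (simp add: distrib_left)
qed (use hom_zero hom_const in auto)

lemma hom_diff: "hom_poly_fun d f \<Longrightarrow> hom_poly_fun d g \<Longrightarrow> hom_poly_fun d (\<lambda>z. f z - g z)"
  using hom_add[of d f "\<lambda>z. (-1) * g z"] hom_cmult[of d g "-1"] by simp

lemma hom_mult:
  assumes "hom_poly_fun d f" "hom_poly_fun e g"
  shows "hom_poly_fun (d + e) (\<lambda>z. f z * g z)"
  using assms(1)
proof (induction rule: hom_poly_induct)
  case (coord d i f) then show ?case using hom_coord by (simp add: mult.assoc)
next
  case (add d f g) then show ?case using hom_add by (simp add: distrib_right)
qed (use hom_cmult assms(2) in \<open>auto intro: hom_zero\<close>)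

lemma hom_linear: "hom_poly_fun 1 (\<lambda>z. \<Sum>i\<in>UNIV. c i * z $ i)"
proof (rule hom_sum)
  fix i
  show "hom_poly_fun 1 (\<lambda>z. c i * z $ i)"
    using hom_cmult[OF hom_coord[OF hom_const, of i 1], of "c i"] by simp
qed

lemma hom_scale: "hom_poly_fun d f \<Longrightarrow> f (c *s z) = c ^ d * f z"
  by (induction rule: hom_poly_induct) (auto simp: algebra_simps)

section \<open>Derivatives of homogeneous polynomials\<close>

lemma hom_differentiable:
  assumes "hom_poly_fun d f"
  shows "\<exists>D. (f has_derivative D) (at z) \<and> (\<forall>c v. D (c *s v) = c * D v)"
  using assms
proof (induction rule: hom_poly_induct)
  case (coord d i f)
  then obtain D where "(f has_derivative D) (at z)" "\<forall>c v. D (c *s v) = c * D v" by blast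
  then show ?case
    by (intro exI[of _ "\<lambda>v. z $ i * D v + v $ i * f z"])
       (auto intro!: derivative_eq_intros bounded_linear.has_derivative[OF bounded_linear_vec_nth] simp: algebra_simps)
next
  case (add d f g)
  then obtain D D' where "(f has_derivative D) (at z)" "\<forall>c v. D (c *s v) = c * D v"
    "(g has_derivative D') (at z)" "\<forall>c v. D' (c *s v) = c * D' v" by blast
  then show ?case
    by (intro exI[of _ "\<lambda>v. D v + D' v"]) (auto intro!: derivative_eq_intros simp: algebra_simps)
qed (auto intro!: exI[of _ "\<lambda>_. 0"])

lemma bounded_linear_smult_vec: "bounded_linear (\<lambda>t::complex. t *s (v :: complex^'n::finite))"
  by (rule bounded_linear_intro[of _ "norm v"])
     (auto simp: vec_eq_iff algebra_simps norm_vec_def norm_mult simp flip: L2_set_right_distrib)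

lemma DERIV_compose_curve:
  fixes f :: "complex^'n::finite \<Rightarrow> complex" and c :: "complex \<Rightarrow> complex^'n"
  assumes f: "(f has_derivative D) (at (c t))" and D: "\<And>c v. D (c *s v) = c * D v"
    and c: "(c has_derivative (\<lambda>h. h *s v)) (at t)"
  shows "((\<lambda>t. f (c t)) has_field_derivative D v) (at t)"
proof -
  have "((\<lambda>t. f (c t)) has_derivative (\<lambda>h. D (h *s v))) (at t)"
    using c f by (rule has_derivative_compose)
  then show ?thesis by (simp add: D has_field_derivative_def mult.commute[of _ "D v"])
qed

lemma line_has_derivative:
  fixes z v :: "complex^'n::finite"
  shows "((\<lambda>t. z + t *s v) has_derivative (\<lambda>h. h *s v)) (at t)"
proof -
  have "((\<lambda>t. z + t *s v) has_derivative (\<lambda>h. 0 + h *s v)) (at t)"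
    by (intro has_derivative_add has_derivative_const bounded_linear_imp_has_derivative bounded_linear_smult_vec)
  then show ?thesis by simp
qed

lemma dir_deriv_eq:
  assumes f: "(f has_derivative D) (at z)" and D: "\<And>c v. D (c *s v) = c * D v"
  shows "dir_deriv f z v = D v"
proof -
  have "((\<lambda>t. f (z + t *s v)) has_field_derivative D v) (at 0)"
    by (rule DERIV_compose_curve[where c = "\<lambda>t. z + t *s v"]) (use f D line_has_derivative in auto)
  then show ?thesis unfolding dir_deriv_def by (rule DERIV_imp_deriv)
qed

lemma hom_has_derivative:
  assumes "hom_poly_fun d f"
  shows "(f has_derivative dir_deriv f z) (at z)" "dir_deriv f z (c *s v) = c * dir_deriv f z v"
    "dir_deriv f z (u + v) = dir_deriv f z u + dir_deriv f z v" "dir_deriv f z 0 = 0"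
proof -
  obtain D where D: "(f has_derivative D) (at z)" "\<And>c v. D (c *s v) = c * D v"
    using hom_differentiable[OF assms] by blast
  have eq: "dir_deriv f z = D" using dir_deriv_eq[OF D] by blast
  then show "(f has_derivative dir_deriv f z) (at z)" "dir_deriv f z (c *s v) = c * dir_deriv f z v"
    using D by auto
  show "dir_deriv f z (u + v) = dir_deriv f z u + dir_deriv f z v" "dir_deriv f z 0 = 0"
    using has_derivative_bounded_linear[OF D(1)] by (simp_all add: eq linear_simps)
qed

lemma hom_continuous: "hom_poly_fun d f \<Longrightarrow> continuous_on S f"
  by (intro continuous_at_imp_continuous_on ballI) (rule has_derivative_continuous, rule hom_has_derivative(1))

lemma hom_curve_derivative:
  assumes "hom_poly_fun d f" and c: "(c has_derivative (\<lambda>h. h *s v)) (at t)"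
  shows "((\<lambda>t. f (c t)) has_field_derivative dir_deriv f (c t) v) (at t)"
  by (rule DERIV_compose_curve[OF hom_has_derivative(1)[OF assms(1)] hom_has_derivative(2)[OF assms(1)] c])

lemma hom_line_derivative:
  assumes "hom_poly_fun d f"
  shows "((\<lambda>t. f (z + t *s v)) has_field_derivative dir_deriv f z v) (at 0)"
  using hom_curve_derivative[OF assms line_has_derivative[of z v 0]] by simp

lemma dir_deriv_sum:
  assumes "\<And>i. i \<in> I \<Longrightarrow> hom_poly_fun d (f i)"
  shows "dir_deriv (\<lambda>x. \<Sum>i\<in>I. c i * f i x) z v = (\<Sum>i\<in>I. c i * dir_deriv (f i) z v)"
  unfolding dir_deriv_def[of "\<lambda>x. \<Sum>i\<in>I. c i * f i x"]
  by (rule DERIV_imp_deriv) (auto intro!: derivative_eq_intros hom_line_derivative assms simp: mult.commute)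

lemma hom_euler:
  assumes "hom_poly_fun d f"
  shows "dir_deriv f z z = of_nat d * f z"
proof -
  have "f (z + t *s z) = (1 + t) ^ d * f z" for t
  proof -
    have "z + t *s z = (1 + t) *s z" by (simp add: vec_eq_iff algebra_simps)
    then show ?thesis by (simp only: hom_scale[OF assms])
  qed
  then show ?thesis
    unfolding dir_deriv_def by (auto intro!: DERIV_imp_deriv derivative_eq_intros)
qed

text \<open>
  The derivative along the linear vector field \<open>M z\<close>, which preserves the degree of homogeneous
  polynomials.
\<close>
definition dop :: "complex^'n^'n \<Rightarrow> (complex^'n::finite \<Rightarrow> complex) \<Rightarrow> complex^'n \<Rightarrow> complex" where
  "dop M f z = dir_deriv f z (M *v z)"

lemma hom_dop: "hom_poly_fun d f \<Longrightarrow> hom_poly_fun d (dop M f)"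
proof (induction rule: hom_poly_induct)
  case (zero d)
  then show ?case using hom_zero by (simp add: dop_def[abs_def] dir_deriv_def)
next
  case (const c)
  then show ?case using hom_zero by (simp add: dop_def[abs_def] dir_deriv_def)
next
  case (coord d i f)
  have "dop M (\<lambda>z. z $ i * f z) = (\<lambda>z. z $ i * dop M f z + (\<Sum>j\<in>UNIV. M $ i $ j * z $ j) * f z)"
  proof
    fix z
    have "dir_deriv (\<lambda>z. z $ i * f z) z v = z $ i * dir_deriv f z v + v $ i * f z" for v
      unfolding dir_deriv_def[of "\<lambda>z. z $ i * f z"]
      by (rule DERIV_imp_deriv) (auto intro!: derivative_eq_intros hom_line_derivative[OF coord.hyps])
    then show "dop M (\<lambda>z. z $ i * f z) z = z $ i * dop M f z + (\<Sum>j\<in>UNIV. M $ i $ j * z $ j) * f z"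
      by (simp add: dop_def matrix_vector_mult_def)
  qed
  then show ?case
    using hom_add[OF hom_coord[OF coord.IH, of i] hom_mult[OF hom_linear[of "\<lambda>j. M $ i $ j"] coord.hyps, simplified]]
    by simp
next
  case (add d f g)
  have "dop M (\<lambda>z. f z + g z) = (\<lambda>z. dop M f z + dop M g z)"
  proof
    fix z
    show "dop M (\<lambda>z. f z + g z) z = dop M f z + dop M g z"
      unfolding dop_def dir_deriv_def[of "\<lambda>z. f z + g z"]
      by (rule DERIV_imp_deriv) (auto intro!: derivative_eq_intros hom_line_derivative add.hyps)
  qed
  then show ?case using hom_add[OF add.IH] by simp
qed

section \<open>Zeros of homogeneous polynomials\<close>

lemma hom_on_line:
  assumes "hom_poly_fun d f"
  shows "\<exists>p. \<forall>t. f (z + t *s v) = poly p t"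
  using assms
proof (induction rule: hom_poly_induct)
  case (coord d i f)
  then obtain p where "\<forall>t. f (z + t *s v) = poly p t" by blast
  then show ?case by (intro exI[of _ "[:z $ i, v $ i:] * p"]) (simp add: algebra_simps)
next
  case (add d f g)
  then obtain p q where "\<forall>t. f (z + t *s v) = poly p t" "\<forall>t. g (z + t *s v) = poly q t" by blast
  then show ?case by (intro exI[of _ "p + q"]) simp
next
  case (zero d) then show ?case by (intro exI[of _ 0]) simp
next
  case (const c) then show ?case by (intro exI[of _ "[:c:]"]) simp
qed

lemma eventually_not_root:
  fixes p :: "complex poly"
  assumes "p \<noteq> 0"
  shows "\<forall>\<^sub>F t in at a. poly p t \<noteq> 0"
proof -
  have "closed ({t. poly p t = 0} - {a})"
    using poly_roots_finite[OF assms] by (intro finite_imp_closed) auto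
  then have "open (- ({t. poly p t = 0} - {a}))" by (rule open_Compl)
  then show ?thesis
    unfolding eventually_at_topological by (rule_tac exI, intro conjI, assumption) auto
qed

text \<open>
  Restricted to the line through \<open>z\<close> and \<open>z1\<close>, \<open>g\<close> is a nonzero polynomial in one variable. So \<open>z\<close>
  is a limit of points of this line where \<open>g\<close> does not vanish.
\<close>
lemma hom_dense:
  fixes W :: "complex^'n::finite \<Rightarrow> complex"
  assumes g: "hom_poly_fun d g" "g z1 \<noteq> 0"
    and W: "continuous_on UNIV W" "\<And>z. g z \<noteq> 0 \<Longrightarrow> W z = 0"
  shows "W z = 0"
proof -
  obtain p where p: "\<And>t. g (z + t *s (z1 - z)) = poly p t" using hom_on_line[OF g(1)] by blast
  have "p \<noteq> 0" using p[of 1] g(2) by auto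
  then have "\<forall>\<^sub>F t in at 0. poly p t \<noteq> 0" by (rule eventually_not_root)
  then have ev: "\<forall>\<^sub>F t in at 0. W (z + t *s (z1 - z)) = 0"
  proof eventually_elim
    case (elim t)
    then have "g (z + t *s (z1 - z)) \<noteq> 0" by (simp only: p not_False_eq_True)
    then show ?case by (rule W(2))
  qed
  have 1: "isCont (\<lambda>t. z + t *s (z1 - z)) 0"
    by (rule has_derivative_continuous[OF line_has_derivative])
  have 2: "isCont W (z + 0 *s (z1 - z))" using W(1) continuous_on_eq_continuous_at open_UNIV by blast
  have "isCont (\<lambda>t. W (z + t *s (z1 - z))) 0" by (rule isCont_o2[OF 1 2])
  then have "((\<lambda>t. W (z + t *s (z1 - z))) \<longlongrightarrow> W z) (at 0)" by (simp add: isCont_def)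
  then have "((\<lambda>t::complex. 0) \<longlongrightarrow> W z) (at 0)" using ev by (rule Lim_transform_eventually)
  then have "0 = W z" by (rule LIM_const_eq)
  then show ?thesis by simp
qed

lemma hom_zero_on_open:
  assumes f: "hom_poly_fun d f" and \<Omega>: "open \<Omega>" "z0 \<in> \<Omega>" "\<And>z. z \<in> \<Omega> \<Longrightarrow> f z = 0"
  shows "f z = 0"
proof -
  obtain p where p: "\<And>t. f (z0 + t *s (z - z0)) = poly p t" using hom_on_line[OF f] by blast
  have "isCont (\<lambda>t. z0 + t *s (z - z0)) 0"
    by (rule has_derivative_continuous[OF line_has_derivative])
  then have "((\<lambda>t. z0 + t *s (z - z0)) \<longlongrightarrow> z0) (at 0)" by (simp add: isCont_def)
  then have "\<forall>\<^sub>F t in at 0. z0 + t *s (z - z0) \<in> \<Omega>" using \<Omega>(1,2) by (rule topological_tendstoD)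
  then have "\<forall>\<^sub>F t in at 0. poly p t = 0" by eventually_elim (simp only: p[symmetric] \<Omega>(3))
  then have "p = 0"
    using eventually_not_root[of p 0] eventually_conj[of "\<lambda>t. poly p t = 0" "at 0" "\<lambda>t. poly p t \<noteq> 0"]
    by auto
  then show ?thesis using p[of 1] by simp
qed

text \<open>
  Induction on the set \<open>S\<close> of variables: with the other variables fixed, the sum is a polynomial in
  \<open>z i\<close>, and its coefficients are sums of the same kind over the exponents with a given value at
  \<open>i\<close>. Such exponents remain distinguished by \<open>S\<close>.
\<close>
lemma monomial_independent_aux:
  assumes "finite S" "finite I"
    and "\<And>\<alpha> \<beta>. \<alpha> \<in> I \<Longrightarrow> \<beta> \<in> I \<Longrightarrow> (\<forall>j\<in>S. \<alpha> j = \<beta> j) \<Longrightarrow> \<alpha> = \<beta>"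
    and "\<And>z::'n \<Rightarrow> complex. (\<Sum>\<alpha>\<in>I. c \<alpha> * (\<Prod>j\<in>S. z j ^ \<alpha> j)) = 0"
    and "\<alpha> \<in> I"
  shows "c \<alpha> = 0"
  using assms
proof (induction S arbitrary: I \<alpha> rule: finite_induct)
  case empty
  then have "I = {\<alpha>}" by auto
  then show ?case using empty.prems(3)[of undefined] by simp
next
  case (insert i S)
  let ?J = "{\<beta> \<in> I. \<beta> i = \<alpha> i}"
  have *: "(\<Sum>\<beta>\<in>?J. c \<beta> * (\<Prod>j\<in>S. z j ^ \<beta> j)) = 0" for z
  proof -
    define p where "p = (\<Sum>\<beta>\<in>I. monom (c \<beta> * (\<Prod>j\<in>S. z j ^ \<beta> j)) (\<beta> i))"
    have "poly p x = 0" for x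
    proof -
      have "poly p x = (\<Sum>\<beta>\<in>I. c \<beta> * (\<Prod>j\<in>insert i S. (z(i := x)) j ^ \<beta> j))"
        unfolding p_def poly_sum
      proof (rule sum.cong[OF refl])
        fix \<beta>
        have "(\<Prod>j\<in>S. (z(i := x)) j ^ \<beta> j) = (\<Prod>j\<in>S. z j ^ \<beta> j)"
          using insert.hyps by (intro prod.cong) auto
        then show "poly (monom (c \<beta> * (\<Prod>j\<in>S. z j ^ \<beta> j)) (\<beta> i)) x = c \<beta> * (\<Prod>j\<in>insert i S. (z(i := x)) j ^ \<beta> j)"
          using insert.hyps by (simp add: poly_monom mult_ac)
      qed
      then show ?thesis using insert.prems(3) by simp
    qed
    then have "p = 0" by (simp add: poly_eq_poly_eq_iff[symmetric] fun_eq_iff)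
    then have "coeff p (\<alpha> i) = 0" by simp
    also have "coeff p (\<alpha> i) = (\<Sum>\<beta>\<in>I. if \<beta> i = \<alpha> i then c \<beta> * (\<Prod>j\<in>S. z j ^ \<beta> j) else 0)"
      by (simp add: p_def coeff_sum)
    also have "\<dots> = (\<Sum>\<beta>\<in>?J. c \<beta> * (\<Prod>j\<in>S. z j ^ \<beta> j))"
      using insert.prems(1) by (simp add: sum.inter_filter)
    finally show ?thesis .
  qed
  show ?case
  proof (rule insert.IH[of ?J])
    show "\<beta> = \<gamma>" if "\<beta> \<in> ?J" "\<gamma> \<in> ?J" "\<forall>j\<in>S. \<beta> j = \<gamma> j" for \<beta> \<gamma>
      using that by (intro insert.prems(2)) auto
  qed (use insert.prems * in auto)
qed

lemma monomial_independent:
  fixes c :: "('n::finite \<Rightarrow> nat) \<Rightarrow> complex"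
  assumes "finite I" "\<And>z. (\<Sum>\<alpha>\<in>I. c \<alpha> * monomial_fun \<alpha> z) = 0" "\<alpha> \<in> I"
  shows "c \<alpha> = 0"
proof (rule monomial_independent_aux[of UNIV I])
  fix z :: "'n \<Rightarrow> complex"
  show "(\<Sum>\<alpha>\<in>I. c \<alpha> * (\<Prod>j\<in>UNIV. z j ^ \<alpha> j)) = 0"
    using assms(2)[of "\<chi> j. z j"] by (simp add: monomial_fun_def)
qed (use assms in auto)

section \<open>Holomorphic vector fields are linear\<close>

text \<open>
  The projection of the linear vector field \<open>M z\<close>: in chart \<open>i\<close>, the class of \<open>M z\<close> modulo \<open>z\<close> is
  represented by the vector with vanishing \<open>i\<close>-th component.
\<close>
definition vf_of :: "complex^'n^'n \<Rightarrow> 'n::finite vfield" where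
  "vf_of M = (\<lambda>i z. if z $ i = 0 then 0 else M *v z - ((M *v z) $ i / z $ i) *s z)"

lemma has_derivative_along_line:
  fixes f :: "complex^'n::finite \<Rightarrow> complex^'m::finite"
  assumes f: "(f has_derivative D) (at (z + t *s v))"
    and D: "\<And>c w. D (c *s w) = c *s D w"
  shows "((\<lambda>t. f (z + t *s v) $ j) has_field_derivative D v $ j) (at t)"
proof -
  have "((\<lambda>t. z + t *s v) has_derivative (\<lambda>t. t *s v)) (at t)" by (rule line_has_derivative)
  then have "((\<lambda>t. f (z + t *s v)) has_derivative (\<lambda>t. D (t *s v))) (at t)"
    using f by (rule has_derivative_compose)
  then have "((\<lambda>t. f (z + t *s v) $ j) has_derivative (\<lambda>t. D (t *s v) $ j)) (at t)"
    by (rule bounded_linear.has_derivative[OF bounded_linear_vec_nth])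
  moreover have "(\<lambda>t. D (t *s v) $ j) = (*) (D v $ j)" by (auto simp: D)
  ultimately show ?thesis by (simp add: has_field_derivative_def)
qed

lemma quadratic_growth_imp_quadratic:
  fixes f :: "complex \<Rightarrow> complex"
  assumes f: "f holomorphic_on UNIV"
    and bd: "\<And>t. cmod (f t) \<le> K * (a + b * cmod t) * (c + d * cmod t)"
    and nn: "K \<ge> 0" "a \<ge> 0" "b \<ge> 0" "c \<ge> 0" "d \<ge> 0"
  shows "\<exists>p0 p1 p2. \<forall>t. f t = p0 + p1 * t + p2 * t ^ 2"
proof -
  have "cmod (f t) \<le> (K * (a + b) * (c + d)) * cmod t ^ 2" if "1 \<le> cmod t" for t
  proof -
    have "a \<le> a * cmod t" "c \<le> c * cmod t" using that nn by (simp_all add: mult_le_cancel_left1)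
    then have "K * (a + b * cmod t) * (c + d * cmod t)
      \<le> K * (a * cmod t + b * cmod t) * (c * cmod t + d * cmod t)"
      using nn by (intro mult_mono mult_nonneg_nonneg add_nonneg_nonneg) auto
    also have "\<dots> = (K * (a + b) * (c + d)) * cmod t ^ 2"
      unfolding distrib_right[symmetric] power2_eq_square by (simp only: mult_ac)
    finally show ?thesis using bd[of t] by simp
  qed
  then have "f t = (\<Sum>k\<le>2. (deriv ^^ k) f 0 / fact k * t ^ k)" for t
    by (rule Liouville_polynomial[OF f])
  also have "(\<Sum>k\<le>2. (deriv ^^ k) f 0 / fact k * t ^ k)
    = f 0 + deriv f 0 * t + deriv (deriv f) 0 / 2 * t ^ 2" for t
    by (simp add: numeral_2_eq_2)
  finally show ?thesis by blast
qed

lemma eq_0_of_linear_growth: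
  fixes d :: complex
  assumes "\<And>t::real. t \<ge> 1 \<Longrightarrow> cmod d * t \<le> C"
  shows "d = 0"
proof (rule ccontr)
  assume "d \<noteq> 0"
  define t where "t = max 1 ((C + 1) / cmod d)"
  have "cmod d * t \<ge> cmod d * ((C + 1) / cmod d)" unfolding t_def by (intro mult_left_mono) auto
  moreover have "cmod d * ((C + 1) / cmod d) = C + 1" using \<open>d \<noteq> 0\<close> by simp
  ultimately show False using assms[of t] by (auto simp: t_def)
qed

lemma norm_smult_vec: "norm (c *s v) = cmod c * norm (v :: complex^'n::finite)"
  by (simp add: norm_vec_def norm_mult flip: L2_set_right_distrib)

text \<open>
  The bound \<open>G1\<close> makes \<open>Y\<close> quadratic on lines; with \<open>Y0\<close> and \<open>Y1\<close> it follows that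
  \<open>Q(u) = Y(e i + u)\<close> is homogeneous of degree two. Dividing \<open>G2\<close> by the cube and \<open>G1\<close> by the square
  of a scaling factor going to infinity yields that \<open>Q(w)\<close> is proportional to \<open>w\<close> and that \<open>Q(w)\<close>
  has no \<open>j\<close>-th component where \<open>w\<close> has none. Hence, on a line in direction \<open>e j\<close>, the \<open>j\<close>-th
  component of \<open>Q\<close> has no constant term, and by \<open>Y2\<close> no quadratic term; by proportionality the
  other components are then constant on the line. So a component of \<open>Q\<close> depends on the coordinate
  of the same index only, where it vanishes by \<open>Y2\<close>.
\<close>
lemma chart_field_rigid:
  fixes Y :: "complex^'n::finite \<Rightarrow> complex^'n" and i :: 'n
  assumes e_def: "\<And>k. e k = axis k (1::complex)"
    and hol: "\<And>z v j. z $ i = 1 \<Longrightarrow> v $ i = 0 \<Longrightarrow> (\<lambda>t. Y (z + t *s v) $ j) holomorphic_on UNIV"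
    and C: "C \<ge> 0"
    and G1: "\<And>z j. z $ i = 1 \<Longrightarrow> cmod (Y z $ j) \<le> C * norm z * (1 + cmod (z $ j))"
    and G2: "\<And>z j k. z $ i = 1 \<Longrightarrow>
      cmod (Y z $ j * z $ k - Y z $ k * z $ j) \<le> C * norm z * (cmod (z $ j) + cmod (z $ k))"
    and Y0: "Y (e i) = 0"
    and Y1: "\<And>u j. u $ i = 0 \<Longrightarrow> deriv (\<lambda>t. Y (e i + t *s u) $ j) 0 = 0"
    and Y2: "\<And>k t. k \<noteq> i \<Longrightarrow> Y (e i + t *s e k) $ k = 0"
    and z: "z $ i = 1" and k: "k \<noteq> i"
  shows "Y z $ k = 0"
proof -
  define Q where "Q u = Y (e i + u)" for u
  have ei: "e i $ i = 1" and ek: "j \<noteq> i \<Longrightarrow> e j $ i = 0" for j by (auto simp: e_def axis_def)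
  have norm_e: "norm (e i) = 1" unfolding e_def by (rule norm_Basis) (simp add: axis_in_Basis_iff)
  have holQ: "(\<lambda>t. Q (u + t *s v) $ j) holomorphic_on UNIV" if "u $ i = 0" "v $ i = 0" for u v j
    using hol[of "e i + u" v j] that ei by (simp add: Q_def add.assoc)
  have quad: "\<exists>p0 p1 p2. \<forall>t. Q (u + t *s v) $ j = p0 + p1 * t + p2 * t ^ 2"
    if "u $ i = 0" "v $ i = 0" for u v j
  proof (rule quadratic_growth_imp_quadratic[OF holQ[OF that]])
    fix t
    let ?z = "e i + (u + t *s v)"
    have "cmod (Q (u + t *s v) $ j) \<le> C * norm ?z * (1 + cmod (?z $ j))"
      unfolding Q_def using that ei by (intro G1) simp
    also have "\<dots> \<le> C * (norm (e i + u) + norm v * cmod t) * ((1 + cmod ((e i + u) $ j)) + cmod (v $ j) * cmod t)"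
    proof (intro mult_mono mult_left_mono C mult_nonneg_nonneg add_nonneg_nonneg)
      show "norm ?z \<le> norm (e i + u) + norm v * cmod t"
        using norm_triangle_ineq[of "e i + u" "t *s v"] by (simp add: norm_smult_vec mult.commute add.assoc)
      show "1 + cmod (?z $ j) \<le> (1 + cmod ((e i + u) $ j)) + cmod (v $ j) * cmod t"
        using norm_triangle_ineq[of "(e i + u) $ j" "(t *s v) $ j"] by (simp add: norm_mult mult.commute add.assoc)
    qed auto
    finally show "cmod (Q (u + t *s v) $ j) \<le> C * (norm (e i + u) + norm v * cmod t) * ((1 + cmod ((e i + u) $ j)) + cmod (v $ j) * cmod t)" .
  qed (use C in auto)
  have homog: "Q (t *s u) $ j = t ^ 2 * Q u $ j" if u: "u $ i = 0" for u t j
  proof -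
    obtain p0 p1 p2 where p: "\<And>t. Q (t *s u) $ j = p0 + p1 * t + p2 * t ^ 2"
      using quad[of 0 u j] u by auto
    have "p0 = 0" using p[of 0] Y0 by (simp add: Q_def)
    moreover have "p1 = 0"
    proof -
      have "((\<lambda>t. p0 + p1 * t + p2 * t ^ 2) has_field_derivative p1) (at 0)"
        by (auto intro!: derivative_eq_intros)
      then have "deriv (\<lambda>t. Q (t *s u) $ j) 0 = p1" unfolding p by (rule DERIV_imp_deriv)
      then show ?thesis using Y1[OF u, of j] by (simp add: Q_def)
    qed
    ultimately show ?thesis using p[of t] p[of 1] by simp
  qed
  have norm_line: "norm (e i + complex_of_real t *s w) \<le> t * (1 + norm w)" if "t \<ge> 1" for t w
    using norm_triangle_ineq[of "e i" "complex_of_real t *s w"] that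
    by (simp add: norm_smult_vec norm_e algebra_simps)
  have H2: "w $ l * Q w $ j = w $ j * Q w $ l" if w: "w $ i = 0" and "j \<noteq> i" "l \<noteq> i" for w j l
  proof -
    define dd where "dd = Q w $ j * w $ l - Q w $ l * w $ j"
    have "cmod dd * t \<le> C * (1 + norm w) * (cmod (w $ j) + cmod (w $ l))" if t: "t \<ge> 1" for t :: real
    proof -
      let ?t = "complex_of_real t" let ?z = "e i + ?t *s w"
      have comp: "?z $ j = ?t * w $ j" "?z $ l = ?t * w $ l"
        using \<open>j \<noteq> i\<close> \<open>l \<noteq> i\<close> by (auto simp: e_def axis_def)
      have Qz: "Y ?z $ m = ?t ^ 2 * Q w $ m" for m using homog[OF w, of ?t m] by (simp add: Q_def)
      have "cmod (Y ?z $ j * ?z $ l - Y ?z $ l * ?z $ j) \<le> C * norm ?z * (cmod (?z $ j) + cmod (?z $ l))"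
        using w ei by (intro G2) simp
      also have "Y ?z $ j * ?z $ l - Y ?z $ l * ?z $ j = ?t ^ 3 * dd"
        unfolding comp Qz dd_def by (simp add: algebra_simps power2_eq_square power3_eq_cube)
      also have "C * norm ?z * (cmod (?z $ j) + cmod (?z $ l))
        \<le> C * (t * (1 + norm w)) * (t * (cmod (w $ j) + cmod (w $ l)))"
        unfolding comp using norm_line[OF t, of w] t C
        by (intro mult_mono mult_left_mono mult_nonneg_nonneg add_nonneg_nonneg) (auto simp: norm_mult algebra_simps)
      finally have "t ^ 2 * (cmod dd * t) \<le> t ^ 2 * (C * (1 + norm w) * (cmod (w $ j) + cmod (w $ l)))"
        using t by (simp add: norm_mult norm_power algebra_simps power2_eq_square power3_eq_cube)
      then show ?thesis using t by simp
    qed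
    then have "dd = 0" by (rule eq_0_of_linear_growth)
    then show ?thesis by (simp add: dd_def mult.commute)
  qed
  have H3: "Q w $ j = 0" if w: "w $ i = 0" "w $ j = 0" "j \<noteq> i" for w j
  proof (rule eq_0_of_linear_growth)
    fix t :: real assume t: "t \<ge> 1"
    let ?t = "complex_of_real t" let ?z = "e i + ?t *s w"
    have comp: "?z $ j = 0" using w by (auto simp: e_def axis_def)
    have "cmod (Y ?z $ j) \<le> C * norm ?z * (1 + cmod (?z $ j))" using w ei by (intro G1) simp
    also have "\<dots> \<le> C * (t * (1 + norm w))"
      unfolding comp using norm_line[OF t, of w] C by (simp add: mult_left_mono)
    also have "Y ?z $ j = ?t ^ 2 * Q w $ j" using homog[OF w(1), of ?t j] by (simp add: Q_def)
    finally have "t * (cmod (Q w $ j) * t) \<le> t * (C * (1 + norm w))"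
      using t by (simp add: norm_mult norm_power algebra_simps power2_eq_square)
    then show "cmod (Q w $ j) * t \<le> C * (1 + norm w)" using t by simp
  qed
  have indep: "Q (u + t *s e j) $ l = Q u $ l"
    if u: "u $ i = 0" "u $ j = 0" and "j \<noteq> i" "l \<noteq> i" "l \<noteq> j" for u j l t
  proof -
    have ej: "e j $ i = 0" "e j $ j = 1" "e j $ l = 0" using that by (auto simp: e_def axis_def)
    obtain p0 p1 p2 where p: "\<And>t. Q (u + t *s e j) $ j = p0 + p1 * t + p2 * t ^ 2"
      using quad[of u "e j" j] u ej by blast
    have p0: "p0 = 0" using p[of 0] H3[OF u \<open>j \<noteq> i\<close>] by simp
    obtain q0 q1 q2 where q: "\<And>s. Q (e j + s *s u) $ j = q0 + q1 * s + q2 * s ^ 2"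
      using quad[of "e j" u j] u ej by blast
    have "q0 = 0" using q[of 0] Y2[OF \<open>j \<noteq> i\<close>, of 1] by (simp add: Q_def)
    have *: "p2 + p1 * s = q1 * s + q2 * s ^ 2" if "s \<noteq> 0" for s
    proof -
      have eq: "u + (1/s) *s e j = (1/s) *s (e j + s *s u)" using that by (simp add: vec_eq_iff algebra_simps)
      have "Q (u + (1/s) *s e j) $ j = (1/s)^2 * Q (e j + s *s u) $ j"
        unfolding eq by (rule homog) (use u ej in simp)
      then have "p1 * (1/s) + p2 * (1/s)^2 = (1/s)^2 * (q1 * s + q2 * s ^ 2)"
        unfolding p q using p0 \<open>q0 = 0\<close> by simp
      then show ?thesis using that by (simp add: field_simps power2_eq_square)
    qed
    have "p2 = 0"
    proof -
      have "((\<lambda>s. p2 + p1 * s) \<longlongrightarrow> p2 + p1 * 0) (at 0)" by (intro tendsto_intros)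
      moreover have "((\<lambda>s. q1 * s + q2 * s ^ 2) \<longlongrightarrow> q1 * 0 + q2 * 0 ^ 2) (at 0)" by (intro tendsto_intros)
      moreover have "\<forall>\<^sub>F s in at 0. q1 * s + q2 * s ^ 2 = p2 + p1 * s"
        using eventually_neq_at_within[of 0 0 UNIV] by eventually_elim (use * in auto)
      ultimately show ?thesis using tendsto_unique[of "at 0" "\<lambda>s. p2 + p1 * s" p2 0]
        by (simp add: tendsto_cong)
    qed
    have off: "Q (u + t *s e j) $ l = u $ l * p1" if "t \<noteq> 0" for t
    proof -
      have "u $ l * (p1 * t) = t * Q (u + t *s e j) $ l"
        using H2[of "u + t *s e j" j l] p[of t] \<open>p2 = 0\<close> p0 u ej \<open>j \<noteq> i\<close> \<open>l \<noteq> i\<close> by simp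
      then show ?thesis using that by simp
    qed
    obtain r0 r1 r2 where r: "\<And>t. Q (u + t *s e j) $ l = r0 + r1 * t + r2 * t ^ 2"
      using quad[of u "e j" l] u ej by blast
    have "((\<lambda>t. r0 + r1 * t + r2 * t ^ 2) \<longlongrightarrow> r0 + r1 * 0 + r2 * 0 ^ 2) (at 0)" by (intro tendsto_intros)
    moreover have "\<forall>\<^sub>F t in at 0. r0 + r1 * t + r2 * t ^ 2 = u $ l * p1"
      using eventually_neq_at_within[of 0 0 UNIV] by eventually_elim (use off r in auto)
    ultimately have "((\<lambda>_. u $ l * p1) \<longlongrightarrow> r0) (at (0::complex))" by (simp add: tendsto_cong)
    then have "r0 = u $ l * p1" by (simp add: tendsto_const_iff)
    then show ?thesis using off r[of 0] by (cases "t = 0") auto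
  qed
  define w where "w = z - e i"
  have w: "w $ i = 0" using z ei by (simp add: w_def)
  have drop: "Q (\<chi> l. if l \<in> S then 0 else w $ l) $ k = Q w $ k" if "S \<subseteq> - {i, k}" for S
    using finite[of S] that
  proof (induction S rule: finite_induct)
    case empty then show ?case by simp
  next
    case (insert j S)
    let ?u = "\<chi> l. if l \<in> insert j S then 0 else w $ l"
    have "(\<chi> l. if l \<in> S then 0 else w $ l) = ?u + (w $ j) *s e j"
      using insert by (auto simp: vec_eq_iff e_def axis_def)
    then show ?case using insert indep[of ?u j k "w $ j"] w k by auto
  qed
  have "(\<chi> l. if l \<in> - {i, k} then 0 else w $ l) = (w $ k) *s e k"
    using w by (auto simp: vec_eq_iff e_def axis_def)
  then have "Q w $ k = Q ((w $ k) *s e k) $ k" using drop[of "- {i, k}"] by simp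
  also have "\<dots> = 0" using Y2[OF k] by (simp add: Q_def)
  finally show ?thesis by (simp add: Q_def w_def)
qed


lemma holo_vfieldsD:
  assumes "X \<in> holo_vfields"
  shows "z $ i \<noteq> 0 \<Longrightarrow> \<exists>D. (X i has_derivative D) (at z) \<and> (\<forall>c v. D (c *s v) = c *s D v)"
    and "z $ i \<noteq> 0 \<Longrightarrow> X i z $ i = 0"
    and "z $ i \<noteq> 0 \<Longrightarrow> c \<noteq> 0 \<Longrightarrow> X i (c *s z) = c *s X i z"
    and "z $ i \<noteq> 0 \<Longrightarrow> z $ j \<noteq> 0 \<Longrightarrow> \<exists>c. X j z = X i z + c *s z"
    and "z $ i = 0 \<Longrightarrow> X i z = 0"
  using assms unfolding holo_vfields_def holomorphic_map_on_def by auto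

lemma holo_vfield_change_chart:
  assumes X: "X \<in> holo_vfields" and z: "z $ i \<noteq> 0" "z $ l \<noteq> 0"
  shows "X i z = X l z - (X l z $ i / z $ i) *s z"
proof -
  obtain c where c: "X i z = X l z + c *s z" using holo_vfieldsD(4)[OF X z(2,1)] by blast
  then have "X i z $ i = X l z $ i + c * z $ i" by simp
  then have "c = - (X l z $ i / z $ i)"
    using holo_vfieldsD(2)[OF X z(1)] z(1) by (simp add: field_simps add_eq_0_iff)
  with c show ?thesis by (simp add: vec_eq_iff)
qed

text \<open>
  At \<open>z\<close> use the chart \<open>l\<close> of a coordinate of maximal modulus: there the point of the projective
  space stays in a compact polydisc, so \<open>X l z\<close> is bounded by a multiple of the norm of \<open>z\<close>. Changing
  to chart \<open>i\<close> adds a multiple of \<open>z\<close>, which cancels in the second estimate.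
\<close>
lemma holo_vfield_growth:
  fixes X :: "'n::finite vfield"
  assumes X: "X \<in> holo_vfields"
  shows "\<exists>C\<ge>0. \<forall>i z j k. z $ i = 1 \<longrightarrow> cmod (X i z $ j) \<le> C * norm z * (1 + cmod (z $ j)) \<and>
       cmod (X i z $ j * z $ k - X i z $ k * z $ j) \<le> C * norm z * (cmod (z $ j) + cmod (z $ k))"
proof -
  define K where "K l = {z :: complex^'n. z $ l = 1 \<and> (\<forall>k. cmod (z $ k) \<le> 1)}" for l
  have "\<exists>B. \<forall>z\<in>K l. norm (X l z) \<le> B" for l
  proof -
    have "closed (K l)"
      unfolding K_def by (intro closed_Collect_conj closed_Collect_all closed_Collect_eq closed_Collect_le continuous_intros)
    moreover have "bounded (K l)"
    proof (rule boundedI)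
      fix z assume z: "z \<in> K l"
      have "norm z \<le> (\<Sum>k\<in>UNIV. norm (z $ k))" by (simp add: norm_vec_def L2_set_le_sum)
      also have "\<dots> \<le> (\<Sum>k\<in>(UNIV :: 'n set). 1)" using z by (intro sum_mono) (auto simp: K_def)
      finally show "norm z \<le> (\<Sum>k\<in>(UNIV :: 'n set). 1)" .
    qed
    moreover have "continuous_on (K l) (X l)"
    proof (intro continuous_at_imp_continuous_on ballI)
      fix z assume "z \<in> K l"
      then have "z $ l \<noteq> 0" by (auto simp: K_def)
      then show "isCont (X l) z" using holo_vfieldsD(1)[OF X] has_derivative_continuous by blast
    qed
    ultimately have "bounded (X l ` K l)"
      by (intro compact_imp_bounded compact_continuous_image) (auto simp: compact_eq_bounded_closed)
    then show ?thesis by (auto simp: bounded_iff)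
  qed
  then obtain B where B: "\<And>l z. z \<in> K l \<Longrightarrow> norm (X l z) \<le> B l" by metis
  define C where "C = (\<Sum>l\<in>UNIV. \<bar>B l\<bar>)"
  have C0: "C \<ge> 0" by (auto simp: C_def intro: sum_nonneg)
  have BC: "B l \<le> C" for l
    using member_le_sum[of l UNIV "\<lambda>l. \<bar>B l\<bar>"] by (simp add: C_def)
  have big: "\<exists>l. z $ l \<noteq> 0 \<and> (\<forall>j. cmod (X l z $ j) \<le> C * norm z)" if z: "z $ i = 1" for i z
  proof -
    obtain l where l: "\<And>k. cmod (z $ k) \<le> cmod (z $ l)"
    proof -
      have "Max (range (\<lambda>k. cmod (z $ k))) \<in> range (\<lambda>k. cmod (z $ k))" by (rule Max_in) auto
      then obtain l where "cmod (z $ l) = Max (range (\<lambda>k. cmod (z $ k)))" by (metis rangeE)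
      then show ?thesis by (intro that[of l]) simp
    qed
    have l0: "z $ l \<noteq> 0" using l[of i] z by auto
    have mem: "(1 / z $ l) *s z \<in> K l" using l l0 by (auto simp: K_def norm_divide divide_le_eq)
    have "X l z = (z $ l) *s X l ((1 / z $ l) *s z)"
      using holo_vfieldsD(3)[OF X, of z l "1 / z $ l"] l0 by (simp add: vec_eq_iff)
    then have "norm (X l z) = cmod (z $ l) * norm (X l ((1 / z $ l) *s z))" by (simp add: norm_smult_vec)
    also have "\<dots> \<le> norm z * C"
      using B[OF mem] BC[of l] Finite_Cartesian_Product.norm_nth_le[of z l] C0
      by (intro mult_mono) auto
    finally have "norm (X l z) \<le> C * norm z" by (simp add: mult.commute)
    then show ?thesis using l0 Finite_Cartesian_Product.norm_nth_le[of "X l z"] order_trans by blast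
  qed
  show ?thesis
  proof (intro exI[of _ C] conjI C0 allI impI)
    fix i j and z :: "complex^'n" assume z: "z $ i = 1"
    obtain l where l: "z $ l \<noteq> 0" "\<And>j. cmod (X l z $ j) \<le> C * norm z" using big[OF z] by blast
    have "X i z $ j = X l z $ j - X l z $ i * z $ j"
      using holo_vfield_change_chart[OF X _ l(1), of i] z by simp
    then have "cmod (X i z $ j) \<le> cmod (X l z $ j) + cmod (X l z $ i) * cmod (z $ j)"
      using norm_triangle_ineq4 by (metis norm_mult)
    also have "\<dots> \<le> C * norm z + C * norm z * cmod (z $ j)" by (intro add_mono mult_right_mono l) auto
    finally show "cmod (X i z $ j) \<le> C * norm z * (1 + cmod (z $ j))" by (simp add: distrib_left)
  next
    fix i j k and z :: "complex^'n" assume z: "z $ i = 1"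
    obtain l where l: "z $ l \<noteq> 0" "\<And>j. cmod (X l z $ j) \<le> C * norm z" using big[OF z] by blast
    have "X i z $ m = X l z $ m - X l z $ i * z $ m" for m
      using holo_vfield_change_chart[OF X _ l(1), of i] z by simp
    then have "X i z $ j * z $ k - X i z $ k * z $ j = X l z $ j * z $ k - X l z $ k * z $ j"
      by (simp add: left_diff_distrib)
    then have "cmod (X i z $ j * z $ k - X i z $ k * z $ j)
      \<le> cmod (X l z $ j) * cmod (z $ k) + cmod (X l z $ k) * cmod (z $ j)"
      using norm_triangle_ineq4 by (metis norm_mult)
    also have "\<dots> \<le> C * norm z * cmod (z $ k) + C * norm z * cmod (z $ j)"
      by (intro add_mono mult_right_mono l) auto
    finally show "cmod (X i z $ j * z $ k - X i z $ k * z $ j) \<le> C * norm z * (cmod (z $ j) + cmod (z $ k))"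
      by (simp add: distrib_left add.commute)
  qed
qed

text \<open>
  A matrix has just enough entries to match the value and the first derivatives of \<open>X i\<close> at the
  centre of the chart and one second derivative in each direction. The difference vanishes by
  rigidity.
\<close>
lemma holo_vfield_eq_on_chart:
  fixes X :: "'n::finite vfield"
  assumes X: "X \<in> holo_vfields"
  obtains M where "\<And>z. z $ i = 1 \<Longrightarrow> X i z = M *v z - ((M *v z) $ i) *s z"
proof -
  define e where "e k = axis k (1::complex)" for k :: 'n
  have ei: "e i $ i = 1" and ek: "j \<noteq> i \<Longrightarrow> e j $ i = 0" for j by (auto simp: e_def axis_def)
  have "e i $ i \<noteq> 0" by (simp add: ei)
  then obtain D where D: "(X i has_derivative D) (at (e i))" "\<And>c v. D (c *s v) = c *s D v"
    using holo_vfieldsD(1)[OF X] by blast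
  have Dadd: "D (u + v) = D u + D v" for u v
    using has_derivative_bounded_linear[OF D(1)] by (simp add: linear_simps)
  have D0: "D 0 = 0" using has_derivative_bounded_linear[OF D(1)] by (simp add: linear_simps)
  obtain C where C0: "C \<ge> 0"
    and Call: "\<forall>i z j k. z $ i = 1 \<longrightarrow> cmod (X i z $ j) \<le> C * norm z * (1 + cmod (z $ j)) \<and>
       cmod (X i z $ j * z $ k - X i z $ k * z $ j) \<le> C * norm z * (cmod (z $ j) + cmod (z $ k))"
    using holo_vfield_growth[OF X] by blast
  have C: "C \<ge> 0"
    "\<And>z j. z $ i = 1 \<Longrightarrow> cmod (X i z $ j) \<le> C * norm z * (1 + cmod (z $ j))"
    "\<And>z j k. z $ i = 1 \<Longrightarrow>
       cmod (X i z $ j * z $ k - X i z $ k * z $ j) \<le> C * norm z * (cmod (z $ j) + cmod (z $ k))"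
    using C0 Call by auto
  have holX: "(\<lambda>t. X i (z + t *s v) $ j) holomorphic_on UNIV" if "z $ i = 1" "v $ i = 0" for z v j
    unfolding holomorphic_on_def
  proof
    fix t
    have "(z + t *s v) $ i \<noteq> 0" using that by simp
    then obtain D' where "(X i has_derivative D') (at (z + t *s v))" "\<And>c v. D' (c *s v) = c *s D' v"
      using holo_vfieldsD(1)[OF X] by blast
    then show "(\<lambda>t. X i (z + t *s v) $ j) field_differentiable at t within UNIV"
      using has_derivative_along_line[of "X i" D' z t v j] by (auto simp: field_differentiable_def)
  qed
  have derX: "((\<lambda>t. X i (e i + t *s u) $ j) has_field_derivative D u $ j) (at 0)" for u j
    using has_derivative_along_line[of "X i" D "e i" 0 u j] D by simp
  have Di: "D u $ i = 0" if "u $ i = 0" for u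
  proof -
    have "(\<lambda>t. X i (e i + t *s u) $ i) = (\<lambda>t. 0)"
      using that ei holo_vfieldsD(2)[OF X] by (auto simp: fun_eq_iff)
    then show ?thesis using derX[of u i] DERIV_unique DERIV_const by metis
  qed
  have "\<exists>p2. \<forall>t. X i (e i + t *s e k) $ k = X i (e i) $ k + D (e k) $ k * t + p2 * t ^ 2" if k: "k \<noteq> i" for k
  proof -
    have "\<exists>p0 p1 p2. \<forall>t. X i (e i + t *s e k) $ k = p0 + p1 * t + p2 * t ^ 2"
    proof (rule quadratic_growth_imp_quadratic[OF holX])
      fix t
      let ?z = "e i + t *s e k"
      have "cmod (X i ?z $ k) \<le> C * norm ?z * (1 + cmod (?z $ k))" by (rule C) (use ei ek[OF k] in simp)
      also have "\<dots> \<le> C * (norm (e i) + norm (e k) * cmod t) * (1 + 1 * cmod t)"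
      proof (intro mult_mono mult_left_mono C mult_nonneg_nonneg add_nonneg_nonneg)
        show "norm ?z \<le> norm (e i) + norm (e k) * cmod t"
          using norm_triangle_ineq[of "e i" "t *s e k"] by (simp add: norm_smult_vec mult.commute)
        show "1 + cmod (?z $ k) \<le> 1 + 1 * cmod t" using k by (simp add: e_def axis_def)
      qed auto
      finally show "cmod (X i ?z $ k) \<le> C * (norm (e i) + norm (e k) * cmod t) * (1 + 1 * cmod t)" .
    qed (use ei ek[OF k] C in auto)
    then obtain p0 p1 p2 where p: "\<And>t. X i (e i + t *s e k) $ k = p0 + p1 * t + p2 * t ^ 2" by blast
    have "((\<lambda>t. p0 + p1 * t + p2 * t ^ 2) has_field_derivative p1) (at 0)"
      by (auto intro!: derivative_eq_intros)
    then have "D (e k) $ k = p1" using derX[of "e k" k] unfolding p by (rule DERIV_unique[rotated])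
    then show ?thesis using p p[of 0] by auto
  qed
  then obtain q where q: "\<And>k t. k \<noteq> i \<Longrightarrow>
      X i (e i + t *s e k) $ k = X i (e i) $ k + D (e k) $ k * t + q k * t ^ 2" by metis
  define m where "m v = (\<Sum>k\<in>- {i}. q k * v $ k)" for v :: "complex^'n"
  define F where "F v = v $ i *s X i (e i) + D (v - v $ i *s e i) - m v *s e i" for v
  have mlin: "m (u + v) = m u + m v" "m (c *s v) = c * m v" for u v c
    by (simp_all add: m_def sum.distrib sum_distrib_left algebra_simps)
  have "Vector_Spaces.linear (*s) (*s) F"
  proof (rule Vector_Spaces.linear_iff[THEN iffD2], intro conjI allI)
    fix u v c
    have Du: "D (u + v - (u + v) $ i *s e i) = D ((u - u $ i *s e i) + (v - v $ i *s e i))"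
      by (rule arg_cong[of _ _ D]) (simp add: vec_eq_iff algebra_simps)
    show "F (u + v) = F u + F v" unfolding F_def Du Dadd mlin by (simp add: vec_eq_iff algebra_simps)
    have Dc: "D (c *s u - (c *s u) $ i *s e i) = D (c *s (u - u $ i *s e i))"
      by (rule arg_cong[of _ _ D]) (simp add: vec_eq_iff algebra_simps)
    show "F (c *s u) = c *s F u" unfolding F_def Dc D(2) mlin by (simp add: vec_eq_iff algebra_simps)
  qed (unfold_locales)
  then have F: "matrix F *v v = F v" for v by (rule matrix_works)
  have ai: "X i (e i) $ i = 0" using holo_vfieldsD(2)[OF X, of "e i" i] ei by simp
  have Fi: "F z $ i = - m z" if "z $ i = 1" for z
    using that ai Di[of "z - e i"] ei by (simp add: F_def)
  define Y where "Y z = X i z - (F z - F z $ i *s z)" for z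
  have Yline: "Y (e i + t *s u) $ j = X i (e i + t *s u) $ j - X i (e i) $ j - t * D u $ j - t ^ 2 * m u * u $ j"
    if u: "u $ i = 0" for u t j
  proof -
    have me: "m (e i) = 0" by (auto simp: m_def e_def axis_def intro!: sum.neutral)
    have "F (e i + t *s u) = X i (e i) + t *s D u - (t * m u) *s e i"
      using u ei by (simp add: F_def mlin me D(2))
    then have "F (e i + t *s u) $ j = X i (e i) $ j + t * D u $ j - t * m u * e i $ j" by simp
    moreover have "F (e i + t *s u) $ i = - (t * m u)" using u ei by (simp add: Fi mlin me)
    ultimately show ?thesis by (simp add: Y_def algebra_simps power2_eq_square)
  qed
  \<comment> \<open>The field induced by a matrix satisfies the same growth estimates as \<open>X\<close>.\<close>
  obtain K where K: "K \<ge> 0" "\<And>v. norm (matrix F *v v) \<le> K * norm v"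
    using linear_bounded_pos[OF matrix_vector_mul_linear[of "matrix F"]] by (metis less_imp_le)
  have Fb: "cmod (F z $ j) \<le> K * norm z" for z j
    using K(2)[of z] Finite_Cartesian_Product.norm_nth_le[of "F z" j] unfolding F by linarith
  have "Y z = 0" if z: "z $ i = 1" for z
  proof -
    have "Y z $ k = 0" if k: "k \<noteq> i" for k
    proof (rule chart_field_rigid[where Y = Y and z = z and C = "C + K" and i = i and e = e])
      show "e k = axis k 1" for k by (rule e_def)
      show "C + K \<ge> 0" using C K by simp
      show "Y (e i) = 0" using Yline[of 0 0] by (simp add: vec_eq_iff D0)
      show "deriv (\<lambda>t. Y (e i + t *s u) $ j) 0 = 0" if u: "u $ i = 0" for u j
        unfolding Yline[OF u]
        by (rule DERIV_imp_deriv) (use derX[of u j] in \<open>auto intro!: derivative_eq_intros\<close>)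
      show "Y (e i + t *s e k) $ k = 0" if k: "k \<noteq> i" for k t
      proof -
        have "m (e k) = q k"
          using k by (simp add: m_def e_def axis_def if_distrib cong: if_cong)
        moreover have "e k $ k = 1" by (simp add: e_def)
        ultimately show ?thesis
          unfolding Yline[OF ek[OF k]] q[OF k] by (simp add: algebra_simps)
      qed
      show "cmod (Y z $ j) \<le> (C + K) * norm z * (1 + cmod (z $ j))" if z: "z $ i = 1" for z j
      proof -
        have "cmod (Y z $ j) \<le> cmod (X i z $ j) + (cmod (F z $ j) + cmod (F z $ i) * cmod (z $ j))"
          unfolding Y_def using norm_triangle_ineq4[of "X i z $ j" "F z $ j - F z $ i * z $ j"]
            norm_triangle_ineq4[of "F z $ j" "F z $ i * z $ j"] by (simp add: norm_mult)
        also have "\<dots> \<le> C * norm z * (1 + cmod (z $ j)) + (K * norm z + K * norm z * cmod (z $ j))"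
          by (intro add_mono mult_right_mono C Fb z) auto
        finally show ?thesis by (simp add: algebra_simps)
      qed
      show "cmod (Y z $ j * z $ k - Y z $ k * z $ j) \<le> (C + K) * norm z * (cmod (z $ j) + cmod (z $ k))"
        if z: "z $ i = 1" for z j k
      proof -
        have "Y z $ j * z $ k - Y z $ k * z $ j
          = (X i z $ j * z $ k - X i z $ k * z $ j) - (F z $ j * z $ k - F z $ k * z $ j)"
          by (simp add: Y_def algebra_simps)
        then have "cmod (Y z $ j * z $ k - Y z $ k * z $ j)
          \<le> cmod (X i z $ j * z $ k - X i z $ k * z $ j) + (cmod (F z $ j) * cmod (z $ k) + cmod (F z $ k) * cmod (z $ j))"
          using norm_triangle_ineq4[of "X i z $ j * z $ k - X i z $ k * z $ j" "F z $ j * z $ k - F z $ k * z $ j"]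
            norm_triangle_ineq4[of "F z $ j * z $ k" "F z $ k * z $ j"] by (simp add: norm_mult)
        also have "\<dots> \<le> C * norm z * (cmod (z $ j) + cmod (z $ k)) + (K * norm z * cmod (z $ k) + K * norm z * cmod (z $ j))"
          by (intro add_mono mult_right_mono C Fb z) auto
        finally show ?thesis by (simp add: algebra_simps)
      qed
      show "(\<lambda>t. Y (z + t *s v) $ j) holomorphic_on UNIV" if "z $ i = 1" "v $ i = 0" for z v j
      proof -
        have Fl: "F (z + t *s v) = F z + t *s F v" for t
          by (simp flip: F add: matrix_vector_right_distrib vector_scalar_commute)
        show ?thesis unfolding Y_def Fl by (auto intro!: holomorphic_intros holX that)
      qed
    qed (use z k in auto)
    moreover have "Y z $ i = 0"
      using z holo_vfieldsD(2)[OF X, of z i] by (simp add: Y_def)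
    ultimately show ?thesis by (metis vec_eq_iff zero_index)
  qed
  then show ?thesis by (intro that[of "matrix F"]) (simp add: F Y_def)
qed


text \<open>
  A matrix found in one chart represents the field in the other charts as well, first where both
  charts are defined and then by continuity.
\<close>
lemma holo_vfield_linear:
  fixes X :: "'n::finite vfield"
  assumes X: "X \<in> holo_vfields"
  obtains M where "X = vf_of M"
proof -
  fix i :: 'n
  obtain M where M: "\<And>z. z $ i = 1 \<Longrightarrow> X i z = M *v z - ((M *v z) $ i) *s z"
    using holo_vfield_eq_on_chart[OF X] by blast
  have Xi: "X i z = M *v z - ((M *v z) $ i / z $ i) *s z" if z: "z $ i \<noteq> 0" for z
  proof -
    have "X i ((1 / z $ i) *s z) = (1 / z $ i) *s X i z" using holo_vfieldsD(3)[OF X z] z by simp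
    then have "X i z = (z $ i) *s X i ((1 / z $ i) *s z)" using z by (simp add: vec_eq_iff)
    also have "\<dots> = M *v z - ((M *v z) $ i / z $ i) *s z"
      using z by (subst M) (simp_all add: vector_scalar_commute vec_eq_iff field_simps)
    finally show ?thesis .
  qed
  have Xj: "X j z = M *v z - ((M *v z) $ j / z $ j) *s z" if z: "z $ j \<noteq> 0" "z $ i \<noteq> 0" for j z
    using holo_vfield_change_chart[OF X z] Xi[OF z(2)] z by (simp add: vec_eq_iff field_simps)
  have Xj': "X j z = M *v z - ((M *v z) $ j / z $ j) *s z" if z: "z $ j \<noteq> 0" for j z
  proof (cases "z $ i = 0")
    case True
    then have "j \<noteq> i" using z by auto
    define c where "c t = z + of_real t *s axis i 1" for t :: real
    have cj: "c t $ j = z $ j" for t using \<open>j \<noteq> i\<close> by (simp add: c_def axis_def)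
    have cc: "(c \<longlongrightarrow> z) (at 0)"
      unfolding c_def by (rule vec_tendstoI) (auto intro!: tendsto_eq_intros)
    have "isCont (X j) z" using holo_vfieldsD(1)[OF X z] has_derivative_continuous by blast
    then have 1: "((\<lambda>t. X j (c t)) \<longlongrightarrow> X j z) (at 0)" using cc by (rule isCont_tendsto_compose)
    have 2: "((\<lambda>t. M *v c t - ((M *v c t) $ j / c t $ j) *s c t) \<longlongrightarrow> M *v z - ((M *v z) $ j / z $ j) *s z) (at 0)"
    proof -
      have m: "((\<lambda>t. M *v c t) \<longlongrightarrow> M *v z) (at 0)"
        using cc by (intro bounded_linear.tendsto[of "(*v) M"]) (auto simp: linear_conv_bounded_linear[symmetric])
      show ?thesis unfolding cj
        by (rule vec_tendstoI) (use z m cc in \<open>auto intro!: tendsto_intros tendsto_vec_nth\<close>)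
    qed
    have "\<forall>\<^sub>F t in at (0::real). X j (c t) = M *v c t - ((M *v c t) $ j / c t $ j) *s c t"
      using eventually_neq_at_within[of 0 0 UNIV]
    proof eventually_elim
      case (elim t)
      then have "c t $ i \<noteq> 0" using True by (simp add: c_def)
      then show ?case using z cj by (intro Xj) auto
    qed
    then have "((\<lambda>t. X j (c t)) \<longlongrightarrow> M *v z - ((M *v z) $ j / z $ j) *s z) (at 0)"
      using 2 by (simp add: tendsto_cong)
    then show ?thesis using 1 tendsto_unique[of "at (0::real)"] by simp
  next
    case False then show ?thesis using Xj[OF z] by simp
  qed
  have "X = vf_of M"
    using Xj' holo_vfieldsD(5)[OF X] by (auto simp: vf_of_def fun_eq_iff)
  then show ?thesis by (rule that)
qed

lemma vf_of_add: "vf_of (M + N) = vf_of M + vf_of N"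
  by (auto simp: vf_of_def fun_eq_iff matrix_vector_mult_add_rdistrib vec_eq_iff add_divide_distrib algebra_simps)

lemma vf_of_cscale: "vf_of (cscale c M) = vf_scale c (vf_of M)"
  by (auto simp: vf_of_def fun_eq_iff vf_scale_def vec_eq_iff algebra_simps)

lemma vf_of_0: "vf_of 0 = 0"
  by (auto simp: vf_of_def fun_eq_iff)

lemma vf_of_mat_1: "vf_of (mat 1) = 0"
  by (auto simp: vf_of_def fun_eq_iff)

text \<open>
  All nonzero vectors are eigenvectors of \<open>M\<close>.
\<close>
lemma vf_of_eq_0_imp_scalar:
  fixes M :: "complex^'n::finite^'n"
  assumes "vf_of M = 0"
  shows "\<exists>c. M = cscale c (mat 1)"
proof -
  have *: "M *v z = ((M *v z) $ i / z $ i) *s z" if "z $ i \<noteq> 0" for z i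
  proof -
    have "vf_of M i z = 0" using assms by simp
    then show ?thesis using that by (simp add: vf_of_def)
  qed
  have col: "(M *v axis k 1) $ j = M $ j $ k" for j k
    by (simp add: matrix_vector_mult_def axis_def if_distrib cong: if_cong)
  have ax: "axis k (1::complex) $ j = (if j = k then 1 else 0)" for j k :: 'n by (simp add: axis_def)
  have off: "M $ j $ k = 0" if "j \<noteq> k" for j k
    using arg_cong[OF *[of "axis k 1" k], of "\<lambda>v. v $ j"] that by (simp add: col ax)
  have diag: "M $ j $ j = M $ k $ k" if "j \<noteq> k" for j k
  proof -
    let ?z = "axis j 1 + axis k 1 :: complex^'n"
    have Mz: "(M *v ?z) $ l = M $ l $ j + M $ l $ k" for l
      by (simp add: matrix_vector_right_distrib col)
    have "?z $ j = 1" "?z $ k = 1" using that by (auto simp: axis_def)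
    then have "(M *v ?z) $ k = (M *v ?z) $ j" using arg_cong[OF *[of ?z j], of "\<lambda>v. v $ k"] by simp
    then show ?thesis using that by (simp add: Mz off)
  qed
  have d: "M $ j $ j = M $ undefined $ undefined" for j
    by (cases "j = undefined") (auto intro: diag)
  show ?thesis
  proof
    show "M = cscale (M $ undefined $ undefined) (mat 1)"
      using off d by (auto simp: cscale_def mat_def vec_eq_iff)
  qed
qed

lemma dir_deriv_vf_of:
  assumes z: "z $ i \<noteq> 0" and u: "u $ i = 0"
  shows "dir_deriv (\<lambda>x. vf_of N i x $ k) z u
    = (N *v u) $ k - (N *v u) $ i / z $ i * z $ k - (N *v z) $ i / z $ i * u $ k"
proof -
  have eq: "vf_of N i (z + t *s u) $ k
    = (N *v z) $ k + t * (N *v u) $ k - ((N *v z) $ i + t * (N *v u) $ i) / z $ i * (z $ k + t * u $ k)" for t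
    using assms by (simp add: vf_of_def matrix_vector_right_distrib vector_scalar_commute algebra_simps add_divide_distrib)
  show ?thesis
    unfolding dir_deriv_def eq
    by (rule DERIV_imp_deriv) (use z in \<open>auto intro!: derivative_eq_intros simp: field_simps\<close>)
qed

text \<open>
  The sign is the usual one: linear vector fields bracket opposite to their matrices.
\<close>
lemma lie_bracket_vf_of: "lie_bracket (vf_of M) (vf_of N) = vf_of (comm N M)"
proof (intro ext)
  fix i z
  show "lie_bracket (vf_of M) (vf_of N) i z = vf_of (comm N M) i z"
  proof (cases "z $ i = 0")
    case False
    have 0: "vf_of M i z $ i = 0" for M using False by (simp add: vf_of_def)
    have c: "comm N M *v z = N *v (M *v z) - M *v (N *v z)"
      by (simp add: comm_def matrix_vector_mult_diff_rdistrib matrix_vector_mul_assoc)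
    have v: "vf_of M i z = M *v z - ((M *v z) $ i / z $ i) *s z" for M using False by (simp add: vf_of_def)
    have eq: "lie_bracket (vf_of M) (vf_of N) i z = (\<chi> k.
       ((N *v vf_of M i z) $ k - (N *v vf_of M i z) $ i / z $ i * z $ k - (N *v z) $ i / z $ i * vf_of M i z $ k)
     - ((M *v vf_of N i z) $ k - (M *v vf_of N i z) $ i / z $ i * z $ k - (M *v z) $ i / z $ i * vf_of N i z $ k))"
      using False by (simp add: lie_bracket_def dir_deriv_vf_of[OF False 0])
    show ?thesis
      unfolding eq v c using False
      by (simp add: vec_eq_iff matrix_vector_mult_diff_distrib vector_scalar_commute field_simps)
  qed (simp add: lie_bracket_def vf_of_def)
qed

section \<open>Polynomial relations along orbits\<close>

definition dword :: "(complex^'n^'n) list \<Rightarrow> (complex^'n::finite \<Rightarrow> complex) \<Rightarrow> complex^'n \<Rightarrow> complex" where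
  "dword Ms f = foldr dop Ms f"

lemma dword_simps [simp]: "dword [] f = f" "dword (M # Ms) f = dop M (dword Ms f)"
  by (simp_all add: dword_def)

lemma hom_dword: "hom_poly_fun d f \<Longrightarrow> hom_poly_fun d (dword Ms f)"
  by (induction Ms) (auto intro: hom_dop)

lemma dop_sum:
  assumes "\<And>i. i \<in> I \<Longrightarrow> hom_poly_fun d (f i)"
  shows "dop M (\<lambda>x. \<Sum>i\<in>I. c i * f i x) = (\<lambda>x. \<Sum>i\<in>I. c i * dop M (f i) x)"
  unfolding dop_def[abs_def] by (intro ext dir_deriv_sum[OF assms])

lemma dword_sum:
  assumes "\<And>i. i \<in> I \<Longrightarrow> hom_poly_fun d (f i)"
  shows "dword Ms (\<lambda>x. \<Sum>i\<in>I. c i * f i x) = (\<lambda>x. \<Sum>i\<in>I. c i * dword Ms (f i) x)"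
proof (induction Ms)
  case (Cons M Ms)
  then show ?case using dop_sum[of I d "\<lambda>i. dword Ms (f i)" M c] assms by (simp add: hom_dword)
qed simp

lemma hom_mono: "\<alpha> \<in> expos d \<Longrightarrow> hom_poly_fun d (monomial_fun \<alpha>)"
  using hom_monomial[of \<alpha> d 1] by simp

text \<open>
  The polynomial \<open>F(z, x) = \<Sum> p \<alpha> z * x^\<alpha>\<close> is an orbit relation if, for \<open>z\<close> in \<open>\<Omega>\<close>, the function
  \<open>F(z, \<sqdot>)\<close> vanishes at \<open>z\<close> with all its iterated derivatives along \<open>g\<close>. This is the infinitesimal
  form of the vanishing of \<open>F(z, \<sqdot>)\<close> on the orbit of \<open>z\<close>.
\<close>
definition orbit_relation ::
  "(complex^'n^'n) set \<Rightarrow> (complex^'n::finite) set \<Rightarrow> nat \<Rightarrow> nat \<Rightarrow> (('n \<Rightarrow> nat) \<Rightarrow> complex^'n \<Rightarrow> complex) \<Rightarrow> bool" where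
  "orbit_relation g \<Omega> m a p \<longleftrightarrow> (\<forall>\<alpha>\<in>expos m. hom_poly_fun a (p \<alpha>)) \<and>
    (\<forall>z\<in>\<Omega>. \<forall>Ms. set Ms \<subseteq> g \<longrightarrow> (\<Sum>\<alpha>\<in>expos m. p \<alpha> z * dword Ms (monomial_fun \<alpha>) z) = 0)"

text \<open>
  Differentiate \<open>\<Sum> p \<alpha> z * dword Ms (monomial_fun \<alpha>) z = 0\<close> with respect to \<open>z\<close> along \<open>M\<close>. The terms
  where a monomial is differentiated belong to the longer word \<open>M # Ms\<close> and cancel.
\<close>
lemma orbit_relation_dop:
  assumes rel: "orbit_relation g \<Omega> m a p" and \<Omega>: "open \<Omega>" and M: "M \<in> g"
  shows "orbit_relation g \<Omega> m a (\<lambda>\<alpha>. dop M (p \<alpha>))"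
  unfolding orbit_relation_def
proof (intro conjI ballI allI impI)
  have hom: "hom_poly_fun a (p \<alpha>)" if "\<alpha> \<in> expos m" for \<alpha> using rel that by (auto simp: orbit_relation_def)
  then show "hom_poly_fun a (dop M (p \<alpha>))" if "\<alpha> \<in> expos m" for \<alpha> using that by (intro hom_dop)
  fix z Ms assume z: "z \<in> \<Omega>" and Ms: "set Ms \<subseteq> g"
  define l where "l t = z + t *s (M *v z)" for t
  define h where "h t = (\<Sum>\<alpha>\<in>expos m. p \<alpha> (l t) * dword Ms (monomial_fun \<alpha>) (l t))" for t
  have homd: "hom_poly_fun m (dword Ms (monomial_fun \<alpha>))" if "\<alpha> \<in> expos m" for \<alpha>
    using that by (intro hom_dword hom_mono)
  have "isCont l 0" unfolding l_def by (rule has_derivative_continuous[OF line_has_derivative])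
  then have "(l \<longlongrightarrow> z) (at 0)" by (simp add: isCont_def l_def)
  then have "\<forall>\<^sub>F t in at 0. l t \<in> \<Omega>" using \<Omega> z by (rule topological_tendstoD)
  then have "\<forall>\<^sub>F t in nhds 0. l t \<in> \<Omega>" using z by (simp add: eventually_nhds_conv_at l_def)
  then have "\<forall>\<^sub>F t in nhds 0. h t = 0"
  proof eventually_elim
    case (elim t)
    then show ?case using rel Ms by (simp add: orbit_relation_def h_def)
  qed
  then have "deriv h 0 = deriv (\<lambda>_. 0) 0" by (intro deriv_cong_ev refl)
  moreover have "(h has_field_derivative (\<Sum>\<alpha>\<in>expos m. p \<alpha> z * dop M (dword Ms (monomial_fun \<alpha>)) z
      + dop M (p \<alpha>) z * dword Ms (monomial_fun \<alpha>) z)) (at 0)"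
    unfolding h_def
  proof (intro DERIV_sum)
    fix \<alpha> :: "'a \<Rightarrow> nat" assume \<alpha>: "\<alpha> \<in> expos m"
    show "((\<lambda>t. p \<alpha> (l t) * dword Ms (monomial_fun \<alpha>) (l t)) has_field_derivative
       p \<alpha> z * dop M (dword Ms (monomial_fun \<alpha>)) z + dop M (p \<alpha>) z * dword Ms (monomial_fun \<alpha>) z) (at 0)"
      using DERIV_mult[OF hom_line_derivative[OF hom[OF \<alpha>], of z "M *v z"] hom_line_derivative[OF homd[OF \<alpha>], of z "M *v z"]]
      by (simp add: l_def dop_def algebra_simps)
  qed
  ultimately have "(\<Sum>\<alpha>\<in>expos m. p \<alpha> z * dop M (dword Ms (monomial_fun \<alpha>)) z
      + dop M (p \<alpha>) z * dword Ms (monomial_fun \<alpha>) z) = 0"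
    by (simp add: DERIV_imp_deriv)
  moreover have "(\<Sum>\<alpha>\<in>expos m. p \<alpha> z * dword (M # Ms) (monomial_fun \<alpha>) z) = 0"
  proof -
    have "\<forall>z\<in>\<Omega>. \<forall>Ms. set Ms \<subseteq> g \<longrightarrow> (\<Sum>\<alpha>\<in>expos m. p \<alpha> z * dword Ms (monomial_fun \<alpha>) z) = 0"
      using rel unfolding orbit_relation_def by (rule conjunct2)
    from this[rule_format, OF z, of "M # Ms"] show ?thesis using Ms M by simp
  qed
  ultimately show "(\<Sum>\<alpha>\<in>expos m. dop M (p \<alpha>) z * dword Ms (monomial_fun \<alpha>) z) = 0"
    by (simp add: sum.distrib)
qed

text \<open>
  For a relation \<open>p\<close> with minimal support and a fixed \<open>\<beta>\<close> in the support, the relation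
  \<open>p \<beta> * dop M (p \<alpha>) - dop M (p \<beta>) * p \<alpha>\<close> has smaller support, as it vanishes for \<open>\<alpha> = \<beta>\<close>, so it is
  zero. If all ratios \<open>p \<alpha> / p \<beta>\<close> were constants \<open>c \<alpha>\<close>, the relation at \<open>x = z\<close> would be a linear
  dependence \<open>\<Sum> c \<alpha> * z^\<alpha> = 0\<close> of monomials.
\<close>
lemma invariant_ratio_of_relation:
  fixes g :: "(complex^'n::finite^'n) set"
  assumes \<Omega>: "open \<Omega>" "z0 \<in> \<Omega>"
    and ex: "orbit_relation g \<Omega> m a0 p0" "\<alpha>0 \<in> expos m" "p0 \<alpha>0 z1 \<noteq> 0"
  shows "\<exists>d P Q. hom_poly_fun d P \<and> hom_poly_fun d Q \<and> (\<exists>z. Q z \<noteq> 0) \<and>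
    \<not> (\<exists>c. \<forall>z. Q z \<noteq> 0 \<longrightarrow> P z / Q z = c) \<and> (\<forall>M\<in>g. \<forall>z. dop M P z * Q z = P z * dop M Q z)"
proof -
  define supp where "supp p = {\<alpha> \<in> expos m. \<exists>z. p \<alpha> z \<noteq> 0}" for p :: "('n \<Rightarrow> nat) \<Rightarrow> complex^'n \<Rightarrow> complex"
  let ?R = "\<lambda>(a, p). orbit_relation g \<Omega> m a p \<and> supp p \<noteq> {}"
  have "?R (a0, p0)" using ex by (auto simp: supp_def)
  then obtain ap where ap: "?R ap" "\<And>bq. ?R bq \<Longrightarrow> card (supp (snd ap)) \<le> card (supp (snd bq))"
    using ex_has_least_nat[of ?R "(a0, p0)" "\<lambda>ap. card (supp (snd ap))"] by blast
  obtain a p where "ap = (a, p)" by (cases ap)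
  then have rel: "orbit_relation g \<Omega> m a p" and ne: "supp p \<noteq> {}"
    and min: "\<And>b q. orbit_relation g \<Omega> m b q \<Longrightarrow> supp q \<noteq> {} \<Longrightarrow> card (supp p) \<le> card (supp q)"
    using ap by fastforce+
  have hom: "hom_poly_fun a (p \<alpha>)" if "\<alpha> \<in> expos m" for \<alpha> using rel that by (auto simp: orbit_relation_def)
  obtain \<beta> where \<beta>: "\<beta> \<in> supp p" using ne by blast
  then have \<beta>': "\<beta> \<in> expos m" "\<exists>z. p \<beta> z \<noteq> 0" by (auto simp: supp_def)
  have inv: "dop M (p \<alpha>) z * p \<beta> z = p \<alpha> z * dop M (p \<beta>) z" if M: "M \<in> g" and \<alpha>: "\<alpha> \<in> expos m" for M \<alpha> z
  proof -
    define q where "q \<alpha> = (\<lambda>z. p \<beta> z * dop M (p \<alpha>) z - dop M (p \<beta>) z * p \<alpha> z)" for \<alpha>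
    have "orbit_relation g \<Omega> m (a + a) q"
      unfolding orbit_relation_def
    proof (intro conjI ballI allI impI)
      show "hom_poly_fun (a + a) (q \<alpha>)" if "\<alpha> \<in> expos m" for \<alpha>
        unfolding q_def using that \<beta>' hom by (intro hom_diff hom_mult hom_dop)
      fix z Ms assume "z \<in> \<Omega>" "set Ms \<subseteq> g"
      then have 1: "(\<Sum>\<alpha>\<in>expos m. p \<alpha> z * dword Ms (monomial_fun \<alpha>) z) = 0"
        and 2: "(\<Sum>\<alpha>\<in>expos m. dop M (p \<alpha>) z * dword Ms (monomial_fun \<alpha>) z) = 0"
        using rel orbit_relation_dop[OF rel \<Omega>(1) M] by (auto simp: orbit_relation_def)
      have "(\<Sum>\<alpha>\<in>expos m. q \<alpha> z * dword Ms (monomial_fun \<alpha>) z)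
        = p \<beta> z * (\<Sum>\<alpha>\<in>expos m. dop M (p \<alpha>) z * dword Ms (monomial_fun \<alpha>) z)
          - dop M (p \<beta>) z * (\<Sum>\<alpha>\<in>expos m. p \<alpha> z * dword Ms (monomial_fun \<alpha>) z)"
        by (simp add: q_def left_diff_distrib sum_subtractf sum_distrib_left mult.assoc)
      then show "(\<Sum>\<alpha>\<in>expos m. q \<alpha> z * dword Ms (monomial_fun \<alpha>) z) = 0" using 1 2 by simp
    qed
    moreover have "supp q \<subseteq> supp p - {\<beta>}"
    proof
      fix \<gamma> assume \<gamma>: "\<gamma> \<in> supp q"
      then have "\<gamma> \<noteq> \<beta>" by (auto simp: supp_def q_def)
      moreover have "\<gamma> \<in> supp p"
      proof (rule ccontr)
        assume "\<gamma> \<notin> supp p"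
        then have "p \<gamma> = (\<lambda>_. 0)" using \<gamma> by (auto simp: supp_def)
        then have "q \<gamma> = (\<lambda>_. 0)" by (simp add: q_def dop_def dir_deriv_def)
        then show False using \<gamma> by (simp add: supp_def)
      qed
      ultimately show "\<gamma> \<in> supp p - {\<beta>}" by blast
    qed
    moreover have "card (supp p - {\<beta>}) < card (supp p)"
      using \<beta> by (intro card_Diff1_less) (auto simp: supp_def)
    moreover have "finite (supp p - {\<beta>})" by (auto simp: supp_def)
    ultimately have "supp q = {}" using min[of "a + a" q] card_mono by (metis le_less_trans not_less)
    then have "q \<alpha> z = 0" using \<alpha> by (auto simp: supp_def)
    then show ?thesis by (simp add: q_def mult.commute)
  qed
  have "\<exists>\<alpha>\<in>expos m. \<not> (\<exists>c. \<forall>z. p \<beta> z \<noteq> 0 \<longrightarrow> p \<alpha> z / p \<beta> z = c)"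
  proof (rule ccontr)
    assume "\<not> ?thesis"
    then obtain c where c: "\<And>\<alpha> z. \<alpha> \<in> expos m \<Longrightarrow> p \<beta> z \<noteq> 0 \<Longrightarrow> p \<alpha> z / p \<beta> z = c \<alpha>" by metis
    define f where "f z = (\<Sum>\<alpha>\<in>expos m. c \<alpha> * monomial_fun \<alpha> z)" for z
    have homf: "hom_poly_fun m f" unfolding f_def by (intro hom_sum hom_monomial)
    have "p \<beta> z * f z = 0" for z
    proof (rule hom_zero_on_open[OF hom_mult[OF hom[OF \<beta>'(1)] homf] \<Omega>])
      fix z assume z: "z \<in> \<Omega>"
      show "p \<beta> z * f z = 0"
      proof (cases "p \<beta> z = 0")
        case False
        have "p \<beta> z * f z = (\<Sum>\<alpha>\<in>expos m. p \<alpha> z * monomial_fun \<alpha> z)"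
          unfolding f_def sum_distrib_left
        proof (rule sum.cong[OF refl])
          fix \<alpha> :: "'n \<Rightarrow> nat" assume "\<alpha> \<in> expos m"
          then have "p \<alpha> z = p \<beta> z * c \<alpha>" using c[of \<alpha> z] False by (simp add: field_simps)
          then show "p \<beta> z * (c \<alpha> * monomial_fun \<alpha> z) = p \<alpha> z * monomial_fun \<alpha> z" by simp
        qed
        also have "\<dots> = 0"
        proof -
          have "\<forall>Ms. set Ms \<subseteq> g \<longrightarrow> (\<Sum>\<alpha>\<in>expos m. p \<alpha> z * dword Ms (monomial_fun \<alpha>) z) = 0"
            using rel z by (simp add: orbit_relation_def)
          from this[rule_format, of "[]"] show ?thesis by simp
        qed
        finally show ?thesis .
      qed simp
    qed
    then have pf: "p \<beta> z \<noteq> 0 \<Longrightarrow> f z = 0" for z by (metis mult_eq_0_iff)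
    obtain z2 where z2: "p \<beta> z2 \<noteq> 0" using \<beta>'(2) by blast
    have f0: "f z = 0" for z
      by (rule hom_dense[OF hom[OF \<beta>'(1)] z2 hom_continuous[OF homf] pf])
    have "c \<beta> = 0"
    proof (rule monomial_independent[of "expos m" c \<beta>])
      show "(\<Sum>\<alpha>\<in>expos m. c \<alpha> * monomial_fun \<alpha> z) = 0" for z using f0[of z] by (simp only: f_def)
    qed (rule finite_expos \<beta>'(1))+
    moreover have "c \<beta> = 1" using c[OF \<beta>'(1) z2] z2 by simp
    ultimately show False by simp
  qed
  then obtain \<alpha> where \<alpha>: "\<alpha> \<in> expos m" "\<not> (\<exists>c. \<forall>z. p \<beta> z \<noteq> 0 \<longrightarrow> p \<alpha> z / p \<beta> z = c)"
    by (rule bexE)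
  show ?thesis
  proof (rule exI[of _ a], rule exI[of _ "p \<alpha>"], rule exI[of _ "p \<beta>"], intro conjI ballI allI)
    show "hom_poly_fun a (p \<alpha>)" "hom_poly_fun a (p \<beta>)" using hom \<alpha>(1) \<beta>'(1) by auto
    show "\<exists>z. p \<beta> z \<noteq> 0" by (rule \<beta>'(2))
    show "dop M (p \<alpha>) z * p \<beta> z = p \<alpha> z * dop M (p \<beta>) z" if "M \<in> g" for M z
      by (rule inv[OF that \<alpha>(1)])
  qed (rule \<alpha>(2))
qed

section \<open>Flows of nilpotent matrices\<close>

lemma mexp_mult_vec:
  fixes N :: "complex^'n::finite^'n"
  shows "mexp D N s *v w = (\<Sum>l<D. (s ^ l / fact l) *s (mpow N l *v w))"
proof -
  have "sum f I *v w = (\<Sum>i\<in>I. f i *v w)" for f :: "nat \<Rightarrow> complex^'n^'n" and I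
    by (induction I rule: infinite_finite_induct) (auto simp: matrix_vector_mult_add_rdistrib)
  then show ?thesis by (simp add: mexp_def)
qed

lemma matrix_vector_mult_sum: "M *v sum f I = (\<Sum>i\<in>I. M *v (f i :: complex^'n))"
  by (induction I rule: infinite_finite_induct) (auto simp: matrix_vector_right_distrib)

lemma mexp_has_derivative:
  assumes N: "mpow N D = 0"
  shows "((\<lambda>s. mexp D N s *v w) has_derivative (\<lambda>h. h *s (N *v (mexp D N s *v w)))) (at s)"
proof -
  have "D \<noteq> 0" using N mat_1_neq_0 by (cases D) auto
  then obtain D' where D': "D = Suc D'" by (cases D) auto
  let ?d = "\<lambda>l. of_nat l * s ^ (l - 1) / fact l"
  have "((\<lambda>s. \<Sum>l<D. (s ^ l / fact l) *s (mpow N l *v w)) has_derivative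
    (\<lambda>h. \<Sum>l<D. (?d l * h) *s (mpow N l *v w))) (at s)"
  proof (intro has_derivative_sum)
    fix l
    have "((\<lambda>s::complex. s ^ l / fact l) has_field_derivative ?d l) (at s)"
      by (auto intro!: derivative_eq_intros)
    then have "((\<lambda>s. s ^ l / fact l) has_derivative (\<lambda>h. ?d l * h)) (at s)"
      by (simp only: has_field_derivative_def)
    then show "((\<lambda>s. (s ^ l / fact l) *s (mpow N l *v w)) has_derivative (\<lambda>h. (?d l * h) *s (mpow N l *v w))) (at s)"
      by (rule bounded_linear.has_derivative[OF bounded_linear_smult_vec])
  qed
  moreover have "(\<Sum>l<D. (?d l * h) *s (mpow N l *v w)) = h *s (N *v (mexp D N s *v w))" for h
  proof -
    have "(\<Sum>l<D. (?d l * h) *s (mpow N l *v w)) = (\<Sum>l<D'. (?d (Suc l) * h) *s (mpow N (Suc l) *v w))"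
      unfolding D' by (subst sum.lessThan_Suc_shift) simp
    also have "\<dots> = (\<Sum>l<D'. h *s ((s ^ l / fact l) *s (mpow N (Suc l) *v w)))"
    proof (intro sum.cong refl)
      fix l
      have "?d (Suc l) = s ^ l / fact l" by (simp del: of_nat_Suc)
      then show "(?d (Suc l) * h) *s (mpow N (Suc l) *v w) = h *s ((s ^ l / fact l) *s (mpow N (Suc l) *v w))"
        by (simp only: vector_smult_assoc mult.commute)
    qed
    also have "\<dots> = (\<Sum>l<D. h *s ((s ^ l / fact l) *s (mpow N (Suc l) *v w)))"
      using N unfolding D' by (subst sum.lessThan_Suc) (simp add: D')
    also have "\<dots> = h *s (N *v (mexp D N s *v w))"
      by (simp add: mexp_mult_vec matrix_vector_mult_sum vector_scalar_commute matrix_vector_mul_assoc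
          vec.scale_sum_right)
    finally show ?thesis .
  qed
  ultimately show ?thesis by (simp add: mexp_mult_vec[abs_def] mexp_mult_vec)
qed

text \<open>
  The point reached from \<open>z\<close> by following the nilpotent fields \<open>N i\<close> during the times \<open>t $ i\<close>, the
  last index of the list first. The matrix \<open>flow_gen D N is t j\<close> is \<open>N j\<close> transported to this end
  point: its field there is the derivative of the flow with respect to the time \<open>t $ j\<close>.
\<close>
primrec flow :: "nat \<Rightarrow> ('n::finite \<Rightarrow> complex^'n^'n) \<Rightarrow> 'n list \<Rightarrow> complex^'n \<Rightarrow> complex^'n \<Rightarrow> complex^'n" where
  "flow D N [] t z = z"
| "flow D N (i # is) t z = mexp D (N i) (t $ i) *v flow D N is t z"

primrec flow_gen :: "nat \<Rightarrow> ('n::finite \<Rightarrow> complex^'n^'n) \<Rightarrow> 'n list \<Rightarrow> complex^'n \<Rightarrow> 'n \<Rightarrow> complex^'n^'n" where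
  "flow_gen D N [] t j = 0"
| "flow_gen D N (i # is) t j =
    (if j = i then N i else mexp D (N i) (t $ i) ** flow_gen D N is t j ** mexp D (N i) (- t $ i))"

lemma flow_cong: "(\<And>i. i \<in> set is \<Longrightarrow> t $ i = t' $ i) \<Longrightarrow> flow D N is t z = flow D N is t' z"
  by (induction "is") auto

lemma flow_0: "D \<noteq> 0 \<Longrightarrow> flow D N is 0 z = z"
  by (induction "is") (auto simp: mexp_0)

lemma flow_gen_0: "D \<noteq> 0 \<Longrightarrow> j \<in> set is \<Longrightarrow> flow_gen D N is 0 j = N j"
  by (induction "is") (auto simp: mexp_0)

lemma (in matrix_lie) flow_gen_g:
  assumes "\<And>i. mpow (N i) D = 0" "\<And>i. N i \<in> g"
  shows "flow_gen D N is t j \<in> g"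
  by (induction "is") (auto simp: subspace_0 subspace_g assms intro: mexp_conj_g)

lemma flow_has_derivative:
  assumes N: "\<And>i. mpow (N i) D = 0" and "distinct is" "j \<in> set is"
  shows "((\<lambda>s. flow D N is (t + s *s axis j 1) z) has_derivative
    (\<lambda>h. h *s (flow_gen D N is t j *v flow D N is t z))) (at 0)"
  using assms(2,3)
proof (induction "is")
  case (Cons i "is")
  show ?case
  proof (cases "j = i")
    case True
    have "flow D N is (t + s *s axis j 1) z = flow D N is t z" for s
      using Cons.prems True by (intro flow_cong) (auto simp: axis_def)
    moreover have "((\<lambda>s. mexp D (N i) (t $ i + s) *v flow D N is t z) has_derivative
      (\<lambda>h. h *s (N i *v (mexp D (N i) (t $ i + 0) *v flow D N is t z)))) (at 0)"
    proof (rule has_derivative_compose[of "\<lambda>s. t $ i + s" "\<lambda>h. h" 0 UNIV "\<lambda>s. mexp D (N i) s *v flow D N is t z"])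
      show "((+) (t $ i) has_derivative (\<lambda>h. h)) (at 0)" by (auto intro!: derivative_eq_intros)
    qed (rule mexp_has_derivative[OF N])
    ultimately show ?thesis using True by simp
  next
    case False
    let ?E = "mexp D (N i) (t $ i)"
    have "bounded_linear ((*v) ?E)" by (simp add: linear_conv_bounded_linear[symmetric])
    then have "((\<lambda>s. ?E *v flow D N is (t + s *s axis j 1) z) has_derivative
      (\<lambda>h. ?E *v (h *s (flow_gen D N is t j *v flow D N is t z)))) (at 0)"
      using Cons False by (intro bounded_linear.has_derivative[of "(*v) ?E"]) auto
    moreover have "mexp D (N i) (- t $ i) ** ?E = mat 1"
      using mexp_inverse[OF N, of i "- t $ i"] by simp
    then have "(?E ** flow_gen D N is t j ** mexp D (N i) (- t $ i)) *v (?E *v w) = ?E *v (flow_gen D N is t j *v w)" for w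
      by (simp add: matrix_vector_mul_assoc) (simp flip: matrix_mul_assoc)
    ultimately show ?thesis using False by (simp add: axis_def vector_scalar_commute)
  qed
qed simp

lemma continuous_on_mult_vec:
  fixes A :: "'a::topological_space \<Rightarrow> complex^'n::finite^'m::finite"
  assumes "continuous_on S A" "continuous_on S v"
  shows "continuous_on S (\<lambda>x. A x *v v x)"
  unfolding matrix_vector_mult_def
  by (intro continuous_on_vec_lambda continuous_intros assms)

lemma continuous_on_matrix_mult:
  fixes A :: "'a::topological_space \<Rightarrow> complex^'n::finite^'m::finite" and B :: "'a \<Rightarrow> complex^'k::finite^'n"
  assumes "continuous_on S A" "continuous_on S B"
  shows "continuous_on S (\<lambda>x. A x ** B x)"
  unfolding matrix_matrix_mult_def
  by (intro continuous_on_vec_lambda continuous_intros assms)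

lemma continuous_on_mexp: "continuous_on S t \<Longrightarrow> continuous_on S (\<lambda>x. mexp D N (t x))"
  unfolding mexp_def cscale_def by (intro continuous_on_vec_lambda continuous_intros) auto

lemma continuous_on_flow:
  "continuous_on UNIV (\<lambda>x. flow D N is (fst x) (snd x))"
  by (induction "is") (auto intro!: continuous_on_mult_vec continuous_on_mexp continuous_intros)

lemma continuous_on_flow_gen: "continuous_on UNIV (\<lambda>x. flow_gen D N is (fst x) j)"
proof (induction "is")
  case (Cons i "is")
  then show ?case
    by (cases "j = i") (auto intro!: continuous_on_matrix_mult continuous_on_mexp continuous_intros)
qed simp

lemma continuous_on_det:
  fixes A :: "'a::topological_space \<Rightarrow> complex^'n::finite^'n"
  assumes "continuous_on S A"
  shows "continuous_on S (\<lambda>x. det (A x))"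
  unfolding det_def by (intro continuous_intros assms)

section \<open>From flow relations to orbit relations\<close>

lemma one_form_linear:
  "one_form A x (u + v) = one_form A x u + one_form A x v"
  "one_form A x (c *s v) = c * one_form A x v"
  "one_form A x 0 = 0"
  by (simp_all add: one_form_def sum.distrib sum_distrib_left algebra_simps)

lemma one_form_sum: "one_form A x (sum f I) = (\<Sum>i\<in>I. one_form A x (f i))"
  by (induction I rule: infinite_finite_induct) (auto simp: one_form_linear)

text \<open>
  The fields \<open>N i\<close> with \<open>i\<close> in the list span, together with the radial direction \<open>z0\<close> and a
  transversal direction \<open>u\<close>, the whole space at \<open>z0\<close>. The indices \<open>i0\<close> and \<open>i1\<close> only mark the columns
  of \<open>z0\<close> and \<open>u\<close> in the determinant that expresses this.
\<close>
locale flow_box = matrix_lie g for g :: "(complex^'n::finite^'n) set" +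
  fixes A :: "complex^'n \<Rightarrow> complex^'n" and a :: nat and D :: nat
    and N :: "'n \<Rightarrow> complex^'n^'n" and "is" :: "'n list" and i0 i1 :: 'n and z0 u :: "complex^'n"
  assumes A: "\<And>k. hom_poly_fun a (\<lambda>z. A z $ k)"
    and tangent: "\<And>M z. M \<in> g \<Longrightarrow> one_form A z (M *v z) = 0"
    and one_g: "mat 1 \<in> g"
    and N_g: "\<And>i. N i \<in> g" and N_nil: "\<And>i. mpow (N i) D = 0"
    and "is": "distinct is" "set is = - {i0, i1}" "i0 \<noteq> i1"
    and u: "one_form A z0 u \<noteq> 0"
    and det: "det (\<chi> r k. (if k = i0 then z0 else if k = i1 then u else N k *v z0) $ r) \<noteq> 0"
begin

abbreviation \<Phi> where "\<Phi> t z \<equiv> flow D N is t z"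
abbreviation K where "K t j \<equiv> flow_gen D N is t j"

definition cols where
  "cols t z k = (if k = i0 then \<Phi> t z else if k = i1 then u else K t k *v \<Phi> t z)"

definition box where
  "box = {x. det (\<chi> r k. cols (fst x) (snd x) k $ r) \<noteq> 0 \<and> one_form A (\<Phi> (fst x) (snd x)) u \<noteq> 0}"

lemma D_neq_0: "D \<noteq> 0"
  using N_nil mat_1_neq_0 by (cases D) auto

lemma open_box: "open box"
proof -
  have "continuous_on UNIV (\<lambda>x. det (\<chi> r k. cols (fst x) (snd x) k $ r))"
  proof (intro continuous_on_det continuous_on_vec_lambda continuous_on_component)
    fix k
    show "continuous_on UNIV (\<lambda>x. cols (fst x) (snd x) k)" using "is"(3)
      by (cases "k = i0"; cases "k = i1")
         (auto simp: cols_def intro!: continuous_on_mult_vec continuous_on_flow_gen continuous_on_flow)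
  qed
  moreover have "continuous_on UNIV (\<lambda>x. one_form A (\<Phi> (fst x) (snd x)) u)"
    unfolding one_form_def
    by (intro continuous_intros continuous_on_compose2[OF hom_continuous[OF A] continuous_on_flow]) auto
  ultimately show ?thesis
    unfolding box_def by (intro open_Collect_conj open_Collect_neq continuous_intros)
qed

lemma z0_box: "(0, z0) \<in> box"
proof -
  have "cols 0 z0 k = (if k = i0 then z0 else if k = i1 then u else N k *v z0)" for k
    using "is" by (simp add: cols_def flow_0[OF D_neq_0] flow_gen_0[OF D_neq_0])
  then show ?thesis using u det by (simp add: box_def flow_0[OF D_neq_0])
qed

text \<open>
  On the open set \<open>box\<close> the columns still form a basis. As \<open>M x\<close>, \<open>x\<close> and the transported fields are
  all annihilated by the form at \<open>x = \<Phi> t z\<close> while \<open>u\<close> is not, \<open>u\<close> does not occur in \<open>M x\<close>.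
\<close>
lemma tangent_span:
  assumes "(t, z) \<in> box" "M \<in> g"
  shows "\<exists>c. M *v \<Phi> t z = c i0 *s \<Phi> t z + (\<Sum>k\<in>set is. c k *s (K t k *v \<Phi> t z))"
proof -
  let ?C = "\<chi> r k. cols t z k $ r"
  have "invertible ?C" using assms(1) by (simp add: box_def invertible_det_nz)
  then obtain c where c: "?C *v c = M *v \<Phi> t z"
    by (metis invertible_right_inverse matrix_vector_mul_assoc matrix_vector_mul_lid)
  have "?C *v c = (\<Sum>k\<in>UNIV. c $ k *s cols t z k)"
    by (simp add: matrix_vector_mult_def vec_eq_iff mult.commute)
  also have "\<dots> = c $ i0 *s cols t z i0 + (c $ i1 *s cols t z i1 + (\<Sum>k\<in>- {i0, i1}. c $ k *s cols t z k))"
  proof -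
    have U: "UNIV = insert i0 (insert i1 (- {i0, i1}))" by auto
    show ?thesis using "is"(3) by (subst U) simp
  qed
  also have "(\<Sum>k\<in>- {i0, i1}. c $ k *s cols t z k) = (\<Sum>k\<in>set is. c $ k *s (K t k *v \<Phi> t z))"
    unfolding "is"(2) by (intro sum.cong) (auto simp: cols_def)
  finally have eq: "M *v \<Phi> t z = c $ i0 *s \<Phi> t z + (c $ i1 *s u + (\<Sum>k\<in>set is. c $ k *s (K t k *v \<Phi> t z)))"
    using "is"(3) c by (simp add: cols_def)
  have "one_form A (\<Phi> t z) (M *v \<Phi> t z) = c $ i1 * one_form A (\<Phi> t z) u"
    unfolding eq one_form_linear one_form_sum
    using tangent[OF one_g, of "\<Phi> t z"] tangent[OF flow_gen_g[OF N_nil N_g]] by simp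
  then have "c $ i1 = 0" using tangent[OF assms(2)] assms(1) by (simp add: box_def)
  then show ?thesis using eq by (intro exI[of _ "($) c"]) simp
qed

text \<open>
  At \<open>\<Phi> t z\<close> the direction of \<open>M\<close> is a combination of the radial direction, where Euler's formula
  applies, and of the derivatives of \<open>\<Phi>\<close> with respect to the times, along which \<open>h\<close> stays zero.
\<close>
lemma vanishing_dop:
  assumes h: "hom_poly_fun m h" and 0: "\<And>t. (t, z) \<in> box \<Longrightarrow> h (\<Phi> t z) = 0"
    and M: "M \<in> g" and t: "(t, z) \<in> box"
  shows "dop M h (\<Phi> t z) = 0"
proof -
  have K0: "dir_deriv h (\<Phi> t z) (K t k *v \<Phi> t z) = 0" if k: "k \<in> set is" for k
  proof -
    have d: "((\<lambda>s. h (\<Phi> (t + s *s axis k 1) z)) has_field_derivative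
        dir_deriv h (\<Phi> (t + 0 *s axis k 1) z) (K t k *v \<Phi> t z)) (at 0)"
      by (rule hom_curve_derivative[OF h flow_has_derivative[OF N_nil "is"(1) k]])
    have "isCont (\<lambda>s. (t + s *s axis k 1, z)) 0"
      by (intro continuous_intros has_derivative_continuous[OF line_has_derivative])
    then have "((\<lambda>s. (t + s *s axis k 1, z)) \<longlongrightarrow> (t, z)) (at 0)" by (simp add: isCont_def)
    then have "\<forall>\<^sub>F s in at 0. (t + s *s axis k 1, z) \<in> box" using open_box t by (rule topological_tendstoD)
    then have "\<forall>\<^sub>F s in nhds 0. (t + s *s axis k 1, z) \<in> box" using t by (simp add: eventually_nhds_conv_at)
    then have "\<forall>\<^sub>F s in nhds 0. h (\<Phi> (t + s *s axis k 1) z) = 0" by eventually_elim (rule 0)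
    then have "deriv (\<lambda>s. h (\<Phi> (t + s *s axis k 1) z)) 0 = deriv (\<lambda>_. 0) 0" by (intro deriv_cong_ev refl)
    then show ?thesis using DERIV_imp_deriv[OF d] by simp
  qed
  obtain c where c: "M *v \<Phi> t z = c i0 *s \<Phi> t z + (\<Sum>k\<in>set is. c k *s (K t k *v \<Phi> t z))"
    using tangent_span[OF t M] by blast
  have sum: "dir_deriv h x (sum f I) = (\<Sum>i\<in>I. dir_deriv h x (f i))" for x I and f :: "'n \<Rightarrow> complex^'n"
    by (induction I rule: infinite_finite_induct) (auto simp: hom_has_derivative(3,4)[OF h])
  show ?thesis
    unfolding dop_def c hom_has_derivative(2,3)[OF h] sum
    using K0 hom_euler[OF h] 0[OF t] by simp
qed

lemma vanishing_dword:
  assumes h: "hom_poly_fun m h" and 0: "\<And>t. (t, z) \<in> box \<Longrightarrow> h (\<Phi> t z) = 0"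
    and "set Ms \<subseteq> g" "(t, z) \<in> box"
  shows "dword Ms h (\<Phi> t z) = 0"
  using assms(3,4)
proof (induction Ms arbitrary: t)
  case (Cons M Ms)
  then show ?case
    by (auto intro!: vanishing_dop[OF hom_dword[OF h]])
qed (simp add: 0)

lemma orbit_relation_of_flow_relation:
  assumes p: "\<And>\<alpha>. \<alpha> \<in> expos m \<Longrightarrow> hom_poly_fun b (p \<alpha>)"
    and rel: "\<And>t z. (\<Sum>\<alpha>\<in>expos m. p \<alpha> z * monomial_fun \<alpha> (\<Phi> t z)) = 0"
  shows "orbit_relation g {z. (0, z) \<in> box} m b p"
  unfolding orbit_relation_def
proof (intro conjI ballI allI impI p)
  fix z Ms assume z: "z \<in> {z. (0, z) \<in> box}" and Ms: "set Ms \<subseteq> g"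
  define h where "h x = (\<Sum>\<alpha>\<in>expos m. p \<alpha> z * monomial_fun \<alpha> x)" for x
  have hm: "hom_poly_fun m h" unfolding h_def by (intro hom_sum hom_monomial)
  have "dword Ms h (\<Phi> 0 z) = 0"
    using z Ms rel by (intro vanishing_dword[OF hm]) (auto simp: h_def)
  then show "(\<Sum>\<alpha>\<in>expos m. p \<alpha> z * dword Ms (monomial_fun \<alpha>) z) = 0"
    by (simp add: h_def[abs_def] dword_sum[of "expos m" m] hom_mono flow_0[OF D_neq_0])
qed

lemma open_slice: "open {z. (0, z) \<in> box}"
proof -
  have "{z. (0, z) \<in> box} = Pair 0 -` box" by auto
  also have "open \<dots>" by (intro open_vimage open_box continuous_intros)
  finally show ?thesis .
qed

end

section \<open>Counting monomials\<close>

interpretation fs: vector_space "\<lambda>(c::complex) f x. c * f x"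
  by unfold_locales (auto simp: fun_eq_iff algebra_simps)

lemma ex_linear_relation:
  fixes f :: "'i \<Rightarrow> 'a \<Rightarrow> complex"
  assumes J: "finite J" and G: "finite G" "card G < card J"
    and f: "\<And>j. j \<in> J \<Longrightarrow> f j \<in> fs.span G"
  shows "\<exists>c. (\<exists>j\<in>J. c j \<noteq> 0) \<and> (\<forall>x. (\<Sum>j\<in>J. c j * f j x) = 0)"
proof (cases "inj_on f J")
  case False
  then obtain i j where ij: "i \<in> J" "j \<in> J" "i \<noteq> j" "f i = f j" by (auto simp: inj_on_def)
  let ?c = "\<lambda>k. if k = i then (1::complex) else if k = j then - 1 else 0"
  have "(\<Sum>k\<in>J. ?c k * f k x) = 0" for x
  proof -
    have "(\<Sum>k\<in>J. ?c k * f k x) = (\<Sum>k\<in>{i, j}. ?c k * f k x)"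
      using ij J by (intro sum.mono_neutral_right) auto
    then show ?thesis using ij by simp
  qed
  moreover have "\<exists>k\<in>J. ?c k \<noteq> 0" using ij by (intro bexI[of _ i]) auto
  ultimately show ?thesis by (intro exI[of _ ?c]) auto
next
  case True
  have "fs.dependent (f ` J)"
  proof (rule ccontr)
    assume "\<not> fs.dependent (f ` J)"
    then have "card (f ` J) \<le> card G"
      using fs.independent_span_bound[OF G(1)] f by (simp add: image_subset_iff)
    then show False using G(2) card_image[OF True] by simp
  qed
  then obtain u where u: "\<exists>v\<in>f ` J. u v \<noteq> 0" "(\<Sum>v\<in>f ` J. (\<lambda>x. u v * v x)) = 0"
    using fs.dependent_finite[of "f ` J"] J by auto
  have "(\<Sum>j\<in>J. u (f j) * f j x) = 0" for x
  proof -
    have "(\<Sum>j\<in>J. u (f j) * f j x) = (\<Sum>v\<in>f ` J. (\<lambda>x. u v * v x)) x"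
      unfolding sum.reindex[OF True] o_def by (induction J rule: infinite_finite_induct) auto
    then show ?thesis using u(2) by simp
  qed
  then show ?thesis using u(1) by (intro exI[of _ "\<lambda>j. u (f j)"]) auto
qed

lemma card_expos_le: "card (expos d :: ('n::finite \<Rightarrow> nat) set) \<le> (d + 1) ^ (CARD('n) - 1)"
proof -
  fix i0 :: 'n
  let ?r = "\<lambda>\<alpha>::'n \<Rightarrow> nat. restrict \<alpha> (- {i0})"
  have "inj_on ?r (expos d)"
  proof (rule inj_onI)
    fix \<alpha> \<beta> :: "'n \<Rightarrow> nat" assume ab: "\<alpha> \<in> expos d" "\<beta> \<in> expos d" "?r \<alpha> = ?r \<beta>"
    have eq: "\<alpha> i = \<beta> i" if "i \<noteq> i0" for i using fun_cong[OF ab(3), of i] that by simp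
    have "\<alpha> i0 + sum \<alpha> (UNIV - {i0}) = \<beta> i0 + sum \<beta> (UNIV - {i0})"
      using ab(1,2) by (simp add: expos_def sum.remove[of UNIV i0])
    moreover have "sum \<alpha> (UNIV - {i0}) = sum \<beta> (UNIV - {i0})" by (intro sum.cong) (auto simp: eq)
    ultimately have "\<alpha> i0 = \<beta> i0" by simp
    then show "\<alpha> = \<beta>" using eq by (intro ext) metis
  qed
  moreover have "?r ` expos d \<subseteq> PiE (- {i0}) (\<lambda>_. {..d})"
  proof (rule image_subsetI)
    fix \<alpha> :: "'n \<Rightarrow> nat" assume "\<alpha> \<in> expos d"
    then have "\<alpha> i \<le> d" for i using member_le_sum[of i UNIV \<alpha>] by (simp add: expos_def)
    then show "?r \<alpha> \<in> PiE (- {i0}) (\<lambda>_. {..d})" by auto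
  qed
  ultimately have "card (expos d :: ('n \<Rightarrow> nat) set) \<le> card (PiE (- {i0}) (\<lambda>_. {..d}))"
    by (intro card_inj_on_le) (auto intro: finite_PiE)
  also have "\<dots> = (d + 1) ^ (CARD('n) - 1)"
    by (simp add: card_PiE Compl_eq_Diff_UNIV)
  finally show ?thesis .
qed

text \<open>
  All but one of the exponents can be chosen freely up to \<open>q\<close>.
\<close>
lemma card_expos_ge:
  "(q + 1) ^ (CARD('n) - 1) \<le> card (expos ((CARD('n) - 1) * q) :: ('n::finite \<Rightarrow> nat) set)"
proof -
  fix i0 :: 'n
  let ?n = "CARD('n) - 1"
  let ?e = "\<lambda>f::'n \<Rightarrow> nat. f(i0 := ?n * q - sum f (- {i0}))"
  have cc: "card (- {i0}) = ?n" by (simp add: Compl_eq_Diff_UNIV)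
  have "inj_on ?e (PiE (- {i0}) (\<lambda>_. {..q}))"
  proof (rule inj_onI)
    fix f h assume fh: "f \<in> PiE (- {i0}) (\<lambda>_. {..q})" "h \<in> PiE (- {i0}) (\<lambda>_. {..q})" "?e f = ?e h"
    have "f i = h i" for i
    proof (cases "i = i0")
      case True then show ?thesis using fh(1,2) by (auto simp: PiE_def extensional_def)
    next
      case False then show ?thesis using fun_cong[OF fh(3), of i] by simp
    qed
    then show "f = h" by blast
  qed
  moreover have "?e ` PiE (- {i0}) (\<lambda>_. {..q}) \<subseteq> expos (?n * q)"
  proof (rule image_subsetI)
    fix f assume f: "f \<in> PiE (- {i0}) (\<lambda>_. {..q})"
    have "sum f (- {i0}) \<le> (\<Sum>i\<in>- {i0}. q)" using f by (intro sum_mono) (auto simp: PiE_def Pi_def)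
    then have le: "sum f (- {i0}) \<le> ?n * q" by (simp add: cc)
    have "sum (?e f) UNIV = ?n * q - sum f (- {i0}) + sum (?e f) (UNIV - {i0})"
      by (simp add: sum.remove[of UNIV i0])
    also have "sum (?e f) (UNIV - {i0}) = sum f (- {i0})"
      unfolding Compl_eq_Diff_UNIV by (intro sum.cong) auto
    finally show "?e f \<in> expos (?n * q)" using le by (simp add: expos_def)
  qed
  ultimately have "card (PiE (- {i0}) (\<lambda>_. {..q})) \<le> card (expos (?n * q) :: ('n \<Rightarrow> nat) set)"
    by (intro card_inj_on_le) auto
  then show ?thesis by (simp add: card_PiE cc)
qed

lemma counting_inequality:
  fixes n D :: nat
  assumes "n \<ge> 1"
  shows "\<exists>q. (n * q * D + 1) ^ (n - 1) * (2 * (n * q) + 1) ^ n < ((q + 1) ^ n) ^ 2"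
proof -
  \<comment> \<open>The left side is at most \<open>q\<close> times the power \<open>2 n - 1\<close> of \<open>q + 1\<close>.\<close>
  define q where "q = (n * D + 1) ^ (n - 1) * (2 * n + 1) ^ n"
  have "(n * q * D + 1) ^ (n - 1) * (2 * (n * q) + 1) ^ n
    \<le> ((n * D + 1) * (q + 1)) ^ (n - 1) * ((2 * n + 1) * (q + 1)) ^ n"
    by (intro mult_mono power_mono) (auto simp: algebra_simps)
  also have "\<dots> = q * (q + 1) ^ ((n - 1) + n)"
    unfolding q_def by (simp only: power_mult_distrib power_add mult_ac)
  also have "\<dots> < (q + 1) * (q + 1) ^ ((n - 1) + n)" by simp
  also have "\<dots> = (q + 1) ^ (n * 2)" using assms by (simp flip: power_Suc add: mult_2_right)
  finally show ?thesis by (auto simp: power_mult)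
qed

section \<open>Polynomials in the times and the starting point\<close>

definition tz_monomials :: "nat \<Rightarrow> ('n::finite \<Rightarrow> nat) \<Rightarrow> ((complex^'n) \<times> (complex^'n) \<Rightarrow> complex) set" where
  "tz_monomials a b =
    (\<lambda>(\<kappa>, \<alpha>) (t, z). monomial_fun \<kappa> t * monomial_fun \<alpha> z) ` ({\<kappa>. \<forall>i. \<kappa> i \<le> b i} \<times> expos a)"

lemma box_eq_PiE: "{\<kappa>. \<forall>i. \<kappa> i \<le> b i} = PiE UNIV (\<lambda>i. {..b i :: nat})" by auto

lemma finite_tz_monomials: "finite (tz_monomials a b)"
  unfolding tz_monomials_def box_eq_PiE by (intro finite_imageI finite_cartesian_product finite_PiE) auto

lemma card_tz_monomials_le:
  fixes b :: "'n::finite \<Rightarrow> nat"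
  shows "card (tz_monomials a b) \<le> (\<Prod>i\<in>UNIV. b i + 1) * card (expos a :: ('n \<Rightarrow> nat) set)"
proof -
  have "finite ({\<kappa>. \<forall>i. \<kappa> i \<le> b i} \<times> (expos a :: ('n \<Rightarrow> nat) set))"
    unfolding box_eq_PiE by (intro finite_cartesian_product finite_PiE) auto
  then have "card (tz_monomials a b) \<le> card ({\<kappa>. \<forall>i. \<kappa> i \<le> b i} \<times> (expos a :: ('n \<Rightarrow> nat) set))"
    unfolding tz_monomials_def by (rule card_image_le)
  then show ?thesis by (simp add: card_cartesian_product box_eq_PiE card_PiE)
qed

abbreviation tz_poly where "tz_poly a b f \<equiv> f \<in> fs.span (tz_monomials a b)"

lemma tz_base: "(\<And>i. \<kappa> i \<le> b i) \<Longrightarrow> \<alpha> \<in> expos a \<Longrightarrow> tz_poly a b (\<lambda>(t, z). monomial_fun \<kappa> t * monomial_fun \<alpha> z)"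
  by (rule fs.span_base) (auto simp: tz_monomials_def intro!: image_eqI[of _ _ "(\<kappa>, \<alpha>)"])

lemma tz_add: "tz_poly a b f \<Longrightarrow> tz_poly a b h \<Longrightarrow> tz_poly a b (\<lambda>x. f x + h x)"
  using fs.span_add[of f _ h] by (simp add: plus_fun_def)

lemma tz_cmult: "tz_poly a b f \<Longrightarrow> tz_poly a b (\<lambda>x. c * f x)"
  by (rule fs.span_scale)

lemma tz_sum: "(\<And>i. i \<in> I \<Longrightarrow> tz_poly a b (f i)) \<Longrightarrow> tz_poly a b (\<lambda>x. \<Sum>i\<in>I. f i x)"
proof (induction I rule: infinite_finite_induct)
  case (insert i I)
  then have "tz_poly a b (\<lambda>x. f i x + (\<Sum>i\<in>I. f i x))" by (intro tz_add) auto
  then show ?case using insert.hyps by simp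
qed (use fs.span_zero in \<open>auto simp: zero_fun_def\<close>)

lemma monomial_add: "monomial_fun \<alpha> z * monomial_fun \<beta> z = monomial_fun (\<lambda>i. \<alpha> i + \<beta> i) z"
  by (simp add: monomial_fun_def power_add prod.distrib)

lemma expos_add: "\<alpha> \<in> expos a \<Longrightarrow> \<beta> \<in> expos b \<Longrightarrow> (\<lambda>i. \<alpha> i + \<beta> i) \<in> expos (a + b)"
  by (simp add: expos_def sum.distrib)

lemma tz_mult:
  assumes f: "tz_poly a b f" and h: "tz_poly a' b' h"
  shows "tz_poly (a + a') (\<lambda>i. b i + b' i) (\<lambda>x. f x * h x)"
proof -
  let ?S = "fs.span (tz_monomials (a + a') (\<lambda>i. b i + b' i))"
  have base: "(\<lambda>x. f x * h x) \<in> ?S" if fh: "f \<in> tz_monomials a b" "h \<in> tz_monomials a' b'" for f h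
  proof -
    obtain \<kappa> \<alpha> \<kappa>' \<alpha>' where *: "\<And>i. \<kappa> i \<le> b i" "\<alpha> \<in> expos a" "\<And>i. \<kappa>' i \<le> b' i" "\<alpha>' \<in> expos a'"
      and f: "f = (\<lambda>(t, z). monomial_fun \<kappa> t * monomial_fun \<alpha> z)"
      and h: "h = (\<lambda>(t, z). monomial_fun \<kappa>' t * monomial_fun \<alpha>' z)"
      using fh by (auto simp: tz_monomials_def)
    have "(\<lambda>x. f x * h x) = (\<lambda>(t, z). monomial_fun (\<lambda>i. \<kappa> i + \<kappa>' i) t * monomial_fun (\<lambda>i. \<alpha> i + \<alpha>' i) z)"
      by (auto simp: f h fun_eq_iff monomial_add[symmetric])
    then show ?thesis using * by (auto intro!: tz_base expos_add add_mono)
  qed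
  have sub: "fs.subspace {f. (\<lambda>x. f x * h x) \<in> ?S}" for h
  proof (rule fs.subspaceI)
    show "0 \<in> {f. (\<lambda>x. f x * h x) \<in> ?S}" using fs.span_zero by (simp add: zero_fun_def)
  next
    fix x y assume "x \<in> {f. (\<lambda>x. f x * h x) \<in> ?S}" "y \<in> {f. (\<lambda>x. f x * h x) \<in> ?S}"
    then show "x + y \<in> {f. (\<lambda>x. f x * h x) \<in> ?S}" using tz_add by (simp add: distrib_right)
  next
    fix c x assume "x \<in> {f. (\<lambda>x. f x * h x) \<in> ?S}"
    then show "(\<lambda>xa. c * x xa) \<in> {f. (\<lambda>x. f x * h x) \<in> ?S}" using tz_cmult by (simp add: mult.assoc)
  qed
  have 1: "(\<lambda>x. f x * h x) \<in> ?S" if h: "h \<in> tz_monomials a' b'" for h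
    using fs.span_induct[OF f sub[of h]] base[OF _ h] by simp
  have "(\<lambda>x. h x * f x) \<in> ?S"
    using fs.span_induct[OF h sub[of f]] 1 by (simp add: mult.commute)
  then show ?thesis by (simp add: mult.commute)
qed

lemma tz_mono: "(\<And>i. b i \<le> b' i) \<Longrightarrow> tz_poly a b f \<Longrightarrow> tz_poly a b' f"
  using fs.span_mono[of "tz_monomials a b" "tz_monomials a b'"] order_trans
  unfolding tz_monomials_def by (fastforce)

lemma tz_one: "tz_poly 0 (\<lambda>_. 0) (\<lambda>x. 1)"
  using tz_base[of "\<lambda>_. 0" "\<lambda>_. 0" "\<lambda>_. 0" 0] by (simp add: expos_0 monomial_zero case_prod_unfold)

lemma tz_start: "tz_poly 1 (\<lambda>_. 0) (\<lambda>x. snd x $ k)"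
  using tz_base[of "\<lambda>_. 0" "\<lambda>_. 0" "(\<lambda>_. 0)(k := Suc 0)" 1] expos_Suc[of "\<lambda>_. 0" 0 k] monomial_Suc[of "\<lambda>_. 0" k]
  by (simp add: expos_0 monomial_zero case_prod_unfold)

lemma tz_time: "l \<le> D \<Longrightarrow> tz_poly 0 (\<lambda>j. if j = i then D else 0) (\<lambda>x. (fst x $ i) ^ l)"
proof -
  assume "l \<le> D"
  moreover have "monomial_fun (\<lambda>j. if j = i then l else 0) t = (t $ i) ^ l" for t
  proof -
    have "monomial_fun (\<lambda>j. if j = i then l else 0) t = (\<Prod>j\<in>UNIV. if j = i then t $ j ^ l else 1)"
      unfolding monomial_fun_def by (intro prod.cong) auto
    then show ?thesis by simp
  qed
  ultimately show ?thesis
    using tz_base[of "\<lambda>j. if j = i then l else 0" "\<lambda>j. if j = i then D else 0" "\<lambda>_. 0" 0]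
    by (simp add: expos_0 monomial_zero case_prod_unfold)
qed

text \<open>
  Each time enters through a single exponential of a nilpotent matrix, so its degree is bounded
  independently of the others.
\<close>
lemma tz_flow:
  assumes "distinct is"
  shows "tz_poly 1 (\<lambda>j. if j \<in> set is then D else 0) (\<lambda>x. flow D N is (fst x) (snd x) $ k)"
  using assms
proof (induction "is" arbitrary: k)
  case Nil then show ?case using tz_start by simp
next
  case (Cons i "is")
  have eq: "flow D N (i # is) (fst x) (snd x) $ k
    = (\<Sum>l<D. (1 / fact l) * ((fst x $ i) ^ l * (\<Sum>p\<in>UNIV. mpow (N i) l $ k $ p * flow D N is (fst x) (snd x) $ p)))" for x
    by (simp add: mexp_mult_vec) (simp add: matrix_vector_mult_def)
  have "tz_poly (0 + 1) (\<lambda>j. (if j = i then D else 0) + (if j \<in> set is then D else 0))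
    (\<lambda>x. flow D N (i # is) (fst x) (snd x) $ k)"
    unfolding eq using Cons by (intro tz_sum tz_cmult tz_mult tz_time) auto
  then have "tz_poly 1 (\<lambda>j. (if j = i then D else 0) + (if j \<in> set is then D else 0))
    (\<lambda>x. flow D N (i # is) (fst x) (snd x) $ k)" by simp
  then show ?case using Cons.prems by (elim tz_mono[rotated]) auto
qed

lemma tz_monomial_of:
  assumes f: "\<And>k. tz_poly 1 b (\<lambda>x. f x $ k)" and "\<alpha> \<in> expos m"
  shows "tz_poly m (\<lambda>j. m * b j) (\<lambda>x. monomial_fun \<alpha> (f x))"
  using assms(2)
proof (induction m arbitrary: \<alpha>)
  case 0 then show ?case using tz_one by (simp add: expos_0 monomial_zero)
next
  case (Suc m)
  then obtain i \<beta> where \<beta>: "\<beta> \<in> expos m" "\<alpha> = \<beta>(i := Suc (\<beta> i))" using expos_SucE by blast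
  show ?case using tz_mult[OF f[of i] Suc.IH[OF \<beta>(1)]] unfolding \<beta>(2) monomial_Suc by simp
qed

context flow_box
begin

text \<open>
  There are \<open>(card (expos m))^2\<close> products \<open>z^\<beta> * (\<Phi> t z)^\<alpha>\<close>, at least \<open>(q + 1)^(2 n)\<close> for
  \<open>m = n q\<close> and \<open>n = CARD('n) - 1\<close>. They lie in a space of polynomials in \<open>t\<close> and \<open>z\<close> whose dimension
  is \<open>O(q^(2 n - 1))\<close>, since there are only \<open>n - 1\<close> times.
\<close>
lemma ex_flow_relation:
  "\<exists>m p \<alpha> z1. (\<forall>\<alpha>\<in>expos m. hom_poly_fun m (p \<alpha>)) \<and> \<alpha> \<in> expos m \<and> p \<alpha> z1 \<noteq> 0 \<and>
     (\<forall>t z. (\<Sum>\<alpha>\<in>expos m. p \<alpha> z * monomial_fun \<alpha> (\<Phi> t z)) = 0)"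
proof -
  let ?n = "CARD('n) - 1"
  have card2: "card {i0, i1} = 2" using "is"(3) by simp
  then have "2 \<le> CARD('n)" using card_mono[of UNIV "{i0, i1}"] by simp
  then have n1: "?n \<ge> 1" by simp
  obtain q where q: "(?n * q * D + 1) ^ (?n - 1) * (2 * (?n * q) + 1) ^ ?n < ((q + 1) ^ ?n) ^ 2"
    using counting_inequality[OF n1] by blast
  define m where "m = ?n * q"
  define b where "b j = m * (if j \<in> set is then D else 0)" for j
  define E where "E = (expos m :: ('n \<Rightarrow> nat) set)"
  define f where "f ab x = monomial_fun (snd ab) (snd x) * monomial_fun (fst ab) (\<Phi> (fst x) (snd x))"
    for ab :: "('n \<Rightarrow> nat) \<times> ('n \<Rightarrow> nat)" and x :: "(complex^'n) \<times> (complex^'n)"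
  have f: "tz_poly (m + m) b (f ab)" if abE: "ab \<in> E \<times> E" for ab
  proof -
    obtain \<alpha> \<beta> where ab: "ab = (\<alpha>, \<beta>)" "\<alpha> \<in> expos m" "\<beta> \<in> expos m" using abE by (auto simp: E_def)
    have 1: "tz_poly m (\<lambda>j. 0) (\<lambda>x. monomial_fun \<beta> (snd x))"
      using tz_base[of "\<lambda>_. 0" "\<lambda>_. 0" \<beta> m] ab(3) by (simp add: monomial_zero case_prod_unfold)
    have 2: "tz_poly m b (\<lambda>x. monomial_fun \<alpha> (\<Phi> (fst x) (snd x)))"
      unfolding b_def by (rule tz_monomial_of[OF tz_flow[OF "is"(1)] ab(2)])
    show ?thesis using tz_mult[OF 1 2] by (simp add: f_def[abs_def] ab(1))
  qed
  have "card (tz_monomials (m + m) b :: ((complex^'n) \<times> (complex^'n) \<Rightarrow> complex) set) < card (E \<times> E)"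
  proof -
    have "(\<Prod>j\<in>UNIV. b j + 1) = (\<Prod>j\<in>UNIV. if j \<in> set is then m * D + 1 else 1)"
      by (intro prod.cong) (auto simp: b_def)
    also have "\<dots> = (m * D + 1) ^ card (set is)" by (simp add: prod.If_cases)
    also have "card (set is) = ?n - 1"
      unfolding "is"(2) Compl_eq_Diff_UNIV using card2 by (subst card_Diff_subset) auto
    finally have b: "(\<Prod>j\<in>UNIV. b j + 1) = (m * D + 1) ^ (?n - 1)" .
    have "card (tz_monomials (m + m) b :: ((complex^'n) \<times> (complex^'n) \<Rightarrow> complex) set)
      \<le> (m * D + 1) ^ (?n - 1) * card (expos (m + m) :: ('n \<Rightarrow> nat) set)"
      using card_tz_monomials_le[of "m + m" b] unfolding b .
    also have "\<dots> \<le> (m * D + 1) ^ (?n - 1) * (2 * m + 1) ^ ?n"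
      using card_expos_le[where 'n='n, of "m + m"] by (intro mult_left_mono) (auto simp: mult_2)
    also have "\<dots> < ((q + 1) ^ ?n) ^ 2" using q by (simp only: m_def)
    also have "\<dots> \<le> (card E) ^ 2"
      unfolding E_def m_def by (intro power_mono card_expos_ge) auto
    finally show ?thesis by (simp add: card_cartesian_product power2_eq_square)
  qed
  then have "\<exists>c. (\<exists>ab\<in>E \<times> E. c ab \<noteq> 0) \<and> (\<forall>x. (\<Sum>ab\<in>E \<times> E. c ab * f ab x) = 0)"
    by (intro ex_linear_relation[OF _ finite_tz_monomials]) (auto simp: E_def intro!: f)
  then obtain c where c: "\<exists>ab\<in>E \<times> E. c ab \<noteq> 0" "\<And>x. (\<Sum>ab\<in>E \<times> E. c ab * f ab x) = 0" by blast
  obtain \<alpha>0 \<beta>0 where c0: "\<alpha>0 \<in> E" "\<beta>0 \<in> E" "c (\<alpha>0, \<beta>0) \<noteq> 0" using c(1) by auto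
  define p where "p \<alpha> z = (\<Sum>\<beta>\<in>E. c (\<alpha>, \<beta>) * monomial_fun \<beta> z)" for \<alpha> z
  have "\<exists>z. p \<alpha>0 z \<noteq> 0"
  proof (rule ccontr)
    assume "\<not> ?thesis"
    then have "(\<Sum>\<beta>\<in>E. c (\<alpha>0, \<beta>) * monomial_fun \<beta> z) = 0" for z by (simp add: p_def)
    then have "c (\<alpha>0, \<beta>0) = 0"
      using monomial_independent[of E "\<lambda>\<beta>. c (\<alpha>0, \<beta>)" \<beta>0] c0(2) by (simp add: E_def)
    then show False using c0(3) by simp
  qed
  then obtain z1 where "p \<alpha>0 z1 \<noteq> 0" by blast
  moreover have "hom_poly_fun m (p \<alpha>)" for \<alpha>
    unfolding p_def E_def by (intro hom_sum hom_monomial)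
  moreover have "(\<Sum>\<alpha>\<in>E. p \<alpha> z * monomial_fun \<alpha> (\<Phi> t z)) = 0" for t z
  proof -
    have "(\<Sum>\<alpha>\<in>E. p \<alpha> z * monomial_fun \<alpha> (\<Phi> t z)) = (\<Sum>\<alpha>\<in>E. \<Sum>\<beta>\<in>E. c (\<alpha>, \<beta>) * f (\<alpha>, \<beta>) (t, z))"
      by (simp add: p_def f_def sum_distrib_right mult.assoc)
    also have "\<dots> = (\<Sum>ab\<in>E \<times> E. c ab * f ab (t, z))"
      by (simp add: sum.cartesian_product case_prod_unfold)
    finally show ?thesis using c(2) by simp
  qed
  ultimately show ?thesis using c0(1) unfolding E_def by blast
qed

lemma ex_invariant_ratio:
  "\<exists>d P Q. hom_poly_fun d P \<and> hom_poly_fun d Q \<and> (\<exists>z. Q z \<noteq> 0) \<and>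
    \<not> (\<exists>c. \<forall>z. Q z \<noteq> 0 \<longrightarrow> P z / Q z = c) \<and> (\<forall>M\<in>g. \<forall>z. dop M P z * Q z = P z * dop M Q z)"
proof -
  obtain m p \<alpha> z1 where p: "\<And>\<alpha>. \<alpha> \<in> expos m \<Longrightarrow> hom_poly_fun m (p \<alpha>)" "\<alpha> \<in> expos m" "p \<alpha> z1 \<noteq> 0"
    "\<And>t z. (\<Sum>\<alpha>\<in>expos m. p \<alpha> z * monomial_fun \<alpha> (\<Phi> t z)) = 0"
    using ex_flow_relation by blast
  show ?thesis
    using z0_box by (intro invariant_ratio_of_relation[OF open_slice, of z0, OF _
      orbit_relation_of_flow_relation[OF p(1,4)] p(2,3)]) simp
qed

end

section \<open>The first integral\<close>

text \<open>
  The derived algebra of a simple ideal is a nonzero ideal of it, hence all of it.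
\<close>
lemma semisimple_imp_perfect:
  assumes "semisimple_lie L"
  shows "derived_algebra L = L"
proof -
  have sub: "derived_algebra I \<subseteq> I" if "lie_subalgebra I" for I :: "'n::finite vfield set"
    unfolding derived_algebra_def
    using that by (intro vf.span_minimal) (auto simp: lie_subalgebra_def)
  from assms obtain S where L: "lie_subalgebra L" and
    S: "\<And>I. I \<in> S \<Longrightarrow> lie_ideal I L \<and> simple_lie I" "vf.span (\<Union>S) = L"
    by (auto simp: semisimple_lie_def)
  have "I \<subseteq> derived_algebra L" if I: "I \<in> S" for I
  proof -
    have simple: "simple_lie I" and "I \<subseteq> L" using S(1)[OF I] by (auto simp: lie_ideal_def)
    then have alg: "lie_subalgebra I" by (simp add: simple_lie_def)
    have "lie_ideal (derived_algebra I) I"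
      unfolding lie_ideal_def
    proof (intro conjI ballI)
      show "vf.subspace (derived_algebra I)" by (simp add: derived_algebra_def)
      show "lie_bracket X Y \<in> derived_algebra I" if "X \<in> I" "Y \<in> derived_algebra I" for X Y
        unfolding derived_algebra_def using that sub[OF alg] by (intro vf.span_base) auto
    qed (rule sub[OF alg])
    moreover have "derived_algebra I \<noteq> {0}"
    proof -
      obtain X Y where "X \<in> I" "Y \<in> I" "lie_bracket X Y \<noteq> 0" using simple by (auto simp: simple_lie_def)
      moreover from this have "lie_bracket X Y \<in> derived_algebra I"
        unfolding derived_algebra_def by (intro vf.span_base) auto
      ultimately show ?thesis by auto
    qed
    ultimately have "derived_algebra I = I" using simple unfolding simple_lie_def by blast
    moreover have "derived_algebra I \<subseteq> derived_algebra L"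
      unfolding derived_algebra_def using \<open>I \<subseteq> L\<close> by (intro vf.span_mono) blast
    ultimately show ?thesis by simp
  qed
  then have "vf.span (\<Union>S) \<subseteq> derived_algebra L"
    by (intro vf.span_minimal) (auto simp: derived_algebra_def)
  then show ?thesis using S(2) sub[OF L] by auto
qed

text \<open>
  All matrices over \<open>L\<close>; since the scalar matrices induce the zero field, they are included.
\<close>
definition lift :: "'n::finite vfield set \<Rightarrow> (complex^'n^'n) set" where
  "lift L = {M. vf_of M \<in> L}"

lemma lift_matrix_lie:
  assumes L: "lie_subalgebra L"
  shows "matrix_lie (lift L)"
proof
  have sub: "vf.subspace L" and br: "\<And>X Y. X \<in> L \<Longrightarrow> Y \<in> L \<Longrightarrow> lie_bracket X Y \<in> L"
    using L by (auto simp: lie_subalgebra_def)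
  show c: "cscale c M \<in> lift L" if "M \<in> lift L" for c M
    using that vf.subspace_scale[OF sub] by (simp add: lift_def vf_of_cscale)
  show "subspace (lift L)"
  proof (rule subspaceI)
    show "0 \<in> lift L" using vf.subspace_0[OF sub] by (simp add: lift_def vf_of_0)
    show "x + y \<in> lift L" if "x \<in> lift L" "y \<in> lift L" for x y
      using that vf.subspace_add[OF sub] by (simp add: lift_def vf_of_add)
    show "r *\<^sub>R x \<in> lift L" if "x \<in> lift L" for r x
      using c[OF that] by (simp add: scaleR_eq_cscale)
  qed
  show "comm M N \<in> lift L" if "M \<in> lift L" "N \<in> lift L" for M N
    using that br by (simp add: lift_def flip: lie_bracket_vf_of)
qed

lemma lift_one: "lie_subalgebra L \<Longrightarrow> mat 1 \<in> lift L"
  by (simp add: lift_def vf_of_mat_1 vf.subspace_0 lie_subalgebra_def)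

lemma lift_perfect:
  assumes L: "lie_subalgebra L" and perfect: "derived_algebra L = L"
  shows "lift L \<subseteq> span ({comm A B | A B. A \<in> lift L \<and> B \<in> lift L} \<union> range (\<lambda>c. cscale c (mat 1)))"
proof
  let ?C = "{comm A B | A B. A \<in> lift L \<and> B \<in> lift L}"
  interpret matrix_lie "lift L" by (rule lift_matrix_lie[OF L])
  have rep: "\<exists>M\<in>span ?C. X = vf_of M" if "X \<in> vf.span {lie_bracket X Y | X Y. X \<in> L \<and> Y \<in> L}" for X
    using that
  proof (induction rule: vf.span_induct_alt)
    case base then show ?case by (intro bexI[of _ 0]) (auto simp: vf_of_0 span_zero)
  next
    case (step c x y)
    then obtain X Y where XY: "x = lie_bracket X Y" "X \<in> L" "Y \<in> L" by blast
    then obtain A B where AB: "X = vf_of A" "Y = vf_of B"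
      using holo_vfield_linear L unfolding lie_subalgebra_def by (metis subsetD)
    obtain M where M: "M \<in> span ?C" "y = vf_of M" using step by blast
    have "cscale c B \<in> lift L" "A \<in> lift L" using XY AB cscale_g[of B c] by (auto simp: lift_def)
    then have "comm (cscale c B) A \<in> span ?C" by (intro span_base) blast
    moreover have "vf_scale c x + y = vf_of (comm (cscale c B) A + M)"
      by (simp add: XY AB M lie_bracket_vf_of vf_of_add vf_of_cscale)
    ultimately show ?case using M by (intro bexI[of _ "comm (cscale c B) A + M"]) (auto intro: span_add)
  qed
  fix M assume "M \<in> lift L"
  then have "vf_of M \<in> derived_algebra L" using perfect by (simp add: lift_def)
  then obtain M' where M': "M' \<in> span ?C" "vf_of M = vf_of M'"
    using rep unfolding derived_algebra_def by blast
  have "vf_of (M + cscale (-1) M') = 0"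
    unfolding vf_of_add vf_of_cscale using M'(2) by (simp add: fun_eq_iff vf_scale_def vec_eq_iff)
  then obtain c where c: "M + cscale (-1) M' = cscale c (mat 1)" using vf_of_eq_0_imp_scalar by blast
  then have "M = M' + cscale c (mat 1)" by (simp add: algebra_simps)
  moreover have "M' \<in> span (?C \<union> range (\<lambda>c. cscale c (mat 1)))"
    using M'(1) span_mono[of ?C "?C \<union> range (\<lambda>c. cscale c (mat 1))"] by blast
  ultimately show "M \<in> span (?C \<union> range (\<lambda>c. cscale c (mat 1)))"
    by (simp only:) (intro span_add, assumption, intro span_base, auto)
qed

lemma one_form_diff: "one_form A x (u - v) = one_form A x u - one_form A x v"
  by (simp add: one_form_def sum_subtractf algebra_simps)

lemma one_form_vf_of:
  assumes radial: "one_form A z z = 0" and z: "z $ i \<noteq> 0"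
  shows "one_form A z (vf_of M i z) = one_form A z (M *v z)"
proof -
  have "M *v z = vf_of M i z + ((M *v z) $ i / z $ i) *s z" using z by (simp add: vf_of_def)
  then show ?thesis by (metis one_form_linear(1,2) radial mult_zero_right add_0_right)
qed

lemma continuous_on_dir_deriv:
  "hom_poly_fun d f \<Longrightarrow> continuous_on UNIV (\<lambda>z. dir_deriv f z v)"
proof (induction rule: hom_poly_induct)
  case (coord d i f)
  have "dir_deriv (\<lambda>z. z $ i * f z) z v = z $ i * dir_deriv f z v + v $ i * f z" for z
    unfolding dir_deriv_def[of "\<lambda>z. z $ i * f z"]
    by (rule DERIV_imp_deriv) (auto intro!: derivative_eq_intros hom_line_derivative[OF coord.hyps])
  then show ?case using coord.IH hom_continuous[OF coord.hyps] by (auto intro!: continuous_intros)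
next
  case (add d f g)
  have "dir_deriv (\<lambda>z. f z + g z) z v = dir_deriv f z v + dir_deriv g z v" for z
    unfolding dir_deriv_def[of "\<lambda>z. f z + g z"]
    by (rule DERIV_imp_deriv) (auto intro!: derivative_eq_intros hom_line_derivative add.hyps)
  then show ?case using add.IH by (auto intro!: continuous_intros)
qed (auto simp: dir_deriv_def)

lemma scaleR_mult_vec: "(r *\<^sub>R M) *v z = of_real r *s (M *v (z :: complex^'n))"
  by (simp add: scaleR_eq_cscale)

text \<open>
  The vectors \<open>N z0\<close> for root vectors \<open>N\<close>, together with \<open>z0\<close>, span the kernel of the form at \<open>z0\<close>;
  select a basis among them.
\<close>
lemma ex_flow_box:
  fixes g :: "(complex^'n::finite^'n) set"
  assumes "matrix_lie g" and one: "mat 1 \<in> g"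
    and gen: "g = span (matrix_lie.all_root_vectors g \<union> range (\<lambda>c. cscale c (mat 1)))"
    and A: "\<And>k. hom_poly_fun a (\<lambda>z. A z $ k)"
    and tangent: "\<And>M z. M \<in> g \<Longrightarrow> one_form A z (M *v z) = 0"
    and z0: "z0 \<noteq> 0" "A z0 \<noteq> 0"
    and onto: "\<And>v. one_form A z0 v = 0 \<Longrightarrow> \<exists>M\<in>g. v = M *v z0"
  shows "\<exists>D N is i0 i1 u. flow_box g A a D N is i0 i1 z0 u"
proof -
  interpret matrix_lie g by fact
  let ?\<omega> = "one_form A z0"
  obtain k where k: "A z0 $ k \<noteq> 0" using z0(2) by (auto simp: vec_eq_iff)
  define u :: "complex^'n" where "u = axis k 1"
  have "?\<omega> u = A z0 $ k" by (simp add: one_form_def u_def axis_def if_distrib cong: if_cong)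
  then have u: "?\<omega> u \<noteq> 0" using k by simp
  define B0 where "B0 = (\<lambda>N. N *v z0) ` all_root_vectors"
  have ker: "v \<in> vec.span (insert z0 B0)" if v: "?\<omega> v = 0" for v
  proof -
    obtain M where M: "M \<in> g" "v = M *v z0" using onto[OF v] by blast
    have Mspan: "M \<in> span (all_root_vectors \<union> range (\<lambda>c. cscale c (mat 1)))"
      using gen M(1) by (rule subst)
    have "M *v z0 \<in> vec.span (insert z0 B0)"
      using Mspan
    proof (induction rule: span_induct_alt)
      case base then show ?case by (simp add: vec.span_zero)
    next
      case (step r x y)
      have "x *v z0 \<in> vec.span (insert z0 B0)"
        using step(1)
      proof
        assume "x \<in> all_root_vectors" then show ?thesis by (intro vec.span_base) (auto simp: B0_def)
      next
        assume "x \<in> range (\<lambda>c. cscale c (mat 1))"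
        then obtain c where "x = cscale c (mat 1)" by blast
        then show ?thesis by (simp add: vec.span_scale vec.span_base)
      qed
      with step show ?case
        by (simp add: matrix_vector_mult_add_rdistrib scaleR_mult_vec vec.span_add vec.span_scale)
    qed
    then show ?thesis by (simp add: M(2))
  qed
  have "vec.independent {z0}" using z0(1) by simp
  then obtain B where B: "{z0} \<subseteq> B" "B \<subseteq> insert z0 B0" "vec.independent B" "insert z0 B0 \<subseteq> vec.span B"
    using vec.maximal_independent_subset_extend[of "{z0}" "insert z0 B0"] by blast
  have kerB: "?\<omega> v = 0" if "v \<in> insert z0 B0" for v
    using that tangent[OF one, of z0] tangent all_roots_g by (auto simp: B0_def)
  have spanB: "?\<omega> v = 0" if "v \<in> vec.span B" for v
    using that
  proof (induction rule: vec.span_induct_alt)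
    case (step c x y) then show ?case using B(2) kerB[of x] by (auto simp: one_form_linear)
  qed (simp add: one_form_linear)
  then have uB: "u \<notin> vec.span B" using u by blast
  then have indep: "vec.independent (insert u B)" using B(3) by (simp add: vec.independent_insert)
  have spanU: "vec.span (insert u B) = UNIV"
  proof -
    have "v \<in> vec.span (insert u B)" for v
    proof -
      have "?\<omega> (v + (- (?\<omega> v / ?\<omega> u)) *s u) = 0" using u by (simp add: one_form_linear one_form_diff)
      then have "v + (- (?\<omega> v / ?\<omega> u)) *s u \<in> vec.span (insert z0 B0)" by (rule ker)
      also have "\<dots> \<subseteq> vec.span B" using B(4) by (rule vec.span_minimal) simp
      finally have 1: "v + (- (?\<omega> v / ?\<omega> u)) *s u \<in> vec.span (insert u B)"
        using vec.span_mono[of B "insert u B"] by blast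
      have 2: "(?\<omega> v / ?\<omega> u) *s u \<in> vec.span (insert u B)" by (intro vec.span_scale vec.span_base) simp
      show ?thesis using vec.span_add[OF 1 2] by (simp add: vec_eq_iff)
    qed
    then show ?thesis by blast
  qed
  have fin: "finite (insert u B)" using indep by (rule vec.finiteI_independent)
  have "card (insert u B) = CARD('n)"
    using vec.basis_card_eq_dim[of "insert u B" UNIV] indep spanU by (simp add: card_cart_basis)
  then obtain h where h: "bij_betw h (UNIV :: 'n set) (insert u B)"
    using fin finite_same_card_bij[of "UNIV :: 'n set" "insert u B"] by auto
  obtain i0 where i0: "h i0 = z0" using h B(1) by (metis bij_betw_iff_bijections insert_subset insertCI)
  obtain i1 where i1: "h i1 = u" using h by (metis bij_betw_iff_bijections insertI1)
  have neq: "i0 \<noteq> i1" using i0 i1 uB B(1) vec.span_base by blast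
  have "\<exists>N. N \<in> all_root_vectors \<and> h k = N *v z0" if "k \<noteq> i0" "k \<noteq> i1" for k
  proof -
    have "h k \<noteq> z0" "h k \<noteq> u" using that i0 i1 h by (auto simp: bij_betw_def inj_def)
    moreover have "h k \<in> insert u B" using h by (auto simp: bij_betw_def)
    ultimately show ?thesis using B(2) by (auto simp: B0_def)
  qed
  then obtain N' where N': "\<And>k. k \<noteq> i0 \<Longrightarrow> k \<noteq> i1 \<Longrightarrow> N' k \<in> all_root_vectors \<and> h k = N' k *v z0" by metis
  define N where "N k = (if k = i0 \<or> k = i1 then 0 else N' k)" for k
  have "\<exists>d. mpow (N k) d = 0" for k
  proof (cases "k = i0 \<or> k = i1")
    case True then show ?thesis by (intro exI[of _ 1]) (auto simp: N_def)
  next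
    case False then show ?thesis using all_roots_nilpotent N' by (auto simp: N_def)
  qed
  then obtain d where d: "\<And>k. mpow (N k) (d k) = 0" by metis
  define D where "D = sum d UNIV"
  have D: "mpow (N k) D = 0" for k
    using mpow_eq_0_mono[OF d[of k], of D] member_le_sum[of k UNIV d] by (simp add: D_def)
  obtain "is" where "is": "set is = - {i0, i1}" "distinct is" using finite_distinct_list[of "- {i0, i1}"] by auto
  have "det (\<chi> r k. (if k = i0 then z0 else if k = i1 then u else N k *v z0) $ r) \<noteq> 0"
  proof -
    have "(\<chi> r k. (if k = i0 then z0 else if k = i1 then u else N k *v z0) $ r) = (\<chi> r k. h k $ r)"
      using i0 i1 N' by (auto simp: vec_eq_iff N_def)
    moreover have "columns (\<chi> r k. h k $ r) = insert u B"
    proof -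
      have "column k (\<chi> r k. h k $ r) = h k" for k by (simp add: column_def vec_eq_iff)
      then have "columns (\<chi> r k. h k $ r) = range h" by (auto simp: columns_def)
      then show ?thesis using h by (simp add: bij_betw_def)
    qed
    ultimately show ?thesis
      using matrix_right_invertible_span_columns[of "\<chi> r k. h k $ r"] spanU
      by (simp flip: invertible_det_nz add: invertible_right_inverse)
  qed
  moreover have "N k \<in> g" for k
    using N' all_roots_g subspace_0[OF subspace_g] by (auto simp: N_def)
  ultimately have "flow_box g A a D N is i0 i1 z0 u"
    using A tangent one D "is" neq u by unfold_locales auto
  then show ?thesis by blast
qed

theorem mainTheorem10:
  fixes A :: "complex^'n::finite \<Rightarrow> complex^'n"
    and L :: "'n vfield set"
  assumes "L_foliation A L"
    and "semisimple_lie L \<or> derived_algebra L = L"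
  shows "has_rational_first_integral A"
proof -
  have perfect: "derived_algebra L = L" using assms(2) semisimple_imp_perfect by blast
  from assms(1) have fol: "codim_one_foliation A" and L: "lie_subalgebra L" and LA: "L = tangent_vfields A"
    and gener: "generically (\<lambda>z. A z \<noteq> 0 \<and> (\<forall>i. z $ i \<noteq> 0 \<longrightarrow> (\<lambda>X. X i z) ` L = leaf_tangent A i z))"
    by (auto simp: L_foliation_def)
  obtain a where A: "\<And>k. hom_poly_fun a (\<lambda>z. A z $ k)" and radial: "\<And>z. one_form A z z = 0"
    using fol by (auto simp: codim_one_foliation_def one_form_def mult.commute)
  obtain dg \<gamma> z\<gamma> where \<gamma>: "hom_poly_fun dg \<gamma>" "\<gamma> z\<gamma> \<noteq> 0"
    and gen0: "\<forall>z. z \<noteq> 0 \<and> \<gamma> z \<noteq> 0 \<longrightarrow>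
      A z \<noteq> 0 \<and> (\<forall>i. z $ i \<noteq> 0 \<longrightarrow> (\<lambda>X. X i z) ` L = leaf_tangent A i z)"
    using gener unfolding generically_def by blast
  have gen: "\<And>z. z \<noteq> 0 \<Longrightarrow> \<gamma> z \<noteq> 0 \<Longrightarrow> A z \<noteq> 0"
    "\<And>z i. z \<noteq> 0 \<Longrightarrow> \<gamma> z \<noteq> 0 \<Longrightarrow> z $ i \<noteq> 0 \<Longrightarrow> (\<lambda>X. X i z) ` L = leaf_tangent A i z"
    using gen0 by auto
  define g where "g = lift L"
  interpret matrix_lie g unfolding g_def by (rule lift_matrix_lie[OF L])
  have one: "mat 1 \<in> g" unfolding g_def by (rule lift_one[OF L])
  have gspan: "g = span (all_root_vectors \<union> range (\<lambda>c. cscale c (mat 1)))"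
    using perfect_spanned_by_roots[OF one] lift_perfect[OF L perfect] by (simp add: g_def)
  have tangent: "one_form A z (M *v z) = 0" if "M \<in> g" for M z
  proof (cases "z = 0")
    case False
    then obtain i where i: "z $ i \<noteq> 0" by (auto simp: vec_eq_iff)
    have "vf_of M \<in> tangent_vfields A" using that LA by (simp add: g_def lift_def)
    then have "one_form A z (vf_of M i z) = 0" using i by (simp add: tangent_vfields_def)
    then show ?thesis using one_form_vf_of[of A z i M] i radial by simp
  qed (simp add: one_form_linear)
  have onto: "\<exists>M\<in>g. v = M *v z" if z: "z \<noteq> 0" "\<gamma> z \<noteq> 0" and v: "one_form A z v = 0" for z v
  proof -
    obtain i where i: "z $ i \<noteq> 0" using z by (auto simp: vec_eq_iff)
    define b where "b = - (v $ i / z $ i)"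
    let ?w = "v + b *s z"
    have "?w \<in> leaf_tangent A i z"
      using i v radial by (simp add: leaf_tangent_def one_form_linear) (simp add: b_def)
    then have "?w \<in> (\<lambda>X. X i z) ` L" by (simp only: gen(2)[OF z i])
    then obtain X where X: "X \<in> L" "X i z = ?w" by (rule imageE) simp
    obtain M where M: "X = vf_of M" using holo_vfield_linear X(1) L unfolding lie_subalgebra_def by blast
    define c where "c = v $ i / z $ i - (M *v z) $ i / z $ i"
    have "M + cscale c (mat 1) \<in> g"
      using X(1) M one by (intro subspace_add subspace_g cscale_g) (auto simp: g_def lift_def)
    moreover have "v = (M + cscale c (mat 1)) *v z"
      using X(2) i by (simp add: M vf_of_def matrix_vector_mult_add_rdistrib c_def b_def vec_eq_iff algebra_simps)
    ultimately show ?thesis by blast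
  qed
  have "\<exists>z0. z0 \<noteq> 0 \<and> \<gamma> z0 \<noteq> 0"
  proof (rule ccontr)
    assume *: "\<not> ?thesis"
    fix i :: 'n
    have "axis i (1::complex) $ i = 0"
    proof (rule hom_dense[OF \<gamma>, of "\<lambda>z. z $ i"])
      show "z $ i = 0" if "\<gamma> z \<noteq> 0" for z
      proof -
        have "z = 0" using * that by blast
        then show ?thesis by simp
      qed
    qed (intro continuous_intros)
    then show False by simp
  qed
  then obtain z0 where z0: "z0 \<noteq> 0" "\<gamma> z0 \<noteq> 0" by blast
  obtain D N "is" i0 i1 u where "flow_box g A a D N is i0 i1 z0 u"
    using ex_flow_box[OF matrix_lie_axioms one gspan A tangent z0(1) gen(1)[OF z0] onto[OF z0]] by blast
  then have "\<exists>d P Q. hom_poly_fun d P \<and> hom_poly_fun d Q \<and> (\<exists>z. Q z \<noteq> 0) \<and>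
    \<not> (\<exists>c. \<forall>z. Q z \<noteq> 0 \<longrightarrow> P z / Q z = c) \<and> (\<forall>M\<in>g. \<forall>z. dop M P z * Q z = P z * dop M Q z)"
    by (rule flow_box.ex_invariant_ratio)
  then obtain d P Q where PQ0: "hom_poly_fun d P \<and> hom_poly_fun d Q \<and> (\<exists>z. Q z \<noteq> 0) \<and>
    \<not> (\<exists>c. \<forall>z. Q z \<noteq> 0 \<longrightarrow> P z / Q z = c) \<and> (\<forall>M\<in>g. \<forall>z. dop M P z * Q z = P z * dop M Q z)"
    by (elim exE) (rule that)
  note PQ = PQ0[THEN conjunct1] PQ0[THEN conjunct2, THEN conjunct1]
    PQ0[THEN conjunct2, THEN conjunct2, THEN conjunct1]
    PQ0[THEN conjunct2, THEN conjunct2, THEN conjunct2, THEN conjunct1]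
    PQ0[THEN conjunct2, THEN conjunct2, THEN conjunct2, THEN conjunct2]
  define \<theta> where "\<theta> z v = dir_deriv P z v * Q z - P z * dir_deriv Q z v" for z v
  have \<theta>_lin: "\<theta> z (c *s v + c' *s v') = c * \<theta> z v + c' * \<theta> z v'" for z v v' c c'
    by (simp add: \<theta>_def hom_has_derivative(2,3)[OF PQ(1)] hom_has_derivative(2,3)[OF PQ(2)] algebra_simps)
  have W0: "one_form A z u * \<theta> z v - one_form A z v * \<theta> z u = 0" for z u v
  proof -
    \<comment> \<open>Up to the factor \<open>(Q z)^2\<close> this is the value of \<open>\<omega> \<and> d(P/Q)\<close> at \<open>u, v\<close>. It is continuous in \<open>z\<close>, so it suffices to treat generic \<open>z\<close>.\<close>
    let ?W = "\<lambda>z. one_form A z u * \<theta> z v - one_form A z v * \<theta> z u"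
    have contW: "continuous_on UNIV ?W"
      unfolding \<theta>_def one_form_def
      by (intro continuous_intros hom_continuous[OF A] hom_continuous[OF PQ(1)] hom_continuous[OF PQ(2)]
          continuous_on_dir_deriv[OF PQ(1)] continuous_on_dir_deriv[OF PQ(2)])
    have W: "?W z = 0" if z: "z \<noteq> 0" "\<gamma> z \<noteq> 0" for z
    proof -
      have e: "one_form A z (one_form A z u *s v + (- one_form A z v) *s u) = 0"
        by (simp add: one_form_linear one_form_diff)
      obtain M where "M \<in> g" "one_form A z u *s v + (- one_form A z v) *s u = M *v z"
        using onto[OF z e] by blast
      then have "\<theta> z (one_form A z u *s v + (- one_form A z v) *s u) = 0"
        using PQ(5) by (simp add: \<theta>_def dop_def)
      then show ?thesis unfolding \<theta>_lin by simp
    qed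
    fix i :: 'n
    have "z $ i * ?W z = 0" for z
    proof (rule hom_dense[OF \<gamma>, of "\<lambda>z. z $ i * ?W z"])
      show "continuous_on UNIV (\<lambda>z. z $ i * ?W z)" by (intro continuous_intros contW)
      show "z $ i * ?W z = 0" if "\<gamma> z \<noteq> 0" for z using W[of z] that by (cases "z = 0") auto
    qed
    then have W': "z $ i * 1 \<noteq> 0 \<Longrightarrow> ?W z = 0" for z by (metis mult_eq_0_iff)
    show ?thesis
      by (rule hom_dense[OF hom_coord[OF hom_const, of i 1] _ contW W', of "axis i 1"]) simp_all
  qed
  have "wedge11 (one_form A z) (dir_deriv (\<lambda>x. P x / Q x) z) u v = 0" if Q: "Q z \<noteq> 0" for z u v
  proof -
    have dd: "dir_deriv (\<lambda>x. P x / Q x) z w = \<theta> z w / (Q z * Q z)" for w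
      unfolding dir_deriv_def[of "\<lambda>x. P x / Q x"]
      by (rule DERIV_imp_deriv)
         (use DERIV_divide[OF hom_line_derivative[OF PQ(1), of z w] hom_line_derivative[OF PQ(2), of z w]] Q
           in \<open>simp add: \<theta>_def\<close>)
    show ?thesis unfolding wedge11_def dd using W0[of z u v] by (simp flip: diff_divide_distrib)
  qed
  then show ?thesis
    unfolding has_rational_first_integral_def
    by (rule_tac exI[of _ d], rule_tac exI[of _ P], rule_tac exI[of _ Q]) (intro conjI PQ(1-4) allI impI)
qed

end
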